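(* Let $q\in\mathbb R$ (close to $1$), let $\mathcal F$ be a unitary minimal twist, let $\hat a_{K,n}$ ($0\le K\le N$) be the twisted mode operators, and let $S=S[\hat\Psi]$ be a polynomial in the $\hat a_{K,n}$ given by an invariant tensor of $\tilde U_q(su(2))$ (an invariant action) which is real, $S^*=S$, and such that $e^{-S_\star(a)}$ times any polynomial is integrable. Then the correlation functions $\langle P(\hat a)\rangle$ satisfy, for all noncommutative polynomials $P,Q$ in the modes: (1) (covariance) $\langle (u\,\tilde\triangleright_qP)(\hat a)\rangle=\varepsilon_q(u)\langle P(\hat a)\rangle$ for all $u\in\tilde U_q(su(2))$; (2) (hermiticity) $\langle P(\hat a)\rangle^*=\langle P(\hat a)^*\rangle$; (3) (positivity) $\langle P(\hat a)^*P(\hat a)\rangle\ge0$; (4) (twisted bosonic symmetry) $\langle P(\hat a)\,\hat a_{K,i}\hat a_{K',j}\,Q(\hat a)\rangle=\langle P(\hat a)\,\hat a_{K',k}\hat a_{K,l}\,\mathfrak R^{lk}_{ij}\,Q(\hat a)\rangle$. Moreover $\langle P(\hat a)\rangle=\langle P_\star(a)\rangle$, where $P_\star(a)$ denotes $P$ evaluated in the $\star$-product with bracketing $a_{1}\star(a_{2}\star(\cdots\star a_{k}))$ and $\langle P_\star(a)\rangle:=\int e^{-S_\star(a)}P_\star(a)\big/\int e^{-S_\star(a)}$.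
   Context: Hopf algebras: $U(su(2))$ has undeformed structure $(\Delta,\varepsilon,S)$ and star $H^*=H$, $(X^\pm)^*=X^\mp$. $U_q(su(2))$, $q=e^h$, has coproduct $\Delta_q$. $\tilde U_q(su(2))$ is $U_q(su(2))$ with flipped coproduct. $\varphi:U_q(su(2))\to U(su(2))$ is Drinfel'd's algebra isomorphism, a $*$-map (defined on finite-dimensional representations for real $q$ near $1$). A Drinfel'd twist $\mathcal F$ satisfies $(\varphi\otimes\varphi)\Delta_q(u)=\mathcal F\Delta(\varphi(u))\mathcal F^{-1}$, $(\varepsilon\otimes\mathrm{id})\mathcal F=\mathbf 1=(\mathrm{id}\otimes\varepsilon)\mathcal F$, $\mathcal F=\mathbf 1\otimes\mathbf 1+o(h)$, $(\varphi\otimes\varphi)\mathcal R=\mathcal F_{21}q^{t/2}\mathcal F^{-1}$ with $\mathcal R$ the universal $R$-matrix, $t=\Delta(C)-\mathbf 1\otimes C-C\otimes\mathbf 1$, $C$ the quadratic Casimir. It is unitary if $( *\otimes* )\mathcal F=\mathcal F^{-1}$, and minimal if its coassociator $\phi=[(\Delta\otimes\mathrm{id})\mathcal F^{-1}](\mathcal F^{-1}\otimes\mathbf 1)(\mathbf 1\otimes\mathcal F)[(\mathrm{id}\otimes\Delta)\mathcal F]$ equals $$\lim_{x_0,y_0\to0^+}\Big\{x_0^{-\frac h{2\pi i}t_{12}}\vec P\exp\Big[-\frac h{2\pi i}\int_{x_0}^{1-y_0}dx\Big(\frac{t_{12}}x+\frac{t_{23}}{x-1}\Big)\Big]y_0^{\frac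 h{2\pi i}t_{23}}\Big\}.$$ It is known that for a minimal twist $\mathcal G$ (in particular for $\tilde{\mathcal F}$ below) $\mathcal G\,\Delta(\mathcal G_2)(S(\mathcal G_1)\gamma'^{-1}\otimes1)=\mathbf 1\otimes \mathbf 1$ with $\gamma'=\mathcal G_2S(\mathcal G_1)$, the unindexed factor being an independent copy. Put $\tilde{\mathcal F}=\mathcal F_{21}$, the twist for $\tilde U_q(su(2))$. Modes: for each integer $0\le K\le N$, $a_{K,n}$ ($2K+1$ values of $n$) is a basis of the spin $K$ representation $\pi=\pi_K$, a unitary matrix representation, with $u\triangleright a_{K,n}=a_{K,m}\pi^m_n(u)$. $\mathcal A$ is the free commutative algebra generated by all of them, with star $a_{K,n}^*=g_c^{nm}a_{K,m}$, where $g_c=g_c^K$ is the real symmetric invariant tensor normalized by $g_c^{ij}g_c^{jk}=\delta^{ik}$. So $\mathcal A$ is the algebra of complex polynomial functions on $\prod_K\mathbb R^{2K+1}$; $\int$ denotes Lebesgue integration, which is invariant under $SO(3)$. $U(su(2))\ltimes\mathcal A$ is $\mathcal A\otimes U(su(2))$ with $ua=(u_{(1)}\triangleright a)u_{(2)}$. It acts on $\mathcal A$ (left vacuum representation) by multiplication and $\triangleright$, with vacuum $1$ satisfying $u\cdot1=\varepsilon(u)1$. Twisted operators: $\hat a_{K,n}=(\tilde{\mathcal F}_1^{-1}\triangleright a_{K,n})\tilde{\mathcal F}_2^{-1}$; twisted product: $a\star b=(\tilde{\mathcal F}_1^{-1}\triangleright a)(\tilde{\mathcal F}_2^{-1}\triangleright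 b)$. For a noncommutative polynomial $P$ with complex coefficients, $P(\hat a)$ is obtained by substitution. $u\in\tilde U_q(su(2))$ acts on noncommutative polynomials $P$ through the coproduct of $\tilde U_q(su(2))$ and $\pi\circ\varphi$ on the generators; this is $u\,\tilde\triangleright_qP$. $P(\hat a)^*$ is the star in $U(su(2))\ltimes\mathcal A$, equivalently the formal operator adjoint with respect to $\langle f,g\rangle=\int f^*g$. Correlation functions: for an invariant polynomial $S$, $S(\hat a)$ commutes with $U(su(2))$ and acts on invariant functions as multiplication by the invariant function $S_\star(a)$. The correlation function $$\langle P(\hat a)\rangle=\frac{\int\mathcal D\hat\Psi\,e^{-S[\hat\Psi]}P(\hat a)}{\int\mathcal D\hat\Psi\,e^{-S[\hat\Psi]}}$$ is defined by evaluating $U(su(2))$ factors with $\varepsilon$ (acting on the vacuum $1$) and integrating; only the singlet part of $P$ contributes, so the numerator is $\int e^{-S_\star(a)}\,(P(\hat a)\cdot1)$ and the denominator is $\int e^{-S_\star(a)}$. Elements of $U(su(2))$ appearing inside (such as $\mathfrak R^{lk}_{ij}$) act as operators to their right. Exchange matrix: with $\tilde{\mathcal R}=\tilde{\mathcal F}_{21}\tilde{\mathcal F}^{-1}$, $\tilde\phi=(\mathbf 1\otimes\tilde{\mathcal F})[(\mathrm{id}\otimes\Delta)\tilde{\mathcal F}][(\Delta\otimes\mathrm{id})\tilde{\mathcal F}^{-1}](\tilde{\mathcal F}^{-1}\otimes\mathbf 1)=\tilde\phi_1\otimes\tilde\phi_2\otimes\tilde\phi_3$ and $\tilde\phi_{213}=\tilde\phi_2\otimes\tilde\phi_1\otimes\tilde\phi_3$,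 $$\mathfrak R^{lk}_{ij}=((\pi_K)^l_i\otimes(\pi_{K'})^k_j\otimes\mathrm{id})(\tilde\phi_{213}\tilde{\mathcal R}_{12}\tilde\phi^{-1}).$$ *)

theory Defs
  imports
    "HOL-Analysis.Analysis"
    "HOL-Library.Poly_Mapping"
    "HOL-Library.Product_Order"
    "HOL-Library.Landau_Symbols"
begin

abbreviation "lookup \<equiv> Poly_Mapping.lookup"
abbreviation "keys \<equiv> Poly_Mapping.keys"
abbreviation "single \<equiv> Poly_Mapping.single"


section \<open>The tensor powers of $U(su(2))$, completed by finite-dimensional representations\<close>

text \<open>
  For real \<open>q\<close> the isomorphism \<open>\<phi>\<close>, the twist and the \<open>R\<close>-matrix exist on finite-dimensional
  representations only, i.e. in the completion of the \<open>n\<close>-th tensor power of \<open>U(su(2))\<close> which is the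
  product, over all \<open>n\<close>-tuples of irreducible representations, of the endomorphism algebras.  An
  irreducible representation is labelled by \<open>d\<close> (twice the spin) and has the weight basis
  \<open>e\<^sub>0, \<dots>, e\<^sub>d\<close>; labels and basis indices for \<open>n\<close> legs are \<open>n\<close>-tuples, and \<open>{..s}\<close> is the set of basis
  indices of the representation \<open>s\<close> (for tuples with respect to the componentwise order).
\<close>

class spin_label = order +
  assumes finite_atMost_label: "finite {..s}"

instance nat :: spin_label
  by standard simp

instance prod :: (spin_label, spin_label) spin_label
proof
  fix s :: "'a \<times> 'b"
  have "{..s} = {..fst s} \<times> {..snd s}"
    by (auto simp: less_eq_prod_def)
  then show "finite {..s}"
    by (simp add: finite_atMost_label)
qed

text \<open>\<open>ent A s m n\<close> is the entry in row \<open>m\<close> and column \<open>n\<close> of the component of \<open>A\<close> at \<open>s\<close>.\<close>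

typedef (overloaded) 's uhat =
  "{A :: 's::spin_label \<Rightarrow> 's \<Rightarrow> 's \<Rightarrow> complex. \<forall>s m n. \<not> (m \<le> s \<and> n \<le> s) \<longrightarrow> A s m n = 0}"
  morphisms ent Abs_uhat
  by (rule exI[of _ "\<lambda>_ _ _. 0"]) simp

definition mk :: "('s::spin_label \<Rightarrow> 's \<Rightarrow> 's \<Rightarrow> complex) \<Rightarrow> 's uhat" where
  "mk f = Abs_uhat (\<lambda>s m n. if m \<le> s \<and> n \<le> s then f s m n else 0)"

lemma ent_mk [simp]: "ent (mk f) s m n = (if m \<le> s \<and> n \<le> s then f s m n else 0)"
  unfolding mk_def by (subst Abs_uhat_inverse) auto

lemma ent_outside: "\<not> (m \<le> s \<and> n \<le> s) \<Longrightarrow> ent A s m n = 0"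
  using ent[of A] by blast

lemma uhat_eqI: "(\<And>s m n. m \<le> s \<Longrightarrow> n \<le> s \<Longrightarrow> ent A s m n = ent B s m n) \<Longrightarrow> A = B"
  by (metis ent_inject ent_outside ext)

instantiation uhat :: (spin_label) ring_1
begin

definition "0 = mk (\<lambda>s m n. 0)"
definition "1 = mk (\<lambda>s m n. if m = n then 1 else 0)"
definition "A + B = mk (\<lambda>s m n. ent A s m n + ent B s m n)"
definition "- A = mk (\<lambda>s m n. - ent A s m n)"
definition "A - B = mk (\<lambda>s m n. ent A s m n - ent B s m n)"
definition "A * B = mk (\<lambda>s m n. \<Sum>k\<in>{..s}. ent A s m k * ent B s k n)"

instance
proof
  fix A B C :: "'a uhat"
  show "A + B + C = A + (B + C)" "A + B = B + A" "0 + A = A" "- A + A = 0" "A - B = A + - B"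
    by (auto intro!: uhat_eqI simp: plus_uhat_def zero_uhat_def uminus_uhat_def minus_uhat_def)
  show "(A + B) * C = A * C + B * C" "A * (B + C) = A * B + A * C"
    by (auto intro!: uhat_eqI sum.cong
        simp: plus_uhat_def times_uhat_def sum.distrib[symmetric] algebra_simps)
  show "A * B * C = A * (B * C)"
  proof (rule uhat_eqI)
    fix s m n :: 'a assume mn: "m \<le> s" "n \<le> s"
    have "ent (A * B * C) s m n
        = (\<Sum>k\<in>{..s}. \<Sum>j\<in>{..s}. ent A s m j * ent B s j k * ent C s k n)"
      using mn by (auto simp: times_uhat_def sum_distrib_right intro!: sum.cong)
    also have "\<dots> = (\<Sum>j\<in>{..s}. \<Sum>k\<in>{..s}. ent A s m j * ent B s j k * ent C s k n)"
      by (rule sum.swap)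
    also have "\<dots> = ent (A * (B * C)) s m n"
      using mn by (auto simp: times_uhat_def sum_distrib_left algebra_simps intro!: sum.cong)
    finally show "ent (A * B * C) s m n = ent (A * (B * C)) s m n" .
  qed
  have delta1: "(\<Sum>k\<in>{..s}. (if m = k then 1 else 0) * f k) = f m"
    if "m \<le> s" for s m :: 'a and f :: "'a \<Rightarrow> complex"
    using that by (subst sum.remove[of _ m]) (auto simp: finite_atMost_label split: if_splits intro!: sum.neutral)
  have delta2: "(\<Sum>k\<in>{..s}. f k * (if k = n then 1 else 0)) = f n"
    if "n \<le> s" for s n :: 'a and f :: "'a \<Rightarrow> complex"
    using that by (subst sum.remove[of _ n]) (auto simp: finite_atMost_label split: if_splits intro!: sum.neutral)
  show "1 * A = A"
  proof (rule uhat_eqI)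
    fix s m n :: 'a assume mn: "m \<le> s" "n \<le> s"
    have "ent (1 * A) s m n = (\<Sum>k\<in>{..s}. (if m = k then 1 else 0) * ent A s k n)"
      using mn by (auto simp: times_uhat_def one_uhat_def intro!: sum.cong)
    then show "ent (1 * A) s m n = ent A s m n"
      using delta1[OF mn(1), of "\<lambda>k. ent A s k n"] by simp
  qed
  show "A * 1 = A"
  proof (rule uhat_eqI)
    fix s m n :: 'a assume mn: "m \<le> s" "n \<le> s"
    have "ent (A * 1) s m n = (\<Sum>k\<in>{..s}. ent A s m k * (if k = n then 1 else 0))"
      using mn by (auto simp: times_uhat_def one_uhat_def intro!: sum.cong)
    then show "ent (A * 1) s m n = ent A s m n"
      using delta2[OF mn(2), of "\<lambda>k. ent A s m k"] by simp
  qed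
  show "(0::'a uhat) \<noteq> 1"
  proof
    assume "(0::'a uhat) = 1"
    then have "ent (0::'a uhat) undefined undefined undefined = ent 1 undefined undefined undefined"
      by simp
    then show False by (simp add: zero_uhat_def one_uhat_def)
  qed
qed

end

definition uscale :: "complex \<Rightarrow> 's::spin_label uhat \<Rightarrow> 's uhat" where
  "uscale c A = mk (\<lambda>s m n. c * ent A s m n)"

definition ustar :: "'s::spin_label uhat \<Rightarrow> 's uhat" where
  "ustar A = mk (\<lambda>s m n. cnj (ent A s n m))"

definition uinv :: "'s::spin_label uhat \<Rightarrow> 's uhat" where
  "uinv A = (THE B. A * B = 1 \<and> B * A = 1)"

definition invertible_uhat :: "'s::spin_label uhat \<Rightarrow> bool" where
  "invertible_uhat A \<longleftrightarrow> (\<exists>B. A * B = 1 \<and> B * A = 1)"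

definition usum :: "(nat \<Rightarrow> 's::spin_label uhat) \<Rightarrow> 's uhat" where
  "usum f = mk (\<lambda>s m n. suminf (\<lambda>k. ent (f k) s m n))"

definition uexp :: "'s::spin_label uhat \<Rightarrow> 's uhat" where
  "uexp A = usum (\<lambda>k. uscale (1 / fact k) (A ^ k))"

definition tens :: "'s::spin_label uhat \<Rightarrow> 't::spin_label uhat \<Rightarrow> ('s \<times> 't) uhat" where
  "tens A B = mk (\<lambda>(s, t) (m, k) (n, l). ent A s m n * ent B t k l)"

definition flip :: "('s::spin_label \<times> 't::spin_label) uhat \<Rightarrow> ('t \<times> 's) uhat" where
  "flip X = mk (\<lambda>(t, s) (k, m) (l, n). ent X (s, t) (m, k) (n, l))"

definition flip213 :: "(nat \<times> nat \<times> nat) uhat \<Rightarrow> (nat \<times> nat \<times> nat) uhat" where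
  "flip213 X = mk (\<lambda>(d, e, f) (m, k, p) (n, l, r). ent X (e, d, f) (k, m, p) (l, n, r))"

text \<open>\<open>pad X = X \<otimes> 1\<close>\<close>

definition pad :: "(nat \<times> nat) uhat \<Rightarrow> (nat \<times> nat \<times> nat) uhat" where
  "pad X = mk (\<lambda>(d, e, f) (m, k, p) (n, l, r). ent (tens X (1 :: nat uhat)) ((d, e), f) ((m, k), p) ((n, l), r))"

text \<open>Fixing component and entry in the remaining legs gives an element for the first leg; a map
  defined on the first leg is applied entrywise to these slices.\<close>

definition slice :: "('s::spin_label \<times> 't::spin_label) uhat \<Rightarrow> 't \<Rightarrow> 't \<Rightarrow> 't \<Rightarrow> 's uhat" where
  "slice X t k l = mk (\<lambda>s m n. ent X (s, t) (m, k) (n, l))"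

text \<open>\<open>leg1 f X = (f \<otimes> id) X\<close> for a linear functional \<open>f\<close>\<close>

definition leg1 :: "('s::spin_label uhat \<Rightarrow> complex) \<Rightarrow> ('s \<times> 't::spin_label) uhat \<Rightarrow> 't uhat" where
  "leg1 f X = mk (\<lambda>t k l. f (slice X t k l))"


section \<open>The Hopf algebra structure of $U(su(2))$\<close>

definition uH :: "nat uhat" where
  "uH = mk (\<lambda>d m n. if m = n then of_int (int d - 2 * int n) else 0)"

definition uXp :: "nat uhat" where
  "uXp = mk (\<lambda>d m n. if Suc m = n then of_real (sqrt (real n * (real d - real n + 1))) else 0)"

definition uXm :: "nat uhat" where
  "uXm = mk (\<lambda>d m n. if m = Suc n then of_real (sqrt (real m * (real d - real m + 1))) else 0)"

definition ueps :: "nat uhat \<Rightarrow> complex" where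
  "ueps u = ent u 0 0 0"

text \<open>The undeformed coproduct: the unital algebra homomorphism with primitive generators, extended
  by continuity (each component of the image depends on finitely many components of the
  argument).\<close>

definition is_coproduct :: "(nat uhat \<Rightarrow> (nat \<times> nat) uhat) \<Rightarrow> bool" where
  "is_coproduct D \<longleftrightarrow>
     D 1 = 1 \<and> (\<forall>u v. D (u + v) = D u + D v) \<and> (\<forall>u v. D (u * v) = D u * D v) \<and>
     (\<forall>c u. D (uscale c u) = uscale c (D u)) \<and>
     (\<forall>X\<in>{uH, uXp, uXm}. D X = tens X 1 + tens 1 X) \<and>
     (\<forall>s. \<exists>L. \<forall>u v. (\<forall>d\<le>L. ent u d = ent v d) \<longrightarrow> ent (D u) s = ent (D v) s)"

definition cop :: "nat uhat \<Rightarrow> (nat \<times> nat) uhat" where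
  "cop = (THE D. is_coproduct D)"

text \<open>\<open>cop_left X = (\<Delta> \<otimes> id) X\<close> and \<open>cop_right X = (id \<otimes> \<Delta>) X\<close>\<close>

definition cop_left :: "(nat \<times> nat) uhat \<Rightarrow> (nat \<times> nat \<times> nat) uhat" where
  "cop_left X = mk (\<lambda>(d, e, f) (m, k, p) (n, l, r). ent (cop (slice X f p r)) (d, e) (m, k) (n, l))"

definition cop_right :: "(nat \<times> nat) uhat \<Rightarrow> (nat \<times> nat \<times> nat) uhat" where
  "cop_right X =
     mk (\<lambda>(d, e, f) (m, k, p) (n, l, r). ent (cop (slice (flip X) d m n)) (e, f) (k, p) (l, r))"

text \<open>The normalization of the Casimir (eigenvalue \<open>2j(j+1)\<close>) is the one for which \<open>q\<^bsup>t/2\<^esup>\<close> has the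
  leading part \<open>q\<^bsup>H \<otimes> H/2\<^esup>\<close> of the \<open>R\<close>-matrix on highest weight vectors.\<close>

definition casimir :: "nat uhat" where
  "casimir = uXp * uXm + uXm * uXp + uscale (1 / 2) (uH * uH)"

definition split_t :: "(nat \<times> nat) uhat" where
  "split_t = cop casimir - tens 1 casimir - tens casimir 1"


section \<open>$U_q(su(2))$ and Drinfel'd's isomorphism\<close>

text \<open>Generators \<open>H, X\<^sup>+, X\<^sup>-\<close> and \<open>q\<^bsup>H/2\<^esup>, q\<^bsup>-H/2\<^esup>\<close>.  Elements of \<open>U\<^sub>q(su(2))\<close> are given by representatives
  in the free algebra on the generators; everything below that depends on such an element factors
  through the relations.\<close>

datatype uq_gen = QH | QXp | QXm | QKp | QKm

type_synonym uq = "uq_gen list \<Rightarrow>\<^sub>0 complex"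

fun cop_gen :: "uq_gen \<Rightarrow> (uq_gen list \<times> uq_gen list) list" where
  "cop_gen QH = [([QH], []), ([], [QH])]"
| "cop_gen QXp = [([QXp], [QKp]), ([QKm], [QXp])]"
| "cop_gen QXm = [([QXm], [QKp]), ([QKm], [QXm])]"
| "cop_gen QKp = [([QKp], [QKp])]"
| "cop_gen QKm = [([QKm], [QKm])]"

text \<open>\<open>\<Delta>\<^sub>q\<close> on words, as the list of the tensors that are summed\<close>

fun cop_q :: "uq_gen list \<Rightarrow> (uq_gen list \<times> uq_gen list) list" where
  "cop_q [] = [([], [])]"
| "cop_q (x # w) = [(a @ c, b @ d). (a, b) \<leftarrow> cop_gen x, (c, d) \<leftarrow> cop_q w]"

definition cop_q_flipped :: "uq_gen list \<Rightarrow> (uq_gen list \<times> uq_gen list) list" where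
  "cop_q_flipped w = map prod.swap (cop_q w)"

definition eps_q_word :: "uq_gen list \<Rightarrow> complex" where
  "eps_q_word w = (\<Prod>x\<leftarrow>w. if x \<in> {QKp, QKm} then 1 else 0)"

definition eps_q :: "uq \<Rightarrow> complex" where
  "eps_q u = (\<Sum>w\<in>keys u. lookup u w * eps_q_word w)"

definition phi_word :: "(uq_gen \<Rightarrow> nat uhat) \<Rightarrow> uq_gen list \<Rightarrow> nat uhat" where
  "phi_word \<phi> w = prod_list (map \<phi> w)"

definition phi_elem :: "(uq_gen \<Rightarrow> nat uhat) \<Rightarrow> uq \<Rightarrow> nat uhat" where
  "phi_elem \<phi> u = (\<Sum>w\<in>keys u. uscale (lookup u w) (phi_word \<phi> w))"

text \<open>\<open>(\<phi> \<otimes> \<phi>) \<Delta>\<^sub>q(u)\<close>\<close>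

definition phi_cop_q :: "(uq_gen \<Rightarrow> nat uhat) \<Rightarrow> uq \<Rightarrow> (nat \<times> nat) uhat" where
  "phi_cop_q \<phi> u = (\<Sum>w\<in>keys u.
      uscale (lookup u w) (\<Sum>(a, b)\<leftarrow>cop_q w. tens (phi_word \<phi> a) (phi_word \<phi> b)))"

definition qnum :: "real \<Rightarrow> nat \<Rightarrow> real" where
  "qnum h n = (if h = 0 then real n else sinh (h * real n) / sinh h)"

text \<open>\<open>[A]\<^sub>q = (q\<^sup>A - q\<^bsup>-A\<^esup>) / (q - q\<^bsup>-1\<^esup>)\<close> with \<open>q = e\<^sup>h\<close>, and its limit \<open>A\<close> for \<open>q = 1\<close>\<close>

definition qbracket :: "real \<Rightarrow> nat uhat \<Rightarrow> nat uhat" where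
  "qbracket h A = (if h = 0 then A else
     uscale (1 / (2 * of_real (sinh h))) (uexp (uscale (of_real h) A) - uexp (uscale (- of_real h) A)))"

text \<open>Surjectivity of \<open>\<phi>\<close> onto the completion means dense image.  Injectivity on \<open>U\<^sub>q(su(2))\<close> is
  automatic, since finite-dimensional representations separate its elements.\<close>

definition drinfeld_iso :: "real \<Rightarrow> (uq_gen \<Rightarrow> nat uhat) \<Rightarrow> bool" where
  "drinfeld_iso h \<phi> \<longleftrightarrow>
     \<phi> QH * \<phi> QXp - \<phi> QXp * \<phi> QH = uscale 2 (\<phi> QXp) \<and>
     \<phi> QH * \<phi> QXm - \<phi> QXm * \<phi> QH = uscale (- 2) (\<phi> QXm) \<and>
     \<phi> QXp * \<phi> QXm - \<phi> QXm * \<phi> QXp = qbracket h (\<phi> QH) \<and>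
     \<phi> QKp = uexp (uscale (of_real (h / 2)) (\<phi> QH)) \<and>
     \<phi> QKm = uexp (uscale (- of_real (h / 2)) (\<phi> QH)) \<and>
     ustar (\<phi> QH) = \<phi> QH \<and> ustar (\<phi> QXp) = \<phi> QXm \<and>
     (\<forall>v L. \<exists>u. \<forall>d\<le>L. ent (phi_elem \<phi> u) d = ent v d)"

text \<open>\<open>A = B + O(h)\<close>, componentwise\<close>

definition equal_mod_h :: "(real \<Rightarrow> 's::spin_label uhat) \<Rightarrow> 's uhat \<Rightarrow> bool" where
  "equal_mod_h A B \<longleftrightarrow>
     (\<forall>s m n. (\<lambda>h. ent (A h) s m n - ent B s m n) \<in> O[nhds 0](\<lambda>h. of_real h))"

definition drinfeld_iso_family :: "real \<Rightarrow> (real \<Rightarrow> uq_gen \<Rightarrow> nat uhat) \<Rightarrow> bool" where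
  "drinfeld_iso_family h0 \<phi> \<longleftrightarrow>
     (\<forall>h. \<bar>h\<bar> < h0 \<longrightarrow> drinfeld_iso h (\<phi> h)) \<and>
     equal_mod_h (\<lambda>h. \<phi> h QH) uH \<and> equal_mod_h (\<lambda>h. \<phi> h QXp) uXp \<and> equal_mod_h (\<lambda>h. \<phi> h QXm) uXm"

text \<open>\<open>(\<phi> \<otimes> \<phi>) R\<close> for the universal \<open>R\<close>-matrix belonging to \<open>\<Delta>\<^sub>q\<close>,
  \<open>R = q\<^bsup>H \<otimes> H/2\<^esup> \<Sum>\<^sub>k (1 - q\<^bsup>-2\<^esup>)\<^sup>k q\<^bsup>k(k-1)/2\<^esup> / [k]\<^sub>q! (q\<^bsup>H/2\<^esup> X\<^sup>+)\<^sup>k \<otimes> (q\<^bsup>-H/2\<^esup> X\<^sup>-)\<^sup>k\<close>.\<close>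

definition phi_R :: "real \<Rightarrow> (uq_gen \<Rightarrow> nat uhat) \<Rightarrow> (nat \<times> nat) uhat" where
  "phi_R h \<phi> =
     uexp (uscale (of_real (h / 2)) (tens (\<phi> QH) (\<phi> QH))) *
     usum (\<lambda>k. uscale
        (of_real ((1 - exp (- 2 * h)) ^ k * exp (h * (real k * (real k - 1) / 2)) / (\<Prod>i=1..k. qnum h i)))
        (tens ((\<phi> QKp * \<phi> QXp) ^ k) ((\<phi> QKm * \<phi> QXm) ^ k)))"


section \<open>Twists\<close>

definition drinfeld_twist :: "real \<Rightarrow> (uq_gen \<Rightarrow> nat uhat) \<Rightarrow> (nat \<times> nat) uhat \<Rightarrow> bool" where
  "drinfeld_twist h \<phi> F \<longleftrightarrow>
     invertible_uhat F \<and>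
     (\<forall>u. phi_cop_q \<phi> u = F * cop (phi_elem \<phi> u) * uinv F) \<and>
     leg1 ueps F = 1 \<and> leg1 ueps (flip F) = 1 \<and>
     phi_R h \<phi> = flip F * uexp (uscale (of_real (h / 2)) split_t) * uinv F"

text \<open>The condition \<open>F = 1 \<otimes> 1 + o(h)\<close> refers to terms of order \<open>h\<close>: the first-order part of
  the antisymmetrization of \<open>F\<close> is prescribed by the \<open>R\<close>-matrix and does not vanish.\<close>

definition drinfeld_twist_family ::
  "real \<Rightarrow> (real \<Rightarrow> uq_gen \<Rightarrow> nat uhat) \<Rightarrow> (real \<Rightarrow> (nat \<times> nat) uhat) \<Rightarrow> bool" where
  "drinfeld_twist_family h0 \<phi> F \<longleftrightarrow>
     (\<forall>h. \<bar>h\<bar> < h0 \<longrightarrow> drinfeld_twist h (\<phi> h) (F h)) \<and> equal_mod_h F 1"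

definition unitary_twist :: "(nat \<times> nat) uhat \<Rightarrow> bool" where
  "unitary_twist F \<longleftrightarrow> ustar F = uinv F"

definition coassociator :: "(nat \<times> nat) uhat \<Rightarrow> (nat \<times> nat \<times> nat) uhat" where
  "coassociator F = cop_left (uinv F) * pad (uinv F) * tens 1 F * cop_right F"

text \<open>The path-ordered exponential of \<open>A\<close> over \<open>[a,b]\<close>, with the factors ordered by increasing
  argument from left to right.  Only with this order do \<open>x\<^sub>0\<close> and \<open>y\<^sub>0\<close> enter the Knizhnik-Zamolodchikov
  expression next to the factors that compensate the divergences.\<close>

definition path_exp ::
  "(real \<Rightarrow> 's::spin_label uhat) \<Rightarrow> real \<Rightarrow> real \<Rightarrow> 's uhat" where
  "path_exp A a b = (THE w. \<exists>W. W a = 1 \<and> W b = w \<and>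
     (\<forall>x\<in>{a..b}. \<forall>s m n.
        ((\<lambda>x. ent (W x) s m n) has_vector_derivative ent (W x * A x) s m n) (at x within {a..b})))"

definition kz_regularized :: "real \<Rightarrow> real \<Rightarrow> real \<Rightarrow> (nat \<times> nat \<times> nat) uhat" where
  "kz_regularized h x0 y0 =
     (let t12 = pad split_t; t23 = tens 1 split_t; c = of_real h / (2 * of_real pi * \<i>) in
      uexp (uscale (- c * of_real (ln x0)) t12) *
      path_exp (\<lambda>x. uscale (- c) (uscale (of_real (1 / x)) t12 + uscale (of_real (1 / (x - 1))) t23))
        x0 (1 - y0) *
      uexp (uscale (c * of_real (ln y0)) t23))"

definition minimal_twist :: "real \<Rightarrow> (nat \<times> nat) uhat \<Rightarrow> bool" where
  "minimal_twist h F \<longleftrightarrow>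
     (\<forall>s m n. ((\<lambda>(x0, y0). ent (kz_regularized h x0 y0) s m n) \<longlongrightarrow> ent (coassociator F) s m n)
        (at_right 0 \<times>\<^sub>F at_right 0))"


section \<open>The mode algebra $\mathcal{A}$\<close>

text \<open>The mode \<open>(K, n)\<close> with \<open>n \<le> 2K\<close> stands for \<open>a\<^bsub>K,n\<^esub>\<close>.  For every \<open>K\<close>, \<open>B K\<close> is a unitary matrix
  describing an orthonormal basis of the spin \<open>K\<close> representation in terms of the weight basis;
  \<open>rep B K\<close> is the resulting unitary matrix representation.\<close>

type_synonym mode = "nat \<times> nat"

definition modes :: "nat \<Rightarrow> mode set" where
  "modes N = {(K, n). K \<le> N \<and> n \<le> 2 * K}"

type_synonym basis_change = "nat \<Rightarrow> nat \<Rightarrow> nat \<Rightarrow> complex"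

definition unitary_basis :: "basis_change \<Rightarrow> bool" where
  "unitary_basis B \<longleftrightarrow> (\<forall>K. \<forall>m\<le>2*K. \<forall>n\<le>2*K.
     (\<Sum>i\<le>2*K. cnj (B K i m) * B K i n) = (if m = n then 1 else 0))"

definition rep :: "basis_change \<Rightarrow> nat \<Rightarrow> nat uhat \<Rightarrow> nat \<Rightarrow> nat \<Rightarrow> complex" where
  "rep B K u m n = (\<Sum>i\<le>2*K. \<Sum>j\<le>2*K. cnj (B K i m) * ent u (2 * K) i j * B K j n)"

text \<open>The real symmetric invariant tensor \<open>g\<^bsup>ij\<^esup>\<close> (i.e. \<open>g\<^bsup>ij\<^esup> a\<^bsub>K,i\<^esub> a\<^bsub>K,j\<^esub>\<close> is invariant) with \<open>g\<^bsup>ij\<^esup> g\<^bsup>jk\<^esup> = \<delta>\<^bsup>ik\<^esup>\<close>\<close>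

definition invariant_form :: "basis_change \<Rightarrow> nat \<Rightarrow> (nat \<Rightarrow> nat \<Rightarrow> real) \<Rightarrow> bool" where
  "invariant_form B K g \<longleftrightarrow>
     (\<forall>i\<le>2*K. \<forall>j\<le>2*K. g i j = g j i) \<and>
     (\<forall>i\<le>2*K. \<forall>k\<le>2*K. (\<Sum>j\<le>2*K. g i j * g j k) = (if i = k then 1 else 0)) \<and>
     (\<forall>X\<in>{uH, uXp, uXm}. \<forall>m\<le>2*K. \<forall>n\<le>2*K.
        (\<Sum>i\<le>2*K. rep B K X m i * of_real (g i n)) + (\<Sum>j\<le>2*K. of_real (g m j) * rep B K X n j) = 0)"

type_synonym apoly = "(mode \<Rightarrow>\<^sub>0 nat) \<Rightarrow>\<^sub>0 complex"

definition Const :: "complex \<Rightarrow> apoly" where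
  "Const c = single 0 c"

definition Mon :: "(mode \<Rightarrow>\<^sub>0 nat) \<Rightarrow> apoly" where
  "Mon \<mu> = single \<mu> 1"

definition Var :: "mode \<Rightarrow> apoly" where
  "Var x = Mon (single x 1)"

definition mode_polys :: "nat \<Rightarrow> apoly set" where
  "mode_polys N = {f. \<forall>\<mu>\<in>keys f. keys \<mu> \<subseteq> modes N}"

definition subst_apoly :: "(complex \<Rightarrow> 'r::comm_ring_1) \<Rightarrow> (mode \<Rightarrow> 'r) \<Rightarrow> apoly \<Rightarrow> 'r" where
  "subst_apoly c x f = (\<Sum>\<mu>\<in>keys f. c (lookup f \<mu>) * (\<Prod>v\<in>keys \<mu>. x v ^ lookup \<mu> v))"

definition eval_apoly :: "(mode \<Rightarrow> complex) \<Rightarrow> apoly \<Rightarrow> complex" where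
  "eval_apoly = subst_apoly (\<lambda>c. c)"

text \<open>The action of \<open>U(su(2))\<close> on \<open>\<A>\<close>, extended to the completion by continuity (\<open>\<A>\<close> is a locally
  finite representation).  Unused indices \<open>(K, n)\<close> with \<open>n > 2K\<close> are given the trivial action.\<close>

definition is_action :: "basis_change \<Rightarrow> (nat uhat \<Rightarrow> apoly \<Rightarrow> apoly) \<Rightarrow> bool" where
  "is_action B \<rho> \<longleftrightarrow>
     (\<forall>u f g. \<rho> u (f + g) = \<rho> u f + \<rho> u g) \<and> (\<forall>u c f. \<rho> u (Const c * f) = Const c * \<rho> u f) \<and>
     (\<forall>u v f. \<rho> (u + v) f = \<rho> u f + \<rho> v f) \<and> (\<forall>c u f. \<rho> (uscale c u) f = Const c * \<rho> u f) \<and>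
     (\<forall>f. \<rho> 1 f = f) \<and> (\<forall>u v f. \<rho> (u * v) f = \<rho> u (\<rho> v f)) \<and>
     (\<forall>X\<in>{uH, uXp, uXm}. \<forall>f g. \<rho> X (f * g) = \<rho> X f * g + f * \<rho> X g) \<and>
     (\<forall>u K n. n \<le> 2 * K \<longrightarrow> \<rho> u (Var (K, n)) = (\<Sum>m\<le>2*K. Var (K, m) * Const (rep B K u m n))) \<and>
     (\<forall>X\<in>{uH, uXp, uXm}. \<forall>K n. n > 2 * K \<longrightarrow> \<rho> X (Var (K, n)) = 0) \<and>
     (\<forall>f. \<exists>L. \<forall>u. (\<forall>d\<le>L. ent u d = ent 0 d) \<longrightarrow> \<rho> u f = 0)"

definition act :: "basis_change \<Rightarrow> nat uhat \<Rightarrow> apoly \<Rightarrow> apoly" where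
  "act B = (THE \<rho>. is_action B \<rho>)"

type_synonym forms = "nat \<Rightarrow> nat \<Rightarrow> nat \<Rightarrow> real"

definition apoly_star :: "forms \<Rightarrow> apoly \<Rightarrow> apoly" where
  "apoly_star g = subst_apoly (\<lambda>c. Const (cnj c))
     (\<lambda>(K, n). \<Sum>m\<le>2*K. Const (of_real (g K n m)) * Var (K, m))"

text \<open>The points of \<open>\<Prod>\<^sub>K \<real>\<^bsup>2K+1\<^esup>\<close> as values of the modes.  The values \<open>x\<close> compatible with the star are
  those with \<open>cnj (x n) = g\<^bsup>nm\<^esup> x m\<close>.  As \<open>g\<close> is a real symmetric involution, they form the isometric
  image of \<open>\<real>\<^bsup>2K+1\<^esup>\<close> under \<open>(1+g)/2 + \<i> (1-g)/2\<close>.\<close>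

definition real_point :: "forms \<Rightarrow> (mode \<Rightarrow> real) \<Rightarrow> mode \<Rightarrow> complex" where
  "real_point g y = (\<lambda>(K, n). \<Sum>m\<le>2*K.
     (of_real (((if n = m then 1 else 0) + g K n m) / 2) +
      \<i> * of_real (((if n = m then 1 else 0) - g K n m) / 2)) * of_real (y (K, m)))"

definition apoly_fun :: "forms \<Rightarrow> apoly \<Rightarrow> (mode \<Rightarrow> real) \<Rightarrow> complex" where
  "apoly_fun g f y = eval_apoly (real_point g y) f"

definition mode_measure :: "nat \<Rightarrow> (mode \<Rightarrow> real) measure" where
  "mode_measure N = (\<Pi>\<^sub>M x\<in>modes N. lborel)"


section \<open>The cross product $U(su(2)) \ltimes \mathcal{A}$\<close>

text \<open>\<open>\<A> \<otimes> U(su(2))\<close>, expanded in the monomials of \<open>\<A>\<close>.  The multiplication is \<open>smash_mult\<close> and not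
  the multiplication that the type \<open>\<Rightarrow>\<^sub>0\<close> carries.\<close>

type_synonym smash = "(mode \<Rightarrow>\<^sub>0 nat) \<Rightarrow>\<^sub>0 nat uhat"

text \<open>\<open>leg_act B X f = (X\<^sub>1 \<triangleright> f) \<otimes> X\<^sub>2\<close>\<close>

definition leg_act :: "basis_change \<Rightarrow> (nat \<times> nat) uhat \<Rightarrow> apoly \<Rightarrow> smash" where
  "leg_act B X f = Abs_poly_mapping (\<lambda>\<kappa>. mk (\<lambda>d m n. lookup (act B (slice X d m n) f) \<kappa>))"

text \<open>\<open>u f = (u\<^sub>(\<^sub>1\<^sub>) \<triangleright> f) u\<^sub>(\<^sub>2\<^sub>)\<close>\<close>

definition commute_past :: "basis_change \<Rightarrow> nat uhat \<Rightarrow> apoly \<Rightarrow> smash" where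
  "commute_past B u f = leg_act B (cop u) f"

definition smash_mult :: "basis_change \<Rightarrow> smash \<Rightarrow> smash \<Rightarrow> smash" where
  "smash_mult B X Y = (\<Sum>\<mu>\<in>keys X. \<Sum>\<nu>\<in>keys Y.
     let Z = commute_past B (lookup X \<mu>) (Mon \<nu>)
     in \<Sum>\<kappa>\<in>keys Z. single (\<mu> + \<kappa>) (lookup Z \<kappa> * lookup Y \<nu>))"

definition smash_prod :: "basis_change \<Rightarrow> smash list \<Rightarrow> smash" where
  "smash_prod B Xs = foldr (smash_mult B) Xs (single 0 1)"

definition of_U :: "nat uhat \<Rightarrow> smash" where
  "of_U u = single 0 u"

text \<open>\<open>(f u)\<^sup>* = u\<^sup>* f\<^sup>*\<close>\<close>

definition smash_star :: "basis_change \<Rightarrow> forms \<Rightarrow> smash \<Rightarrow> smash" where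
  "smash_star B g X = (\<Sum>\<mu>\<in>keys X.
     commute_past B (ustar (lookup X \<mu>)) (apoly_star g (Mon \<mu>)))"

text \<open>left vacuum representation\<close>

definition vac_act :: "basis_change \<Rightarrow> smash \<Rightarrow> apoly \<Rightarrow> apoly" where
  "vac_act B X f = (\<Sum>\<mu>\<in>keys X. Mon \<mu> * act B (lookup X \<mu>) f)"


section \<open>Twisted modes and correlation functions\<close>

text \<open>In this section \<open>F\<close> is the twist for \<open>U\<^sub>q(su(2))\<close>, so that \<open>flip F\<close> is the one for the algebra with
  flipped coproduct.\<close>

definition hat :: "basis_change \<Rightarrow> (nat \<times> nat) uhat \<Rightarrow> mode \<Rightarrow> smash" where
  "hat B F x = leg_act B (uinv (flip F)) (Var x)"

definition star_mult :: "basis_change \<Rightarrow> (nat \<times> nat) uhat \<Rightarrow> apoly \<Rightarrow> apoly \<Rightarrow> apoly" where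
  "star_mult B F a b = (let Z = leg_act B (uinv (flip F)) a
     in \<Sum>\<kappa>\<in>keys Z. Mon \<kappa> * act B (lookup Z \<kappa>) b)"

type_synonym nc_poly = "mode list \<Rightarrow>\<^sub>0 complex"

definition nc_polys :: "nat \<Rightarrow> nc_poly set" where
  "nc_polys N = {P. \<forall>w\<in>keys P. set w \<subseteq> modes N}"

text \<open>\<open>P(\<hat>a)\<close>\<close>

definition hat_poly :: "basis_change \<Rightarrow> (nat \<times> nat) uhat \<Rightarrow> nc_poly \<Rightarrow> smash" where
  "hat_poly B F P = (\<Sum>w\<in>keys P.
     Poly_Mapping.map (uscale (lookup P w)) (smash_prod B (map (hat B F) w)))"

text \<open>\<open>P\<^sub>\<star>(a)\<close>\<close>

fun star_word :: "basis_change \<Rightarrow> (nat \<times> nat) uhat \<Rightarrow> mode list \<Rightarrow> apoly" where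
  "star_word B F [] = 1"
| "star_word B F [x] = Var x"
| "star_word B F (x # y # w) = star_mult B F (Var x) (star_word B F (y # w))"

definition star_poly :: "basis_change \<Rightarrow> (nat \<times> nat) uhat \<Rightarrow> nc_poly \<Rightarrow> apoly" where
  "star_poly B F P = (\<Sum>w\<in>keys P. Const (lookup P w) * star_word B F w)"

text \<open>The action of a word \<open>u\<close> in the generators on a monomial, through the iterated flipped coproduct
  and \<open>\<pi> \<circ> \<phi>\<close> on the modes\<close>

fun q_act_word :: "basis_change \<Rightarrow> (uq_gen \<Rightarrow> nat uhat) \<Rightarrow> uq_gen list \<Rightarrow> mode list \<Rightarrow> nc_poly" where
  "q_act_word B \<phi> u [] = single [] (eps_q_word u)"
| "q_act_word B \<phi> u ((K, n) # w) = (\<Sum>(u1, u2)\<leftarrow>cop_q_flipped u. \<Sum>m\<le>2*K.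
     (let P = q_act_word B \<phi> u2 w
      in \<Sum>v\<in>keys P. single ((K, m) # v) (rep B K (phi_word \<phi> u1) m n * lookup P v)))"

definition q_act :: "basis_change \<Rightarrow> (uq_gen \<Rightarrow> nat uhat) \<Rightarrow> uq \<Rightarrow> nc_poly \<Rightarrow> nc_poly" where
  "q_act B \<phi> u P = (\<Sum>a\<in>keys u. \<Sum>w\<in>keys P.
     Poly_Mapping.map ((*) (lookup u a * lookup P w)) (q_act_word B \<phi> a w))"

text \<open>Unnormalized weight \<open>\<integral> e\<^bsup>-S\<^sub>\<star>(a)\<^esup> f(a)\<close>\<close>

definition weighted_integral ::
  "basis_change \<Rightarrow> forms \<Rightarrow> nat \<Rightarrow> (nat \<times> nat) uhat \<Rightarrow> nc_poly \<Rightarrow> apoly \<Rightarrow> complex" where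
  "weighted_integral B g N F S f =
     (\<integral>y. exp (- apoly_fun g (star_poly B F S) y) * apoly_fun g f y \<partial>mode_measure N)"

definition weight_integrable ::
  "basis_change \<Rightarrow> forms \<Rightarrow> nat \<Rightarrow> (nat \<times> nat) uhat \<Rightarrow> nc_poly \<Rightarrow> bool" where
  "weight_integrable B g N F S \<longleftrightarrow> (\<forall>f\<in>mode_polys N.
     integrable (mode_measure N) (\<lambda>y. exp (- apoly_fun g (star_poly B F S) y) * apoly_fun g f y))"

text \<open>\<open>\<langle>f(a)\<rangle>\<close> for a function and \<open>\<langle>X\<rangle>\<close> for an element of the cross product\<close>

definition fun_corr ::
  "basis_change \<Rightarrow> forms \<Rightarrow> nat \<Rightarrow> (nat \<times> nat) uhat \<Rightarrow> nc_poly \<Rightarrow> apoly \<Rightarrow> complex" where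
  "fun_corr B g N F S f = weighted_integral B g N F S f / weighted_integral B g N F S 1"

definition corr ::
  "basis_change \<Rightarrow> forms \<Rightarrow> nat \<Rightarrow> (nat \<times> nat) uhat \<Rightarrow> nc_poly \<Rightarrow> smash \<Rightarrow> complex" where
  "corr B g N F S X = fun_corr B g N F S (vac_act B X 1)"

definition tilde_R :: "(nat \<times> nat) uhat \<Rightarrow> (nat \<times> nat) uhat" where
  "tilde_R F = (let G = flip F in flip G * uinv G)"

definition tilde_phi :: "(nat \<times> nat) uhat \<Rightarrow> (nat \<times> nat \<times> nat) uhat" where
  "tilde_phi F = (let G = flip F in tens 1 G * cop_right G * cop_left (uinv G) * pad (uinv G))"

text \<open>\<open>exchange B F K K' l k i j\<close> has the upper indices \<open>l, k\<close> and the lower indices \<open>i, j\<close>.\<close>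

definition exchange ::
  "basis_change \<Rightarrow> (nat \<times> nat) uhat \<Rightarrow> nat \<Rightarrow> nat \<Rightarrow> nat \<Rightarrow> nat \<Rightarrow> nat \<Rightarrow> nat \<Rightarrow> nat uhat" where
  "exchange B F K K' l k i j =
     leg1 (\<lambda>u. rep B K' u k j) (leg1 (\<lambda>u. rep B K u l i)
       (flip213 (tilde_phi F) * pad (tilde_R F) * uinv (tilde_phi F)))"

end

theory Submission
  imports Defs
begin

text \<open>
  Everything is reduced to matrix identities: an element of \<open>\<A>\<close> is a sum of images of intertwiners
  \<open>V\<^sub>d \<rightarrow> \<A>\<close> (Clebsch-Gordan), and on images of intertwiners the elements of the completed tensor
  powers of \<open>U(su(2))\<close> act by their matrices.  This yields the coproduct and the action on the
  completion, and turns a product of twisted operators, applied to the vacuum, into the bracketed star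
  product.  Covariance then is the intertwining property of the twist \<open>G\<close>, and the exchange relation
  is the identity \<open>W\<^sub>2\<^sub>1\<^sub>3 T = W\<close> for \<open>W = (id \<otimes> \<Delta>)(G\<^sup>-\<^sup>1) (1 \<otimes> G\<^sup>-\<^sup>1)\<close>, in which only the
  cocommutativity of \<open>\<Delta>\<close> enters.  Since \<open>su(2)\<close> acts by divergence-free vector fields, integration
  by parts shows that the functional \<open>f \<mapsto> \<integral> e\<^sup>-\<^sup>S f\<close> is invariant.  Therefore the star of the
  cross product is the formal adjoint for \<open>\<integral> e\<^sup>-\<^sup>S a\<^sup>* b\<close>, which gives hermiticity and positivity.
  Density of the polynomials in the generators is the hypothesis on \<open>\<phi>\<close> at \<open>h = 0\<close>.
\<close>

section \<open>Entrywise calculus in the completed tensor powers\<close>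

text \<open>\<open>cop\<close> and \<open>act\<close> are definite descriptions, so nothing is known
  about them before existence and uniqueness are proved. Existence is the obstacle: an element of
  the completion is not an expression in the generators, and its value on a vector can only be read
  off from matrices once the vector is decomposed into images of intertwiners. Such a decomposition
  is not unique; density makes the value well defined. Two-leg elements such as the twist need not
  be finite sums of tensors, so they too are handled through matrix entries instead of Sweedler
  components. Reality of S is assumed for the operator \<open>S(\<hat>a)\<close>, whereas
  hermiticity and positivity need the function \<open>S\<^sub>\<star>\<close> to be real; the
  passage from one to the other uses the invariance of S. The integrability hypothesis contains no
  decay at infinity. Boundary terms vanish because a polynomial times the weight and its derivative
  are both of the same form and hence both integrable.\<close>

declare finite_atMost_label [simp, intro]

lemma atMost_Pair: "{..(s, t)} = {..s::'a::spin_label} \<times> {..t::'b::spin_label}"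
  by (auto simp: less_eq_prod_def)

lemma sum_atMost_Pair:
  "(\<Sum>p\<in>{..(s, t)}. f p) = (\<Sum>m\<in>{..s::'a::spin_label}. \<Sum>k\<in>{..t::'b::spin_label}. f (m, k))"
  by (simp add: atMost_Pair sum.cartesian_product)

lemma ent_zero [simp]: "ent 0 s m n = 0"
  by (simp add: zero_uhat_def)

lemma ent_one: "ent 1 s m n = (if m = n \<and> m \<le> s then 1 else 0)"
  by (auto simp: one_uhat_def)

lemma ent_plus [simp]: "ent (A + B) s m n = ent A s m n + ent B s m n"
  by (auto simp: plus_uhat_def ent_outside)

lemma ent_uminus [simp]: "ent (- A) s m n = - ent A s m n"
  by (auto simp: uminus_uhat_def ent_outside)

lemma ent_minus [simp]: "ent (A - B) s m n = ent A s m n - ent B s m n"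
  by (auto simp: minus_uhat_def ent_outside)

text \<open>No range conditions: outside the range both sides vanish because of the invariant of the
  type. This lets the entry rules rewrite unconditionally.\<close>

lemma ent_times: "ent (A * B) s m n = (\<Sum>k\<in>{..s}. ent A s m k * ent B s k n)"
  by (auto simp: times_uhat_def ent_outside)

lemma ent_uscale [simp]: "ent (uscale c A) s m n = c * ent A s m n"
  by (auto simp: uscale_def ent_outside)

lemma ent_ustar [simp]: "ent (ustar A) s m n = cnj (ent A s n m)"
  by (auto simp: ustar_def ent_outside)

lemma ent_sum [simp]: "ent (\<Sum>i\<in>I. f i) s m n = (\<Sum>i\<in>I. ent (f i) s m n)"
  by (induction I rule: infinite_finite_induct) auto

lemma ent_tens [simp]: "ent (tens A B) (s, t) (m, k) (n, l) = ent A s m n * ent B t k l"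
  by (auto simp: tens_def ent_outside)

lemma ent_flip [simp]: "ent (flip X) (t, s) (k, m) (l, n) = ent X (s, t) (m, k) (n, l)"
  by (auto simp: flip_def ent_outside)

lemma ent_flip213 [simp]:
  "ent (flip213 X) (d, e, f) (m, k, p) (n, l, r) = ent X (e, d, f) (k, m, p) (l, n, r)"
  by (auto simp: flip213_def ent_outside)

lemma ent_pad [simp]:
  "ent (pad X) (d, e, f) (m, k, p) (n, l, r) = ent X (d, e) (m, k) (n, l) * ent 1 f p r"
  by (auto simp: pad_def ent_outside)

lemma ent_slice [simp]: "ent (slice X t k l) s m n = ent X (s, t) (m, k) (n, l)"
  by (auto simp: slice_def ent_outside)

lemma uhat_ext: "(\<And>s m n. ent A s m n = ent B s m n) \<Longrightarrow> A = B"
  by (simp add: uhat_eqI)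

lemma sum_ent_one_left: "m \<le> s \<Longrightarrow> (\<Sum>k\<in>{..s}. ent 1 s m k * f k) = f m"
  by (subst sum.remove[of _ m]) (auto simp: ent_one intro!: sum.neutral split: if_splits)

lemma sum_ent_one_right: "n \<le> s \<Longrightarrow> (\<Sum>k\<in>{..s}. f k * ent 1 s k n) = f n"
  by (subst sum.remove[of _ n]) (auto simp: ent_one intro!: sum.neutral split: if_splits)

lemma uscale_one [simp]: "uscale 1 A = A"
  and uscale_zero [simp]: "uscale 0 A = 0"
  and uscale_zero_right [simp]: "uscale c 0 = 0"
  and uscale_uscale [simp]: "uscale a (uscale b A) = uscale (a * b) A"
  and uscale_add: "uscale c (A + B) = uscale c A + uscale c B"
  and add_uscale: "uscale (a + b) A = uscale a A + uscale b A"
  by (auto intro!: uhat_ext simp: algebra_simps)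

lemma uscale_mult_left: "uscale c A * B = uscale c (A * B)"
  and uscale_mult_right: "A * uscale c B = uscale c (A * B)"
  by (auto intro!: uhat_ext simp: ent_times sum_distrib_left algebra_simps)

lemma ustar_simps [simp]:
  "ustar (ustar A) = A" "ustar 1 = 1" "ustar (A + B) = ustar A + ustar B"
  "ustar (uscale c A) = uscale (cnj c) (ustar A)"
  by (auto intro!: uhat_ext simp: ent_one)

lemma ustar_mult: "ustar (A * B) = ustar B * ustar A"
  by (auto intro!: uhat_ext simp: ent_times algebra_simps)

lemma tens_mult: "tens A B * tens C D = tens (A * C) (B * D)"
proof (rule uhat_ext)
  fix s m n
  show "ent (tens A B * tens C D) s m n = ent (tens (A * C) (B * D)) s m n"
    by (cases s; cases m; cases n)
      (simp add: ent_times sum_atMost_Pair sum_product algebra_simps)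
qed

lemma tens_one_one [simp]: "tens 1 1 = 1"
proof (rule uhat_ext)
  fix s m n
  show "ent (tens 1 1) s m n = ent 1 s m n"
    by (cases s; cases m; cases n) (auto simp: ent_one less_eq_prod_def)
qed

lemma tens_add_left: "tens (A + B) C = tens A C + tens B C"
  and tens_add_right: "tens A (B + C) = tens A B + tens A C"
  and tens_uscale_left: "tens (uscale c A) B = uscale c (tens A B)"
  and tens_uscale_right: "tens A (uscale c B) = uscale c (tens A B)"
  by (auto intro!: uhat_ext simp: algebra_simps)

lemma flip_add: "flip (X + Y) = flip X + flip Y"
  and flip_uscale: "flip (uscale c X) = uscale c (flip X)"
  and flip_tens [simp]: "flip (tens A B) = tens B A"
  by (auto intro!: uhat_ext simp: algebra_simps)

lemma flip_mult: "flip (X * Y) = flip X * flip Y"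
proof (rule uhat_ext)
  fix s m n
  show "ent (flip (X * Y)) s m n = ent (flip X * flip Y) s m n"
    by (cases s; cases m; cases n) (simp add: ent_times sum_atMost_Pair, rule sum.swap)
qed

lemma flip_one [simp]: "flip 1 = 1"
  by (metis flip_tens tens_one_one)

lemma flip_sum_list: "flip (\<Sum>x\<leftarrow>xs. f x) = (\<Sum>x\<leftarrow>xs. flip (f x))"
  by (induction xs) (auto simp: flip_add intro!: uhat_ext)

lemma pad_mult: "pad (X * Y) = pad X * pad Y"
proof (rule uhat_ext)
  fix s m n :: "nat \<times> nat \<times> nat"
  obtain d e f m1 k p n1 l r where eq: "s = (d, e, f)" "m = (m1, k, p)" "n = (n1, l, r)"
    by (metis prod_cases3)
  have "(\<Sum>q\<in>{..f}. (\<Sum>a\<in>{..d}. \<Sum>b\<in>{..e}. ent X (d, e) (m1, k) (a, b) * ent Y (d, e) (a, b) (n1, l)) *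
      (ent 1 f p q * ent 1 f q r)) =
      (\<Sum>a\<in>{..d}. \<Sum>b\<in>{..e}. ent X (d, e) (m1, k) (a, b) * ent Y (d, e) (a, b) (n1, l)) * ent 1 f p r"
    using ent_times[of 1 1 f p r] by (simp add: sum_distrib_left[symmetric])
  then show "ent (pad (X * Y)) s m n = ent (pad X * pad Y) s m n"
    unfolding eq
    by (simp add: ent_times sum_atMost_Pair sum_distrib_right sum_distrib_left sum.swap[of _ "{..f}"]
        algebra_simps)
qed

lemma pad_one [simp]: "pad 1 = 1"
  by (rule uhat_ext) (auto simp: ent_one less_eq_prod_def split: if_splits)

lemma flip213_mult: "flip213 (X * Y) = flip213 X * flip213 Y"
proof (rule uhat_ext)
  fix s m n :: "nat \<times> nat \<times> nat"
  obtain d e f m1 k p n1 l r where eq: "s = (d, e, f)" "m = (m1, k, p)" "n = (n1, l, r)"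
    by (metis prod_cases3)
  show "ent (flip213 (X * Y)) s m n = ent (flip213 X * flip213 Y) s m n"
    unfolding eq by (simp add: ent_times sum_atMost_Pair sum.swap[of _ "{..e}" "{..d}"])
qed

lemma flip213_pad: "flip213 (pad X) = pad (flip X)"
  by (rule uhat_ext) auto

lemma flip213_one [simp]: "flip213 1 = 1"
  by (metis flip213_pad flip_one pad_one)

lemma uinv_eq: "A * B = 1 \<Longrightarrow> B * A = 1 \<Longrightarrow> uinv A = B"
  unfolding uinv_def by (rule the_equality) (auto, metis mult.assoc mult.left_neutral mult.right_neutral)

lemma uinv_mult:
  assumes "invertible_uhat A"
  shows "A * uinv A = 1" "uinv A * A = 1"
  using assms uinv_eq unfolding invertible_uhat_def by metis+

lemma ueps_simps [simp]:
  "ueps (u + v) = ueps u + ueps v" "ueps (u * v) = ueps u * ueps v"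
  "ueps (uscale c u) = c * ueps u" "ueps 1 = 1" "ueps 0 = 0"
  "ueps uH = 0" "ueps uXp = 0" "ueps uXm = 0"
  by (auto simp: ueps_def ent_times ent_one uH_def uXp_def uXm_def)

lemma ueps_ustar: "ueps (ustar u) = cnj (ueps u)"
  by (simp add: ueps_def)

lemma ueps_sum: "ueps (\<Sum>i\<in>I. f i) = (\<Sum>i\<in>I. ueps (f i))"
  by (simp add: ueps_def)

lemma ustar_generators [simp]: "ustar uH = uH" "ustar uXp = uXm" "ustar uXm = uXp"
  by (auto intro!: uhat_ext simp: uH_def uXp_def uXm_def)

section \<open>Locally finite representations of $sl_2$\<close>

text \<open>The image of U(su(2)) itself inside its completion. The zero element is obtained by
  scaling with 0.\<close>

inductive_set upoly :: "nat uhat set" where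
  upoly_H: "uH \<in> upoly"
| upoly_Xp: "uXp \<in> upoly"
| upoly_Xm: "uXm \<in> upoly"
| upoly_one: "1 \<in> upoly"
| upoly_add: "u \<in> upoly \<Longrightarrow> v \<in> upoly \<Longrightarrow> u + v \<in> upoly"
| upoly_scale: "u \<in> upoly \<Longrightarrow> uscale c u \<in> upoly"
| upoly_mult: "u \<in> upoly \<Longrightarrow> v \<in> upoly \<Longrightarrow> u * v \<in> upoly"

text \<open>Density for the product topology, where only finitely many components are prescribed. In
  algebraic terms this is the density theorem for the pairwise inequivalent irreducible
  representations \<open>V\<^sub>0, \<dots>, V\<^sub>L\<close>.\<close>

definition upoly_dense :: bool where
  "upoly_dense \<longleftrightarrow> (\<forall>v L. \<exists>u\<in>upoly. \<forall>d\<le>L. ent u d = ent v d)"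

text \<open>The matrix element connecting \<open>e\<^sub>j\<close> and
  \<open>e\<^sub>j\<^sub>+\<^sub>1\<close>, the same for \<open>uXp\<close> and \<open>uXm\<close>.
  The subtraction is one of reals, and the value 0 at j = d ends the ladder.\<close>

definition rt :: "nat \<Rightarrow> nat \<Rightarrow> complex" where
  "rt d j = of_real (sqrt (real (Suc j) * (real d - real j)))"

lemma rt_square: "j \<le> d \<Longrightarrow> rt d j * rt d j = of_nat (Suc j) * (of_nat d - of_nat j)"
  unfolding rt_def of_real_mult[symmetric] by (simp flip: power2_eq_square)

lemma rt_nonzero: "j < d \<Longrightarrow> rt d j \<noteq> 0"
  by (simp add: rt_def)

lemma rt_reflect: "Suc j \<le> d \<Longrightarrow> rt d (d - Suc j) = rt d j"
  by (simp add: rt_def of_nat_diff mult.commute add.commute)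

lemma ent_uH: "ent uH d m n = (if m = n \<and> n \<le> d then of_nat d - 2 * of_nat n else 0)"
  by (auto simp: uH_def)

lemma ent_uXp: "ent uXp d m n = (if Suc m = n \<and> n \<le> d then rt d m else 0)"
  by (auto simp: uXp_def rt_def)

lemma ent_uXm: "ent uXm d m n = (if m = Suc n \<and> m \<le> d then rt d n else 0)"
  by (auto simp: uXm_def rt_def)

text \<open>No finiteness is assumed, because both modules to which this is applied are
  infinite-dimensional: the two-leg algebra under left multiplication by primitive elements, and the
  mode algebra under derivations.\<close>

locale sl2_rep = module scale
  for scale :: "complex \<Rightarrow> 'v::ab_group_add \<Rightarrow> 'v" (infixr \<open>\<odot>\<close> 75) +
  fixes H E F :: "'v \<Rightarrow> 'v"
  assumes hom_H: "module_hom scale scale H"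
    and hom_E: "module_hom scale scale E"
    and hom_F: "module_hom scale scale F"
    and HE: "H (E v) = E (H v) + 2 \<odot> E v"
    and HF: "H (F v) = F (H v) - 2 \<odot> F v"
    and EF: "E (F v) = F (E v) + H v"
begin

lemmas H_simps = module_hom.add[OF hom_H] module_hom.scale[OF hom_H] module_hom.zero[OF hom_H]
  module_hom.diff[OF hom_H] module_hom.sum[OF hom_H] module_hom.neg[OF hom_H]
lemmas E_simps = module_hom.add[OF hom_E] module_hom.scale[OF hom_E] module_hom.zero[OF hom_E]
  module_hom.diff[OF hom_E] module_hom.sum[OF hom_E] module_hom.neg[OF hom_E]
lemmas F_simps = module_hom.add[OF hom_F] module_hom.scale[OF hom_F] module_hom.zero[OF hom_F]
  module_hom.diff[OF hom_F] module_hom.sum[OF hom_F] module_hom.neg[OF hom_F]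

section \<open>Highest weight vectors and decomposition into irreducible representations\<close>

lemma funpow_linear:
  assumes A: "module_hom scale scale A"
  shows "(A ^^ n) (a \<odot> x + b \<odot> y) = a \<odot> (A ^^ n) x + b \<odot> (A ^^ n) y"
  by (induction n) (simp_all add: module_hom.add[OF A] module_hom.scale[OF A])

lemma funpow_zero_mono:
  assumes A: "module_hom scale scale A" and "(A ^^ n) x = 0" "n \<le> m"
  shows "(A ^^ m) x = 0"
proof -
  have "(A ^^ m) x = (A ^^ (m - n)) ((A ^^ n) x)"
    using assms(3) by (metis comp_apply funpow_add le_add_diff_inverse2)
  then show ?thesis using funpow_linear[OF A, of "m - n" 0 0 0] assms(2) by simp
qed

lemma scale_cancel: "c \<odot> v = 0 \<Longrightarrow> c \<noteq> 0 \<Longrightarrow> v = 0"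
  by (metis left_inverse scale_one scale_scale scale_zero_right)

text \<open>An intertwiner is encoded by the images of the weight vectors
  \<open>e\<^sub>0, \<dots>, e\<^sub>d\<close>; values beyond d are arbitrary, and the zero map is
  allowed.\<close>

definition intertwiner :: "nat \<Rightarrow> (nat \<Rightarrow> 'v) \<Rightarrow> bool" where
  "intertwiner d \<theta> \<longleftrightarrow> (\<forall>j\<le>d.
     H (\<theta> j) = (\<Sum>i\<le>d. ent uH d i j \<odot> \<theta> i) \<and>
     E (\<theta> j) = (\<Sum>i\<le>d. ent uXp d i j \<odot> \<theta> i) \<and>
     F (\<theta> j) = (\<Sum>i\<le>d. ent uXm d i j \<odot> \<theta> i))"

lemma sum_uH: "j \<le> d \<Longrightarrow> (\<Sum>i\<le>d. ent uH d i j \<odot> \<theta> i) = (of_nat d - 2 * of_nat j) \<odot> \<theta> j"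
  by (subst sum.remove[of _ j]) (auto simp: ent_uH intro!: sum.neutral)

lemma sum_uXp: "j \<le> d \<Longrightarrow>
    (\<Sum>i\<le>d. ent uXp d i j \<odot> \<theta> i) = (case j of 0 \<Rightarrow> 0 | Suc m \<Rightarrow> rt d m \<odot> \<theta> m)"
proof (cases j)
  case (Suc m)
  assume "j \<le> d"
  then show ?thesis unfolding Suc
    by (subst sum.remove[of _ m]) (auto simp: ent_uXp intro!: sum.neutral)
qed (auto simp: ent_uXp)

lemma sum_uXm: "j \<le> d \<Longrightarrow>
    (\<Sum>i\<le>d. ent uXm d i j \<odot> \<theta> i) = (if j < d then rt d j \<odot> \<theta> (Suc j) else 0)"
proof (cases "j < d")
  case True
  then show ?thesis
    by (subst sum.remove[of _ "Suc j"]) (auto simp: ent_uXm intro!: sum.neutral)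
qed (auto simp: ent_uXm intro!: sum.neutral)

lemma intertwiner_iff: "intertwiner d \<theta> \<longleftrightarrow> (\<forall>j\<le>d.
     H (\<theta> j) = (of_nat d - 2 * of_nat j) \<odot> \<theta> j \<and>
     E (\<theta> j) = (case j of 0 \<Rightarrow> 0 | Suc m \<Rightarrow> rt d m \<odot> \<theta> m) \<and>
     F (\<theta> j) = (if j < d then rt d j \<odot> \<theta> (Suc j) else 0))"
  unfolding intertwiner_def by (simp add: sum_uH sum_uXp sum_uXm)

lemma intertwiner_scale: "intertwiner d \<theta> \<Longrightarrow> intertwiner d (\<lambda>j. c \<odot> \<theta> j)"
  by (auto simp: intertwiner_iff H_simps E_simps F_simps mult.commute split: nat.splits)

text \<open>The sum of the images of all intertwiners. Closure under scalars need not be a rule,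
  since a multiple of an intertwiner is again one.\<close>

inductive good :: "'v \<Rightarrow> bool" where
  good_zero: "good 0"
| good_intertwiner: "intertwiner d \<theta> \<Longrightarrow> j \<le> d \<Longrightarrow> good (\<theta> j)"
| good_add: "good v \<Longrightarrow> good w \<Longrightarrow> good (v + w)"

lemma good_scale: "good v \<Longrightarrow> good (c \<odot> v)"
proof (induction rule: good.induct)
  case (good_intertwiner d \<theta> j)
  show ?case
    using good.good_intertwiner[OF intertwiner_scale[OF good_intertwiner(1)] good_intertwiner(2)] .
qed (auto simp: scale_right_distrib intro: good.intros)

lemma good_sum: "(\<And>i. i \<in> I \<Longrightarrow> good (f i)) \<Longrightarrow> good (\<Sum>i\<in>I. f i)"
  by (induction I rule: infinite_finite_induct) (auto intro: good_zero good_add)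

lemma H_funpow_F: "H v = c \<odot> v \<Longrightarrow> H ((F ^^ j) v) = (c - 2 * of_nat j) \<odot> (F ^^ j) v"
  by (induction j) (auto simp: HF F_simps algebra_simps simp flip: scale_left_distrib scale_left_diff_distrib)

lemma H_funpow_E: "H v = c \<odot> v \<Longrightarrow> H ((E ^^ j) v) = (c + 2 * of_nat j) \<odot> (E ^^ j) v"
  by (induction j) (auto simp: HE E_simps algebra_simps simp flip: scale_left_distrib)

lemma E_funpow_F:
  assumes "H u = c \<odot> u" "E u = 0"
  shows "E ((F ^^ Suc j) u) = (of_nat (Suc j) * (c - of_nat j)) \<odot> (F ^^ j) u"
proof (induction j)
  case 0
  then show ?case using assms by (simp add: EF F_simps)
next
  case (Suc j)
  have "E ((F ^^ Suc (Suc j)) u) = F (E ((F ^^ Suc j) u)) + H ((F ^^ Suc j) u)"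
    by (simp add: EF)
  also have "\<dots> = (of_nat (Suc j) * (c - of_nat j) + (c - 2 * of_nat (Suc j))) \<odot> (F ^^ Suc j) u"
    using Suc H_funpow_F[OF assms(1), of "Suc j"] by (simp only: F_simps scale_left_distrib) simp
  finally show ?case by (simp add: algebra_simps)
qed

lemma funpow_E_funpow_F:
  assumes "H u = c \<odot> u" "E u = 0"
  shows "(E ^^ n) ((F ^^ n) u) = (\<Prod>i<n. of_nat (Suc i) * (c - of_nat i)) \<odot> u"
proof (induction n)
  case (Suc n)
  have hom: "(E ^^ n) (a \<odot> v) = a \<odot> (E ^^ n) v" for a v
    using funpow_linear[OF hom_E, of n a v 0] by simp
  have "(E ^^ Suc n) ((F ^^ Suc n) u) = (E ^^ n) (E ((F ^^ Suc n) u))"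
    by (simp only: funpow_Suc_right o_apply)
  then show ?case unfolding E_funpow_F[OF assms] hom Suc by (simp add: mult.commute)
qed simp

text \<open>Let \<open>F ^^ Suc l\<close> be the first power that kills u. Applying E to it gives (l
  + 1)(c - l) times the nonzero vector \<open>(F ^^ l) u\<close>, which forces c = l.\<close>

lemma highest_weight_integral:
  assumes "H u = c \<odot> u" "E u = 0" "u \<noteq> 0" "(F ^^ m) u = 0"
  obtains l :: nat where "c = of_nat l" "(F ^^ Suc l) u = 0"
proof -
  define m' where "m' = (LEAST m. (F ^^ m) u = 0)"
  have z: "(F ^^ m') u = 0" unfolding m'_def using assms(4) by (rule LeastI)
  with assms(3) obtain l where l: "m' = Suc l" by (cases m') auto
  then have nz: "(F ^^ l) u \<noteq> 0" using not_less_Least[of l "\<lambda>m. (F ^^ m) u = 0"] by (simp add: m'_def)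
  have "(of_nat (Suc l) * (c - of_nat l)) \<odot> (F ^^ l) u = 0"
    using E_funpow_F[OF assms(1,2), of l] z l by (simp only: E_simps)
  then have "of_nat (Suc l) * (c - of_nat l) = 0" using nz scale_cancel by blast
  then have "c = of_nat l" using of_nat_neq_0 by (auto simp del: of_nat_Suc)
  then show ?thesis using that z l by simp
qed

lemma good_highest_weight:
  assumes "H u = of_nat l \<odot> u" "E u = 0" "(F ^^ Suc l) u = 0"
  shows "good ((F ^^ j) u)"
proof (cases "j \<le> l")
  case False
  then show ?thesis using funpow_zero_mono[OF hom_F assms(3), of j] by (simp add: good_zero)
next
  case True
  \<comment> \<open>The string \<open>(F ^^ j) u\<close> has unnormalized steps, whereas an
    intertwiner must satisfy F (\<theta> j) = \<open>rt l j\<close> \<odot> \<theta> (j + 1);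
    dividing by the product of the earlier matrix elements repairs this.\<close>
  define a where "a j = (\<Prod>i<j. inverse (rt l i))" for j
  define \<theta> where "\<theta> j = a j \<odot> (F ^^ j) u" for j
  have aS: "a (Suc j) * rt l j = a j" if "j < l" for j
    using rt_nonzero[OF that] by (simp add: a_def)
  have "intertwiner l \<theta>"
    unfolding intertwiner_iff
  proof (intro allI impI conjI)
    fix j assume j: "j \<le> l"
    show "H (\<theta> j) = (of_nat l - 2 * of_nat j) \<odot> \<theta> j"
      using H_funpow_F[OF assms(1)] by (simp add: \<theta>_def H_simps mult.commute)
    show "F (\<theta> j) = (if j < l then rt l j \<odot> \<theta> (Suc j) else 0)"
      using aS[of j] assms(3) j by (auto simp: \<theta>_def F_simps mult.commute)
    show "E (\<theta> j) = (case j of 0 \<Rightarrow> 0 | Suc m \<Rightarrow> rt l m \<odot> \<theta> m)"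
    proof (cases j)
      case 0 then show ?thesis using assms(2) by (simp add: \<theta>_def E_simps)
    next
      case (Suc m)
      then have m: "m < l" using j by simp
      have "E (\<theta> j) = (a (Suc m) * (of_nat (Suc m) * (of_nat l - of_nat m))) \<odot> (F ^^ m) u"
        unfolding \<theta>_def Suc using E_funpow_F[OF assms(1,2), of m] by (simp add: E_simps)
      also have "a (Suc m) * (of_nat (Suc m) * (of_nat l - of_nat m)) = (a (Suc m) * rt l m) * rt l m"
        using rt_square[of m l] m by simp
      finally show ?thesis using aS[OF m] Suc by (simp add: \<theta>_def mult.commute)
    qed
  qed
  then have "good (inverse (a j) \<odot> \<theta> j)" using True by (intro good_scale good_intertwiner)
  moreover have "a j \<noteq> 0" using True by (auto simp: a_def rt_nonzero)
  ultimately show ?thesis by (simp add: \<theta>_def)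
qed

text \<open>Local nilpotency of E and F replaces finite dimension in the weight arguments
  below.\<close>

definition stable :: "'v set \<Rightarrow> bool" where
  "stable T \<longleftrightarrow> subspace T \<and> (\<forall>v\<in>T. E v \<in> T \<and> F v \<in> T \<and> (\<exists>n. (E ^^ n) v = 0) \<and> (\<exists>n. (F ^^ n) v = 0))"

text \<open>Induction on the power of E that kills v. If the power n + 1 does, u =
  \<open>(E ^^ n) v\<close> is a highest weight vector of weight k + 2n, and
  \<open>(F ^^ n) u\<close> lies in the same weight space as v. Subtracting a suitable multiple of
  it leaves a vector killed by the power n. The multiple exists because the factors k + 2n - i with
  i < n are positive, which is where k \<ge> 0 enters.\<close>

lemma good_weight_nonneg:
  assumes T: "stable T"
  shows "v \<in> T \<Longrightarrow> H v = of_nat k \<odot> v \<Longrightarrow> (E ^^ n) v = 0 \<Longrightarrow> good v"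
proof (induction n arbitrary: v)
  case 0
  then show ?case by (simp add: good_zero)
next
  case (Suc n)
  have ET: "(E ^^ i) w \<in> T" "(F ^^ i) w \<in> T" if "w \<in> T" for i w
    using T that by (induction i) (auto simp: stable_def)
  define u where "u = (E ^^ n) v"
  have uT: "u \<in> T" unfolding u_def by (rule ET) (rule Suc)
  have Hu: "H u = of_nat (k + 2 * n) \<odot> u"
    unfolding u_def using H_funpow_E[OF Suc.prems(2), of n] by simp
  have Eu: "E u = 0" using Suc.prems(3) by (simp add: u_def)
  show ?case
  proof (cases "u = 0")
    case True
    then show ?thesis using Suc by (simp add: u_def)
  next
    case False
    obtain m where m: "(F ^^ m) u = 0" using uT T by (auto simp: stable_def)
    obtain l where l: "(of_nat (k + 2 * n) :: complex) = of_nat l" "(F ^^ Suc l) u = 0"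
      by (rule highest_weight_integral[OF Hu Eu False m])
    then have l': "l = k + 2 * n" by (metis of_nat_eq_iff)
    define c where "c = (\<Prod>i<n. of_nat (Suc i) * (of_nat (k + 2 * n) - of_nat i) :: complex)"
    have c: "c \<noteq> 0"
      unfolding c_def
    proof (subst prod_zero_iff, simp, rule notI, elim bexE)
      fix i assume "i \<in> {..<n}" "of_nat (Suc i) * (of_nat (k + 2 * n) - of_nat i) = (0::complex)"
      then have "(of_nat (k + 2 * n) :: complex) = of_nat i" using of_nat_neq_0 by (auto simp del: of_nat_Suc)
      then have "k + 2 * n = i" by (metis of_nat_eq_iff)
      with \<open>i \<in> {..<n}\<close> show False by simp
    qed
    define w where "w = (F ^^ n) u"
    have Ew: "(E ^^ n) w = c \<odot> u" unfolding w_def c_def by (rule funpow_E_funpow_F[OF Hu Eu])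
    have Hw: "H w = of_nat k \<odot> w"
      unfolding w_def using H_funpow_F[OF Hu, of n] by (simp add: of_nat_add)
    have gw: "good w" unfolding w_def using good_highest_weight[of u l n] Hu Eu l l' by simp
    define v' where "v' = v - inverse c \<odot> w"
    have "(E ^^ n) v' = 0"
      using funpow_linear[OF hom_E, of n 1 v "- inverse c" w] c unfolding v'_def Ew by (simp add: u_def)
    moreover have "v' \<in> T" unfolding v'_def
      using T Suc.prems(1) ET(2)[OF uT] by (auto simp: stable_def w_def subspace_diff subspace_scale)
    moreover have "H v' = of_nat k \<odot> v'"
      unfolding v'_def using Suc.prems(2) Hw by (simp add: H_simps scale_right_diff_distrib mult.commute)
    ultimately have "good v'" using Suc.IH by blast
    then have "good (v' + inverse c \<odot> w)" by (intro good_add good_scale gw)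
    then show ?thesis by (simp add: v'_def)
  qed
qed

text \<open>The Weyl reflection of sl2. It reduces negative weights to nonnegative ones.\<close>

lemma swap: "sl2_rep scale (\<lambda>v. - H v) F E"
proof
  show "- H (a + b) = - H a + - H b" "- H (c \<odot> a) = c \<odot> - H a" 
      "F (a + b) = F a + F b" "F (c \<odot> a) = c \<odot> F a"
      "E (a + b) = E a + E b" "E (c \<odot> a) = c \<odot> E a" for a b c
    by (simp_all add: H_simps E_simps F_simps)
  show "- H (F v) = F (- H v) + 2 \<odot> F v" "- H (E v) = E (- H v) - 2 \<odot> E v" 
    "F (E v) = E (F v) + - H v" for v
    by (simp_all add: HF HE EF F_simps E_simps)
qed

text \<open>Reversing the weight basis, \<open>e\<^sub>j\<close> to
  \<open>e\<^sub>d\<^sub>-\<^sub>j\<close>, turns an intertwiner for the reflected triple into one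
  for the original triple; the matrix elements agree by \<open>rt_reflect\<close>.\<close>

lemma good_swap: "sl2_rep.good scale (\<lambda>v. - H v) F E v \<Longrightarrow> good v"
proof (induction rule: sl2_rep.good.induct[OF swap, consumes 1])
  case (2 d \<theta> j)
  have i: "- H (\<theta> j) = (of_nat d - 2 * of_nat j) \<odot> \<theta> j \<and>
     F (\<theta> j) = (case j of 0 \<Rightarrow> 0 | Suc m \<Rightarrow> rt d m \<odot> \<theta> m) \<and>
     E (\<theta> j) = (if j < d then rt d j \<odot> \<theta> (Suc j) else 0)" if "j \<le> d" for j
    using 2(1) that unfolding sl2_rep.intertwiner_iff[OF swap] by blast
  have "intertwiner d (\<lambda>j. \<theta> (d - j))"
    unfolding intertwiner_iff
  proof (intro allI impI conjI)
    fix j assume j: "j \<le> d"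
    have "H (\<theta> (d - j)) = - ((of_nat d - 2 * of_nat (d - j)) \<odot> \<theta> (d - j))"
      using i[of "d - j"] by (metis diff_le_self minus_equation_iff)
    then show "H (\<theta> (d - j)) = (of_nat d - 2 * of_nat j) \<odot> \<theta> (d - j)"
      using j by (simp add: of_nat_diff flip: scale_minus_left)
    show "E (\<theta> (d - j)) = (case j of 0 \<Rightarrow> 0 | Suc m \<Rightarrow> rt d m \<odot> \<theta> (d - m))"
      using i[of "d - j"] j rt_reflect by (auto split: nat.splits simp: Suc_diff_Suc)
    show "F (\<theta> (d - j)) = (if j < d then rt d j \<odot> \<theta> (d - Suc j) else 0)"
      using i[of "d - j"] j rt_reflect[of j d] by (auto simp: diff_Suc split: nat.splits)
  qed
  then show ?case using good_intertwiner[of d "\<lambda>j. \<theta> (d - j)" "d - j"] 2(2) by simp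
qed (auto intro: good.intros)

lemma good_weight:
  assumes T: "stable T" "v \<in> T" and "H v = of_int k \<odot> v"
  shows "good v"
proof (cases "k \<ge> 0")
  case True
  then obtain n where "(E ^^ n) v = 0" using T by (auto simp: stable_def)
  then show ?thesis using good_weight_nonneg[OF T, of "nat k" n] assms(3) True by simp
next
  case False
  obtain n where n: "(F ^^ n) v = 0" using T by (auto simp: stable_def)
  have "sl2_rep.stable scale F E T"
    using T by (auto simp: sl2_rep.stable_def[OF swap] stable_def)
  moreover have "- H v = of_nat (nat (- k)) \<odot> v"
    using False assms(3) by (simp flip: scale_minus_left)
  ultimately show ?thesis
    using sl2_rep.good_weight_nonneg[OF swap _ T(2) _ n] good_swap by blast
qed

text \<open>Clebsch-Gordan: the image of an intertwiner defined on \<open>V\<^sub>d \<otimes> V\<^sub>e\<close> is spanned by images of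
  intertwiners defined on irreducible representations.\<close>

lemma good_tensor:
  fixes \<psi> :: "nat \<Rightarrow> nat \<Rightarrow> 'v"
  assumes \<psi>: "\<And>i j. i \<le> d \<Longrightarrow> j \<le> e \<Longrightarrow>
      H (\<psi> i j) = (\<Sum>k\<le>d. ent uH d k i \<odot> \<psi> k j) + (\<Sum>k\<le>e. ent uH e k j \<odot> \<psi> i k) \<and>
      E (\<psi> i j) = (\<Sum>k\<le>d. ent uXp d k i \<odot> \<psi> k j) + (\<Sum>k\<le>e. ent uXp e k j \<odot> \<psi> i k) \<and>
      F (\<psi> i j) = (\<Sum>k\<le>d. ent uXm d k i \<odot> \<psi> k j) + (\<Sum>k\<le>e. ent uXm e k j \<odot> \<psi> i k)"
    and ij: "i \<le> d" "j \<le> e"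
  shows "good (\<psi> i j)"
proof -
  define T where "T = span {\<psi> i j | i j. i \<le> d \<and> j \<le> e}"
  have \<psi>T: "\<psi> i j \<in> T" if "i \<le> d" "j \<le> e" for i j
    unfolding T_def using that by (intro span_base) auto
  have sub: "subspace T" unfolding T_def by simp
  have E: "E (\<psi> i j) = (case i of 0 \<Rightarrow> 0 | Suc m \<Rightarrow> rt d m \<odot> \<psi> m j) +
      (case j of 0 \<Rightarrow> 0 | Suc m \<Rightarrow> rt e m \<odot> \<psi> i m)"
    and F: "F (\<psi> i j) = (if i < d then rt d i \<odot> \<psi> (Suc i) j else 0) +
      (if j < e then rt e j \<odot> \<psi> i (Suc j) else 0)"
    and H: "H (\<psi> i j) = of_int (int d + int e - 2 * int i - 2 * int j) \<odot> \<psi> i j"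
    if "i \<le> d" "j \<le> e" for i j
    using \<psi>[OF that] sum_uXp[OF that(1), of "\<lambda>k. \<psi> k j"] sum_uXm[OF that(1), of "\<lambda>k. \<psi> k j"] 
      sum_uH[OF that(1), of "\<lambda>k. \<psi> k j"] sum_uXp[OF that(2)] sum_uXm[OF that(2)] sum_uH[OF that(2)]
    by (simp_all add: algebra_simps flip: scale_left_distrib)
  \<comment> \<open>E lowers i + j by one and F lowers (d - i) + (e - j) by one, so these numbers
    bound the nilpotency orders. Together they make the span T stable.\<close>
  have Enil: "(E ^^ n) (\<psi> i j) = 0" if "i \<le> d" "j \<le> e" "i + j < n" for n i j
    using that
  proof (induction n arbitrary: i j)
    case (Suc n)
    have "(E ^^ Suc n) (\<psi> i j) = (E ^^ n) (E (\<psi> i j))" by (simp only: funpow_Suc_right o_apply)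
    also have "E (\<psi> i j) = (case i of 0 \<Rightarrow> 0 | Suc m \<Rightarrow> rt d m) \<odot> \<psi> (i - 1) j +
      (case j of 0 \<Rightarrow> 0 | Suc m \<Rightarrow> rt e m) \<odot> \<psi> i (j - 1)"
      using E[OF Suc.prems(1,2)] by (auto split: nat.splits)
    also have "(E ^^ n) \<dots> = 0"
      unfolding funpow_linear[OF hom_E] using Suc by (auto split: nat.splits)
    finally show ?case .
  qed auto
  have Fnil: "(F ^^ n) (\<psi> i j) = 0" if "i \<le> d" "j \<le> e" "(d - i) + (e - j) < n" for n i j
    using that
  proof (induction n arbitrary: i j)
    case (Suc n)
    have "(F ^^ Suc n) (\<psi> i j) = (F ^^ n) (F (\<psi> i j))" by (simp only: funpow_Suc_right o_apply)
    also have "F (\<psi> i j) = (if i < d then rt d i else 0) \<odot> \<psi> (Suc i) j +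
      (if j < e then rt e j else 0) \<odot> \<psi> i (Suc j)"
      using F[OF Suc.prems(1,2)] by auto
    also have "(F ^^ n) \<dots> = 0"
      unfolding funpow_linear[OF hom_F] using Suc by auto
    finally show ?case .
  qed auto
  have "\<exists>n. (E ^^ n) v = 0 \<and> (F ^^ n) v = 0" if "v \<in> T" for v
    using that unfolding T_def
  proof (induction rule: span_induct_alt)
    case base
    show ?case by (intro exI[of _ 0]) simp
  next
    case (step c x y)
    then obtain i j n where *: "x = \<psi> i j" "i \<le> d" "j \<le> e" "(E ^^ n) y = 0" "(F ^^ n) y = 0" by auto
    define m where "m = n + Suc (d + e)"
    have "(E ^^ m) x = 0" "(F ^^ m) x = 0" "(E ^^ m) y = 0" "(F ^^ m) y = 0"
      using * funpow_zero_mono[OF hom_E, of n y m] funpow_zero_mono[OF hom_F, of n y m]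
        Enil[of i j m] Fnil[of i j m] by (simp_all add: m_def del: funpow.simps)
    then show ?case
      using funpow_linear[OF hom_E, of m c x 1 y] funpow_linear[OF hom_F, of m c x 1 y] by auto
  qed
  moreover have "E v \<in> T \<and> F v \<in> T" if "v \<in> T" for v
    using that unfolding T_def
  proof (induction rule: span_induct_alt)
    case base
    show ?case by (simp add: E_simps F_simps span_zero)
  next
    case (step c x y)
    then obtain i j where *: "x = \<psi> i j" "i \<le> d" "j \<le> e" by auto
    have "E x \<in> T" "F x \<in> T"
      unfolding *(1) E[OF *(2,3)] F[OF *(2,3)] using * sub
      by (auto split: nat.splits intro!: subspace_add subspace_scale \<psi>T intro: subspace_0)
    then show ?case using step unfolding T_def by (simp add: E_simps F_simps span_add span_scale)
  qed
  ultimately have "stable T" using sub unfolding stable_def by blast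
  then show ?thesis using good_weight[OF _ \<psi>T[OF ij] H[OF ij]] by blast
qed

section \<open>Extension of the action from polynomials in the generators to the completion\<close>

inductive prel :: "nat uhat \<Rightarrow> ('v \<Rightarrow> 'v) \<Rightarrow> bool" where
  prel_H: "prel uH H"
| prel_E: "prel uXp E"
| prel_F: "prel uXm F"
| prel_one: "prel 1 (\<lambda>v. v)"
| prel_add: "prel u a \<Longrightarrow> prel v b \<Longrightarrow> prel (u + v) (\<lambda>x. a x + b x)"
| prel_scale: "prel u a \<Longrightarrow> prel (uscale c u) (\<lambda>x. c \<odot> a x)"
| prel_mult: "prel u a \<Longrightarrow> prel v b \<Longrightarrow> prel (u * v) (\<lambda>x. a (b x))"

lemma upoly_prel: "u \<in> upoly \<Longrightarrow> \<exists>a. prel u a"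
  by (induction rule: upoly.induct) (blast intro: prel.intros)+

lemma prel_hom: "prel u a \<Longrightarrow> a (x + y) = a x + a y \<and> a (c \<odot> x) = c \<odot> a x"
  by (induction arbitrary: x y c rule: prel.induct)
    (auto simp: H_simps E_simps F_simps algebra_simps)

lemma prel_zero: "prel u a \<Longrightarrow> a 0 = 0"
  using prel_hom[of u a 0 0 0] by simp

lemma prel_sum: "prel u a \<Longrightarrow> a (\<Sum>i\<in>I. f i) = (\<Sum>i\<in>I. a (f i))"
  by (induction I rule: infinite_finite_induct) (auto simp: prel_hom prel_zero)

text \<open>\<open>prel\<close> is a relation because an element has many expressions in the
  generators, and these might induce different operators. On images of intertwiners the matrix of u
  alone determines the result, whatever the expression.\<close>

lemma prel_intertwiner:
  "prel u a \<Longrightarrow> intertwiner d \<theta> \<Longrightarrow> j \<le> d \<Longrightarrow> a (\<theta> j) = (\<Sum>i\<le>d. ent u d i j \<odot> \<theta> i)"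
proof (induction arbitrary: j rule: prel.induct)
  case prel_one
  then show ?case by (subst sum.remove[of _ j]) (auto simp: ent_one intro!: sum.neutral)
next
  case (prel_mult u a v b)
  have "a (b (\<theta> j)) = (\<Sum>k\<le>d. ent v d k j \<odot> a (\<theta> k))"
    using prel_mult by (simp add: prel_sum[OF prel_mult(1)] prel_hom[OF prel_mult(1)])
  also have "\<dots> = (\<Sum>k\<le>d. \<Sum>i\<le>d. (ent u d i k * ent v d k j) \<odot> \<theta> i)"
    using prel_mult by (simp add: scale_sum_right mult.commute)
  also have "\<dots> = (\<Sum>i\<le>d. ent (u * v) d i j \<odot> \<theta> i)"
    by (subst sum.swap) (simp add: ent_times scale_sum_left)
  finally show ?case .
qed (auto simp: intertwiner_def scale_left_distrib sum.distrib scale_sum_right)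

definition cont :: "(nat uhat \<Rightarrow> 'v) \<Rightarrow> bool" where
  "cont R \<longleftrightarrow> (\<exists>L. \<forall>u u'. (\<forall>d\<le>L. ent u d = ent u' d) \<longrightarrow> R u = R u')"

lemma cont_add: "cont R \<Longrightarrow> cont R' \<Longrightarrow> cont (\<lambda>u. R u + R' u)"
  unfolding cont_def
proof (elim exE)
  fix L L' assume "\<forall>u u'. (\<forall>d\<le>L. ent u d = ent u' d) \<longrightarrow> R u = R u'"
    "\<forall>u u'. (\<forall>d\<le>L'. ent u d = ent u' d) \<longrightarrow> R' u = R' u'"
  then show "\<exists>L. \<forall>u u'. (\<forall>d\<le>L. ent u d = ent u' d) \<longrightarrow> R u + R' u = R u' + R' u'"
    by (intro exI[of _ "max L L'"]) (metis max.coboundedI1 max.coboundedI2)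
qed

text \<open>The vector is fixed and the algebra element varies: R is the orbit map of v, prescribed
  on polynomials and depending on finitely many components of its argument.\<close>

definition extends :: "'v \<Rightarrow> (nat uhat \<Rightarrow> 'v) \<Rightarrow> bool" where
  "extends v R \<longleftrightarrow> cont R \<and> (\<forall>u a. prel u a \<longrightarrow> a v = R u)"

lemma extends_intertwiner:
  assumes "intertwiner d \<theta>" "j \<le> d"
  shows "extends (\<theta> j) (\<lambda>u. \<Sum>i\<le>d. ent u d i j \<odot> \<theta> i)"
  using prel_intertwiner[OF _ assms] unfolding extends_def cont_def
  by (auto intro!: exI[of _ d])

lemma extends_add: "extends v R \<Longrightarrow> extends w R' \<Longrightarrow> extends (v + w) (\<lambda>u. R u + R' u)"
  unfolding extends_def using cont_add prel_hom by auto

lemma good_extends: "good v \<Longrightarrow> \<exists>R. extends v R"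
proof (induction rule: good.induct)
  case good_zero
  then show ?case by (intro exI[of _ "\<lambda>_. 0"]) (auto simp: extends_def cont_def prel_zero)
qed (blast intro: extends_intertwiner extends_add)+

text \<open>Choosing an orbit map instead of a decomposition of v makes additivity in v immediate
  once orbit maps are unique, which is what density provides.\<close>

definition ext :: "nat uhat \<Rightarrow> 'v \<Rightarrow> 'v" where
  "ext u v = (SOME R. extends v R) u"

lemma extends_unique:
  assumes upoly_dense "extends v R" "extends v R'"
  shows "R = R'"
proof
  fix u
  obtain L where L: "\<And>u u'. (\<forall>d\<le>L. ent u d = ent u' d) \<Longrightarrow> R u = R u'"
    using assms(2) unfolding extends_def cont_def by blast
  obtain L' where L': "\<And>u u'. (\<forall>d\<le>L'. ent u d = ent u' d) \<Longrightarrow> R' u = R' u'"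
    using assms(3) unfolding extends_def cont_def by blast
  obtain p where p: "p \<in> upoly" "\<And>d. d \<le> max L L' \<Longrightarrow> ent p d = ent u d"
    using assms(1) unfolding upoly_dense_def by blast
  obtain a where a: "prel p a" using upoly_prel[OF p(1)] by blast
  have "R u = R p" "R' u = R' p" using L[of p u] L'[of p u] p(2) by simp_all
  then show "R u = R' u" using a assms(2,3) unfolding extends_def by metis
qed

context
  assumes dense: upoly_dense
begin

lemma ext_eq: "extends v R \<Longrightarrow> ext u v = R u"
  unfolding ext_def using extends_unique[OF dense] by (metis someI)

lemma extends_ext: "good v \<Longrightarrow> extends v (\<lambda>u. ext u v)"
  using good_extends ext_eq by (metis (no_types, lifting) ext)

lemma ext_intertwiner:
  "intertwiner d \<theta> \<Longrightarrow> j \<le> d \<Longrightarrow> ext u (\<theta> j) = (\<Sum>i\<le>d. ent u d i j \<odot> \<theta> i)"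
  by (rule ext_eq[OF extends_intertwiner])

lemma ext_zero: "ext u 0 = 0"
proof -
  have "extends 0 (\<lambda>_. 0)" by (auto simp: extends_def cont_def prel_zero)
  then show ?thesis by (rule ext_eq)
qed

lemma ext_add: "good v \<Longrightarrow> good w \<Longrightarrow> ext u (v + w) = ext u v + ext u w"
  by (rule ext_eq[OF extends_add[OF extends_ext extends_ext]])

lemma ext_scale: "good v \<Longrightarrow> ext u (c \<odot> v) = c \<odot> ext u v"
proof (induction rule: good.induct)
  case (good_intertwiner d \<theta> j)
  then show ?case
    using ext_intertwiner[OF intertwiner_scale[OF good_intertwiner(1)]] ext_intertwiner[of d \<theta>]
    by (simp add: scale_sum_right mult.commute)
next
  case (good_add v w)
  then show ?case by (simp add: scale_right_distrib ext_add good_scale)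
qed (simp add: ext_zero)

lemma ext_sum: "(\<And>i. i \<in> I \<Longrightarrow> good (f i)) \<Longrightarrow> ext u (\<Sum>i\<in>I. f i) = (\<Sum>i\<in>I. ext u (f i))"
  by (induction I rule: infinite_finite_induct) (auto simp: ext_zero ext_add good_sum)

lemma ext_prel: "prel u a \<Longrightarrow> good v \<Longrightarrow> ext u v = a v"
  using extends_ext unfolding extends_def by metis

lemma ext_cont: "good v \<Longrightarrow> cont (\<lambda>u. ext u v)"
  using extends_ext unfolding extends_def by blast

lemma ext_good: "good v \<Longrightarrow> good (ext u v)"
proof (induction rule: good.induct)
  case (good_intertwiner d \<theta> j)
  then show ?case by (auto simp: ext_intertwiner intro!: good_sum good_scale intro: good.intros)
qed (auto simp: ext_zero ext_add good.intros)

lemma ext_uadd: "good v \<Longrightarrow> ext (u + u') v = ext u v + ext u' v"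
  by (induction rule: good.induct)
    (auto simp: ext_zero ext_add ext_intertwiner scale_left_distrib sum.distrib)

lemma ext_uscale: "good v \<Longrightarrow> ext (uscale c u) v = c \<odot> ext u v"
  by (induction rule: good.induct)
    (auto simp: ext_zero ext_add ext_intertwiner scale_right_distrib scale_sum_right)

lemma ext_one: "good v \<Longrightarrow> ext 1 v = v"
  using ext_prel[OF prel_one] by simp

lemma ext_mult: "good v \<Longrightarrow> ext (u * u') v = ext u (ext u' v)"
proof (induction rule: good.induct)
  case (good_intertwiner d \<theta> j)
  have g: "good (\<theta> i)" if "i \<le> d" for i using good.good_intertwiner good_intertwiner(1) that .
  have "ext u (ext u' (\<theta> j)) = (\<Sum>k\<le>d. ent u' d k j \<odot> ext u (\<theta> k))"
    using good_intertwiner g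
    by (simp add: ext_intertwiner[of d \<theta> j]) (subst ext_sum, auto intro: good_scale simp: ext_scale)
  also have "\<dots> = (\<Sum>k\<le>d. \<Sum>i\<le>d. (ent u d i k * ent u' d k j) \<odot> \<theta> i)"
    using good_intertwiner by (simp add: ext_intertwiner scale_sum_right mult.commute)
  also have "\<dots> = ext (u * u') (\<theta> j)"
    using good_intertwiner by (subst sum.swap) (simp add: ent_times scale_sum_left ext_intertwiner)
  finally show ?case by simp
qed (auto simp: ext_zero ext_add ext_good)

text \<open>A map commuting with the generators sends intertwiners to intertwiners with the same
  matrices, hence commutes with the whole completion. The case needed is right multiplication in the
  two-leg algebra.\<close>

lemma
  assumes T: "module_hom scale scale T" "\<And>v. T (H v) = H (T v)" "\<And>v. T (E v) = E (T v)" "\<And>v. T (F v) = F (T v)"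
  shows good_commute: "good v \<Longrightarrow> good (T v)"
    and ext_commute: "good v \<Longrightarrow> ext u (T v) = T (ext u v)"
proof -
  have i: "intertwiner d (\<lambda>j. T (\<theta> j))" if "intertwiner d \<theta>" for d \<theta>
    using that T(2,3,4)[symmetric]
    by (auto simp: intertwiner_def module_hom.sum[OF T(1)] module_hom.scale[OF T(1)])
  show g: "good v \<Longrightarrow> good (T v)" for v
  proof (induction rule: good.induct)
    case (good_intertwiner d \<theta> j)
    then show ?case using good.good_intertwiner[OF i] by blast
  qed (auto simp: module_hom.zero[OF T(1)] module_hom.add[OF T(1)] intro: good.intros)
  show "good v \<Longrightarrow> ext u (T v) = T (ext u v)"
  proof (induction rule: good.induct)
    case (good_intertwiner d \<theta> j)
    then show ?case using ext_intertwiner[OF i, of d \<theta>] ext_intertwiner[of d \<theta>]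
      by (simp add: module_hom.sum[OF T(1)] module_hom.scale[OF T(1)])
  qed (auto simp: module_hom.zero[OF T(1)] module_hom.add[OF T(1)] ext_zero ext_add g)
qed

end

end

section \<open>The coproduct\<close>

lemma sum_rotate:
  "(\<Sum>x\<in>A. \<Sum>y\<in>B. \<Sum>z\<in>C. f x y z) = (\<Sum>y\<in>B. \<Sum>z\<in>C. \<Sum>x\<in>A. f x y z)"
  by (subst sum.swap, rule sum.cong[OF refl], rule sum.swap)

lemma slice_mult: "slice (X * Y) t k l = (\<Sum>j\<in>{..t}. slice X t k j * slice Y t j l)"
  by (rule uhat_ext) (simp add: ent_times sum_atMost_Pair, rule sum.swap)

lemma slice_one: "slice 1 t k l = (if k = l \<and> k \<le> t then 1 else 0)"
  by (rule uhat_ext) (auto simp: ent_one)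

lemma ent_uH_mult: "ent (uH * A) d m n = (of_nat d - 2 * of_nat m) * ent A d m n"
proof (cases "m \<le> d")
  case True
  then show ?thesis
    by (subst ent_times, subst sum.remove[of _ m]) (auto simp: ent_uH intro!: sum.neutral)
qed (simp add: ent_outside)

lemma ent_uXp_mult: "ent (uXp * A) d m n = (if m < d then rt d m * ent A d (Suc m) n else 0)"
proof (cases "m < d")
  case True
  then show ?thesis
    by (subst ent_times, subst sum.remove[of _ "Suc m"]) (auto simp: ent_uXp intro!: sum.neutral)
qed (auto simp: ent_times ent_uXp intro!: sum.neutral)

lemma ent_uXm_mult:
  "ent (uXm * A) d m n = (case m of 0 \<Rightarrow> 0 | Suc j \<Rightarrow> if m \<le> d then rt d j * ent A d j n else 0)"
proof (cases m)
  case 0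
  then show ?thesis by (auto simp: ent_times ent_uXm)
next
  case (Suc j)
  show ?thesis
  proof (cases "m \<le> d")
    case True
    then show ?thesis unfolding Suc
      by (subst ent_times, subst sum.remove[of _ j]) (auto simp: ent_uXm intro!: sum.neutral)
  next
    case False
    then show ?thesis using Suc by (simp add: ent_outside)
  qed
qed

lemma sl2_relations:
  "uH * uXp = uXp * uH + uscale 2 uXp"
  "uH * uXm = uXm * uH + uscale (- 2) uXm"
  "uXp * uXm = uXm * uXp + uH"
proof -
  show "uH * uXp = uXp * uH + uscale 2 uXp"
    by (rule uhat_ext) (auto simp: ent_uH_mult ent_uXp_mult ent_uH ent_uXp algebra_simps)
  show "uH * uXm = uXm * uH + uscale (- 2) uXm"
    by (rule uhat_ext) (auto simp: ent_uH_mult ent_uXm_mult ent_uH ent_uXm algebra_simps split: nat.splits)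
  show "uXp * uXm = uXm * uXp + uH"
  proof (rule uhat_ext)
    fix d m n
    show "ent (uXp * uXm) d m n = ent (uXm * uXp + uH) d m n"
      by (auto simp: ent_uXp_mult ent_uXm_mult ent_uH ent_uXp ent_uXm rt_square split: nat.splits)
        (simp_all add: algebra_simps)
  qed
qed

section \<open>The two-leg algebra as an sl2 module\<close>

definition primitive :: "nat uhat \<Rightarrow> (nat \<times> nat) uhat" where
  "primitive X = tens X 1 + tens 1 X"

lemma primitive_commutator:
  assumes "X * Y = Y * X + Z"
  shows "primitive X * primitive Y = primitive Y * primitive X + primitive Z"
proof -
  have "primitive X * primitive Y = tens (X * Y) 1 + tens X Y + tens Y X + tens 1 (X * Y)"
    by (simp add: primitive_def algebra_simps tens_mult)
  also have "\<dots> = primitive Y * primitive X + primitive Z"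
    unfolding assms by (simp add: primitive_def algebra_simps tens_mult tens_add_left tens_add_right)
  finally show ?thesis .
qed

lemma primitive_uscale: "primitive (uscale c X) = uscale c (primitive X)"
  by (simp add: primitive_def tens_uscale_left tens_uscale_right uscale_add)

lemma flip_primitive: "flip (primitive X) = primitive X"
  by (simp add: primitive_def flip_add add.commute)

lemma module_uscale: "module (uscale :: complex \<Rightarrow> 's::spin_label uhat \<Rightarrow> 's uhat)"
  by standard (auto simp: uscale_add add_uscale)

lemma module_hom_uscale_mult_left: "module_hom uscale uscale (\<lambda>Y. X * Y)"
  and module_hom_uscale_mult_right: "module_hom uscale uscale (\<lambda>Y. Y * X)"
  by (auto simp: module_hom_def module_hom_axioms_def module_uscale algebra_simps
      uscale_mult_left uscale_mult_right)

text \<open>Left multiplication moves only the row index of a matrix, so each column of the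
  component at (d, e) is a copy of \<open>V\<^sub>d \<otimes> V\<^sub>e\<close>.\<close>

interpretation cg: sl2_rep "uscale :: complex \<Rightarrow> (nat \<times> nat) uhat \<Rightarrow> (nat \<times> nat) uhat"
  "\<lambda>Y. primitive uH * Y" "\<lambda>Y. primitive uXp * Y" "\<lambda>Y. primitive uXm * Y"
proof (intro sl2_rep.intro sl2_rep_axioms.intro module_uscale module_hom_uscale_mult_left)
  fix Y :: "(nat \<times> nat) uhat"
  show "primitive uH * (primitive uXp * Y) = primitive uXp * (primitive uH * Y) + uscale 2 (primitive uXp * Y)"
    using primitive_commutator[OF sl2_relations(1)]
    by (simp add: primitive_uscale uscale_mult_left distrib_right flip: mult.assoc)
  have "uscale (-2) Z = - uscale 2 Z" for Z :: "(nat \<times> nat) uhat"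
    by (rule uhat_ext) simp
  then show "primitive uH * (primitive uXm * Y) = primitive uXm * (primitive uH * Y) - uscale 2 (primitive uXm * Y)"
    using primitive_commutator[OF sl2_relations(2)]
    by (simp add: primitive_uscale uscale_mult_left distrib_right left_diff_distrib flip: mult.assoc)
  show "primitive uXp * (primitive uXm * Y) = primitive uXm * (primitive uXp * Y) + primitive uH * Y"
    using primitive_commutator[OF sl2_relations(3)] by (simp add: distrib_right flip: mult.assoc)
qed

definition unit_at :: "'s::spin_label \<Rightarrow> 's \<Rightarrow> 's \<Rightarrow> 's uhat" where
  "unit_at s i j = mk (\<lambda>t m n. if t = s \<and> m = i \<and> n = j then 1 else 0)"

text \<open>The unit is the infinite sum of these central idempotents, whereas \<open>good\<close>
  allows finite sums only; therefore the coproduct has to be assembled component by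
  component.\<close>

definition component :: "'s::spin_label \<Rightarrow> 's uhat" where
  "component s = mk (\<lambda>t m n. if t = s \<and> m = n then 1 else 0)"

lemma ent_unit_at: "ent (unit_at s i j) t m n = (if t = s \<and> m = i \<and> n = j \<and> i \<le> s \<and> j \<le> s then 1 else 0)"
  by (auto simp: unit_at_def)

lemma ent_component: "ent (component s) t m n = (if t = s then ent 1 t m n else 0)"
  by (auto simp: component_def ent_one)

lemma ent_component_mult: "ent (component s * X) t m n = (if t = s then ent X t m n else 0)"
  and ent_mult_component: "ent (X * component s) t m n = (if t = s then ent X t m n else 0)"
proof -
  show "ent (component s * X) t m n = (if t = s then ent X t m n else 0)"
    by (cases "m \<le> t") (auto simp: ent_times ent_component sum_ent_one_left ent_outside)
  show "ent (X * component s) t m n = (if t = s then ent X t m n else 0)"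
    by (cases "n \<le> t") (auto simp: ent_times ent_component sum_ent_one_right ent_outside)
qed

lemma ent_mult_unit_at:
  "ent (X * unit_at s i j) t m n = (if t = s \<and> n = j \<and> j \<le> s then ent X s m i else 0)"
proof (cases "i \<le> s")
  case True
  have "ent (X * unit_at s i j) t m n = (\<Sum>k\<in>{..t}. if k = i then (if t = s \<and> n = j \<and> j \<le> s then ent X s m i else 0) else 0)"
    unfolding ent_times using True by (intro sum.cong) (auto simp: ent_unit_at)
  also have "\<dots> = (if t = s \<and> n = j \<and> j \<le> s then ent X s m i else 0)"
    using True by (subst sum.delta) auto
  finally show ?thesis .
qed (auto simp: ent_times ent_unit_at ent_outside)

lemma primitive_mult_unit_at:
  assumes "i \<le> d" "j \<le> e"
  shows "primitive X * unit_at (d, e) (i, j) c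
    = (\<Sum>k\<le>d. uscale (ent X d k i) (unit_at (d, e) (k, j) c)) + (\<Sum>k\<le>e. uscale (ent X e k j) (unit_at (d, e) (i, k) c))"
proof (rule uhat_ext)
  fix t m n :: "nat \<times> nat"
  obtain a b where m: "m = (a, b)" by (cases m)
  have d: "(\<Sum>k\<le>d. ent X d k i * (if t = (d, e) \<and> a = k \<and> b = j \<and> k \<le> d \<and> n = c \<and> c \<le> (d, e) then 1 else 0))
      = (if t = (d, e) \<and> b = j \<and> n = c \<and> c \<le> (d, e) then ent X d a i else 0)"
  proof (cases "a \<le> d")
    case True
    then show ?thesis by (subst sum.remove[of _ a]) (auto intro!: sum.neutral)
  qed (auto simp: ent_outside intro!: sum.neutral)
  have e: "(\<Sum>k\<le>e. ent X e k j * (if t = (d, e) \<and> a = i \<and> b = k \<and> k \<le> e \<and> n = c \<and> c \<le> (d, e) then 1 else 0))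
      = (if t = (d, e) \<and> a = i \<and> n = c \<and> c \<le> (d, e) then ent X e b j else 0)"
  proof (cases "b \<le> e")
    case True
    then show ?thesis by (subst sum.remove[of _ b]) (auto intro!: sum.neutral)
  qed (auto simp: ent_outside intro!: sum.neutral)
  show "ent (primitive X * unit_at (d, e) (i, j) c) t m n
    = ent ((\<Sum>k\<le>d. uscale (ent X d k i) (unit_at (d, e) (k, j) c)) + (\<Sum>k\<le>e. uscale (ent X e k j) (unit_at (d, e) (i, k) c))) t m n"
    using assms d e unfolding m
    by (simp add: ent_unit_at ent_mult_unit_at primitive_def ent_one less_eq_prod_def)
qed

text \<open>The column c is a spectator, and the row runs through the product basis of
  \<open>V\<^sub>d \<otimes> V\<^sub>e\<close>, so Clebsch-Gordan applies.\<close>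

lemma good_unit_at: "i \<le> s \<Longrightarrow> cg.good (unit_at s i c)"
proof -
  assume i: "i \<le> s"
  obtain d e a b where s: "s = (d, e)" "i = (a, b)" by (metis surj_pair)
  have "cg.good ((\<lambda>a b. unit_at s (a, b) c) a b)"
    by (rule cg.good_tensor[of d e "\<lambda>a b. unit_at s (a, b) c"])
      (use i in \<open>auto simp: s less_eq_prod_def primitive_mult_unit_at\<close>)
  then show ?thesis by (simp add: s)
qed

lemma good_component: "cg.good (component s)"
proof -
  have "component s = (\<Sum>i\<in>{..s}. unit_at s i i)"
  proof (rule uhat_ext)
    fix t m n
    have "(\<Sum>i\<in>{..s}. ent (unit_at s i i) t m n) = (\<Sum>i\<in>{..s}. if i = m then (if t = s \<and> m = n then 1 else 0) else 0)"
      by (intro sum.cong) (auto simp: ent_unit_at)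
    then show "ent (component s) t m n = ent (\<Sum>i\<in>{..s}. unit_at s i i) t m n"
      by (simp add: ent_component ent_one)
  qed
  then show ?thesis by (auto intro!: cg.good_sum good_unit_at)
qed

text \<open>\<open>\<Delta>(u)\<close> is the value of u on the unit, since
  \<open>\<Delta>(u) = \<Delta>(u) 1\<close>. This uses only the action on the module and requires
  no expression of u in the generators.\<close>

definition coproduct :: "nat uhat \<Rightarrow> (nat \<times> nat) uhat" where
  "coproduct u = mk (\<lambda>s m n. ent (cg.ext u (component s)) s m n)"

lemma ent_coproduct: "ent (coproduct u) s m n = ent (cg.ext u (component s)) s m n"
  by (auto simp: coproduct_def ent_outside)

context
  assumes dense: upoly_dense
begin

text \<open>Right multiplications commute with the left multiplications that define the module; this
  is the source of multiplicativity of the coproduct.\<close>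

lemma ext_mult_right:
  assumes "cg.good Y"
  shows "cg.good (Y * Z)" "cg.ext u (Y * Z) = cg.ext u Y * Z"
  using cg.good_commute[OF dense module_hom_uscale_mult_right[of Z] _ _ _ assms]
    cg.ext_commute[OF dense module_hom_uscale_mult_right[of Z] _ _ _ assms]
  by (simp_all add: mult.assoc)

lemma ext_component: "cg.ext u (component s) = component s * coproduct u"
proof -
  \<comment> \<open>Idempotency together with \<open>ext_mult_right\<close> shows that the value of
    u on the component s stays supported at s.\<close>
  have "component s * component s = component s"
    by (rule uhat_ext) (simp add: ent_component_mult ent_component)
  then have *: "cg.ext u (component s) * component s = cg.ext u (component s)"
    using ext_mult_right(2)[OF good_component, of u s "component s"] by simp
  show ?thesis
    by (rule uhat_ext) (subst * [symmetric], simp add: ent_mult_component ent_component_mult ent_coproduct)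
qed

lemma is_coproduct_coproduct: "is_coproduct coproduct"
  unfolding is_coproduct_def
proof (intro conjI allI ballI)
  show "coproduct 1 = 1"
    by (rule uhat_ext) (simp add: ent_coproduct cg.ext_one[OF dense good_component] ent_component)
  show "coproduct (u + v) = coproduct u + coproduct v" for u v
    by (rule uhat_ext) (simp add: ent_coproduct cg.ext_uadd[OF dense good_component])
  show "coproduct (uscale c u) = uscale c (coproduct u)" for c u
    by (rule uhat_ext) (simp add: ent_coproduct cg.ext_uscale[OF dense good_component])
  show "coproduct (u * v) = coproduct u * coproduct v" for u v
  proof (rule uhat_ext)
    fix s m n
    \<comment> \<open>The value of v on the idempotent is the idempotent times
      \<open>coproduct v\<close>, and the right factor passes through the action of u.\<close>
    have "cg.ext (u * v) (component s) = cg.ext u (component s) * coproduct v"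
      by (simp add: cg.ext_mult[OF dense good_component] ext_component[of v] ext_mult_right(2) good_component)
    then show "ent (coproduct (u * v)) s m n = ent (coproduct u * coproduct v) s m n"
      unfolding ent_coproduct by (simp add: ent_times ent_coproduct)
  qed
  fix X assume "X \<in> {uH, uXp, uXm}"
  then have "cg.prel X (\<lambda>Y. primitive X * Y)" by (auto intro: cg.prel.intros)
  then have "cg.ext X (component s) = primitive X * component s" for s
    using cg.ext_prel[OF dense _ good_component] by blast
  then show "coproduct X = tens X 1 + tens 1 X"
    by (intro uhat_ext) (simp add: ent_coproduct ent_mult_component primitive_def)
next
  fix s
  obtain L where L: "\<And>u u'. (\<forall>d\<le>L. ent u d = ent u' d) \<Longrightarrow> cg.ext u (component s) = cg.ext u' (component s)"
    using cg.ext_cont[OF dense good_component, of s] unfolding cg.cont_def by blast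
  then have "(\<forall>d\<le>L. ent u d = ent v d) \<Longrightarrow> ent (coproduct u) s = ent (coproduct v) s" for u v
    unfolding fun_eq_iff ent_coproduct by metis
  then show "\<exists>L. \<forall>u v. (\<forall>d\<le>L. ent u d = ent v d) \<longrightarrow> ent (coproduct u) s = ent (coproduct v) s"
    by blast
qed

text \<open>Two candidates agree on polynomials by the algebra rules; at each s both see only
  finitely many components of u, and there u can be replaced by a polynomial.\<close>

lemma is_coproduct_unique:
  assumes D: "is_coproduct D" and D': "is_coproduct D'"
  shows "D = D'"
proof
  fix u
  have poly: "D p = D' p" if "p \<in> upoly" for p
    using that D D' by (induction rule: upoly.induct) (simp_all add: is_coproduct_def)
  have "ent (D u) s = ent (D' u) s" for s
  proof -
    obtain L where L: "\<And>u v. (\<forall>d\<le>L. ent u d = ent v d) \<Longrightarrow> ent (D u) s = ent (D v) s"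
      using D unfolding is_coproduct_def by blast
    obtain L' where L': "\<And>u v. (\<forall>d\<le>L'. ent u d = ent v d) \<Longrightarrow> ent (D' u) s = ent (D' v) s"
      using D' unfolding is_coproduct_def by blast
    obtain p where p: "p \<in> upoly" "\<And>d. d \<le> max L L' \<Longrightarrow> ent p d = ent u d"
      using dense unfolding upoly_dense_def by blast
    have "ent (D u) s = ent (D p) s" "ent (D' u) s = ent (D' p) s"
      using L[of p u] L'[of p u] p(2) by simp_all
    then show ?thesis using poly[OF p(1)] by simp
  qed
  then show "D u = D' u" by (intro uhat_ext) simp
qed

lemma is_coproduct_cop: "is_coproduct cop"
  unfolding cop_def by (rule theI[of _ coproduct]) (auto intro: is_coproduct_coproduct is_coproduct_unique)

lemma cop_simps:
  "cop 1 = 1" "cop (u + v) = cop u + cop v" "cop (u * v) = cop u * cop v"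
  "cop (uscale c u) = uscale c (cop u)"
  "cop uH = primitive uH" "cop uXp = primitive uXp" "cop uXm = primitive uXm"
  using is_coproduct_cop unfolding is_coproduct_def primitive_def by auto

lemma cop_continuous:
  obtains L where "\<And>u v. (\<forall>d\<le>L. ent u d = ent v d) \<Longrightarrow> ent (cop u) s = ent (cop v) s"
  using is_coproduct_cop unfolding is_coproduct_def by blast

lemma cop_zero: "cop 0 = 0"
  using cop_simps(4)[of 0 0] by simp

lemma cop_sum: "cop (\<Sum>i\<in>I. f i) = (\<Sum>i\<in>I. cop (f i))"
  by (induction I rule: infinite_finite_induct) (auto simp: cop_zero cop_simps)

text \<open>Primitive elements are symmetric, so the flipped map satisfies the same characterization
  and uniqueness identifies the two.\<close>

lemma flip_cop: "flip (cop u) = cop u"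
proof -
  have "is_coproduct (\<lambda>u. flip (cop u))"
    unfolding is_coproduct_def
  proof (intro conjI allI ballI)
    fix s :: "nat \<times> nat"
    obtain L where L: "\<And>u v. (\<forall>d\<le>L. ent u d = ent v d) \<Longrightarrow> ent (cop u) (prod.swap s) = ent (cop v) (prod.swap s)"
      using cop_continuous by blast
    have "ent (flip (cop u)) s = ent (flip (cop v)) s" if "\<forall>d\<le>L. ent u d = ent v d" for u v
      using L[OF that] by (intro ext) (cases s, auto)
    then show "\<exists>L. \<forall>u v. (\<forall>d\<le>L. ent u d = ent v d) \<longrightarrow> ent (flip (cop u)) s = ent (flip (cop v)) s"
      by blast
  qed (auto simp: cop_simps flip_add flip_mult flip_uscale flip_primitive, auto simp: primitive_def)
  then show ?thesis using is_coproduct_unique[OF _ is_coproduct_cop] by metis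
qed

lemma ent_cop_left: "ent (cop_left X) (d, e, f) (m, k, p) (n, l, r) = ent (cop (slice X f p r)) (d, e) (m, k) (n, l)"
proof -
  have "slice X f p r = 0" if "\<not> (p \<le> f \<and> r \<le> f)"
    by (rule uhat_ext) (use that in \<open>auto simp: ent_outside\<close>)
  then show ?thesis by (auto simp: cop_left_def cop_zero ent_outside)
qed

lemma ent_cop_right: "ent (cop_right X) (d, e, f) (m, k, p) (n, l, r) = ent (cop (slice (flip X) d m n)) (e, f) (k, p) (l, r)"
proof -
  have "slice (flip X) d m n = 0" if "\<not> (m \<le> d \<and> n \<le> d)"
    by (rule uhat_ext) (use that in \<open>auto simp: ent_outside\<close>)
  then show ?thesis by (auto simp: cop_right_def cop_zero ent_outside)
qed

lemma cop_left_mult: "cop_left (X * Y) = cop_left X * cop_left Y"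
proof (rule uhat_ext)
  fix s m n :: "nat \<times> nat \<times> nat"
  obtain d e f m1 k p n1 l r where eq: "s = (d, e, f)" "m = (m1, k, p)" "n = (n1, l, r)"
    by (metis prod_cases3)
  show "ent (cop_left (X * Y)) s m n = ent (cop_left X * cop_left Y) s m n"
    unfolding eq
    by (simp add: ent_times sum_atMost_Pair ent_cop_left slice_mult cop_sum cop_simps, rule sum_rotate)
qed

lemma cop_right_mult: "cop_right (X * Y) = cop_right X * cop_right Y"
proof (rule uhat_ext)
  fix s m n :: "nat \<times> nat \<times> nat"
  obtain d e f m1 k p n1 l r where eq: "s = (d, e, f)" "m = (m1, k, p)" "n = (n1, l, r)"
    by (metis prod_cases3)
  show "ent (cop_right (X * Y)) s m n = ent (cop_right X * cop_right Y) s m n"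
    unfolding eq
    by (simp add: ent_times sum_atMost_Pair ent_cop_right slice_mult flip_mult cop_sum cop_simps)
qed

lemma cop_left_one: "cop_left 1 = 1"
  by (rule uhat_ext) (auto simp: ent_cop_left slice_one cop_simps cop_zero ent_one split: if_splits)

lemma cop_right_one: "cop_right 1 = 1"
  by (rule uhat_ext) (auto simp: ent_cop_right slice_one cop_simps cop_zero ent_one split: if_splits)

lemma flip213_cop_left: "flip213 (cop_left X) = cop_left X"
proof (rule uhat_ext)
  fix s m n :: "nat \<times> nat \<times> nat"
  obtain d e f m1 k p n1 l r where eq: "s = (d, e, f)" "m = (m1, k, p)" "n = (n1, l, r)"
    by (metis prod_cases3)
  show "ent (flip213 (cop_left X)) s m n = ent (cop_left X) s m n"
    unfolding eq using ent_flip[of "cop (slice X f p r)" d e m1 k n1 l] by (simp add: ent_cop_left flip_cop)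
qed

end

lemma tens_one_mult: "tens 1 X * tens 1 Y = tens 1 (X * Y)"
  by (simp add: tens_mult)

text \<open>The matrix of the exchange relation compares the two orders \<open>W\<close> and \<open>W\<^sub>2\<^sub>1\<^sub>3\<close> of a double twisted
  product: cocommutativity cancels the remaining factors.\<close>

lemma exchange_cocycle:
  assumes dense: upoly_dense and F: "invertible_uhat F"
  defines "W \<equiv> cop_right (uinv (flip F)) * tens 1 (uinv (flip F))"
  shows "flip213 W * (flip213 (tilde_phi F) * pad (tilde_R F) * uinv (tilde_phi F)) = W"
proof -
  define G where "G = flip F"
  define R where "R = uinv G"
  have "G * flip (uinv F) = 1" "flip (uinv F) * G = 1"
    unfolding G_def using uinv_mult[OF F] by (simp_all flip: flip_mult)
  then have "invertible_uhat G" unfolding invertible_uhat_def by blast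
  then have GR: "G * R = 1" "R * G = 1" unfolding R_def by (rule uinv_mult)+
  \<comment> \<open>V is the matrix of the bracketing (a \<star> b) \<star> c, as W is the one of a
    \<star> (b \<star> c); \<open>V'\<close> and \<open>W'\<close> are their inverses, and
    \<open>tilde_phi F\<close> is \<open>W' * V\<close>.\<close>
  define V where "V = cop_left R * pad R"
  define V' where "V' = pad G * cop_left G"
  define W' where "W' = tens 1 G * cop_right G"
  have W: "W = cop_right R * tens 1 R" by (simp add: W_def R_def G_def)
  have mid: "X * Y = 1 \<Longrightarrow> (A * X) * (Y * C) = A * C" for A X Y C :: "(nat \<times> nat \<times> nat) uhat"
  proof -
    assume "X * Y = 1"
    moreover have "(A * X) * (Y * C) = A * (X * Y) * C" by (simp only: mult.assoc)
    ultimately show ?thesis by simp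
  qed
  have inv: "cop_left R * cop_left G = 1" "cop_left G * cop_left R = 1"
      "cop_right R * cop_right G = 1" "cop_right G * cop_right R = 1"
      "pad R * pad G = 1" "pad G * pad R = 1" "tens 1 R * tens 1 G = (1 :: (nat \<times> nat \<times> nat) uhat)"
      "tens 1 G * tens 1 R = (1 :: (nat \<times> nat \<times> nat) uhat)"
    by (simp_all only: cop_left_mult[OF dense, symmetric] cop_right_mult[OF dense, symmetric]
        pad_mult[symmetric] tens_one_mult GR cop_left_one[OF dense] cop_right_one[OF dense] pad_one tens_one_one)
  have VV: "V * V' = 1" "V' * V = 1" and WW: "W * W' = 1" "W' * W = 1"
    unfolding V_def V'_def W W'_def by (simp_all only: mid inv)
  have phi: "tilde_phi F = W' * V"
    by (simp add: tilde_phi_def Let_def W'_def V_def R_def G_def mult.assoc)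
  have "tilde_phi F * (V' * W) = 1" "V' * W * tilde_phi F = 1"
    unfolding phi by (simp_all only: mid VV WW)
  then have inv_phi: "uinv (tilde_phi F) = V' * W" by (rule uinv_eq)
  have R: "pad (tilde_R F) = pad (flip G) * pad R"
    by (simp add: tilde_R_def Let_def G_def R_def pad_mult)
  have "pad (flip R) * pad (flip G) = 1"
    using GR by (simp flip: pad_mult flip_mult)
  \<comment> \<open>The swap fixes the factor \<open>cop_left R\<close> and turns
    \<open>pad R\<close> into its flipped version, which cancels the left factor of
    \<open>tilde_R F = flip G * R\<close>.\<close>
  then have V: "flip213 V * pad (tilde_R F) = V"
    unfolding V_def flip213_mult flip213_cop_left[OF dense] flip213_pad R by (rule mid)
  have fW: "flip213 W * flip213 W' = 1"
    by (simp add: WW flip: flip213_mult)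
  \<comment> \<open>After regrouping, the three cancellations just established occur in turn and
    leave W.\<close>
  have "flip213 W * (flip213 (tilde_phi F) * pad (tilde_R F) * uinv (tilde_phi F))
      = (flip213 W * flip213 W') * ((flip213 V * pad (tilde_R F)) * V') * W"
    unfolding inv_phi unfolding phi flip213_mult by (simp only: mult.assoc)
  then show ?thesis by (simp only: fW V VV mult_1_left)
qed

section \<open>The mode algebra\<close>

lemma poly_mapping_expand:
  fixes f :: "'k \<Rightarrow>\<^sub>0 'b::comm_monoid_add"
  shows "f = (\<Sum>\<mu>\<in>keys f. single \<mu> (lookup f \<mu>))"
proof (rule poly_mapping_eqI)
  fix \<nu>
  have "(\<Sum>\<mu>\<in>keys f. lookup (single \<mu> (lookup f \<mu>)) \<nu>) = (\<Sum>\<mu>\<in>keys f. if \<mu> = \<nu> then lookup f \<nu> else 0)"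
    by (intro sum.cong) (auto simp: lookup_single)
  then show "lookup f \<nu> = lookup (\<Sum>\<mu>\<in>keys f. single \<mu> (lookup f \<mu>)) \<nu>"
    by (simp add: lookup_sum in_keys_iff)
qed

lemma poly_mapping_induct [case_names zero single add]:
  fixes f :: "'k \<Rightarrow>\<^sub>0 'b::comm_monoid_add"
  assumes "P 0" "\<And>\<mu> a. P (single \<mu> a)" "\<And>f g. P f \<Longrightarrow> P g \<Longrightarrow> P (f + g)"
  shows "P f"
proof -
  have "P (\<Sum>\<mu>\<in>I. single \<mu> (lookup f \<mu>))" for I
    by (induction I rule: infinite_finite_induct) (auto intro: assms)
  then show ?thesis using poly_mapping_expand[of f] by metis
qed

text \<open>The operations on polynomials are sums over \<open>keys\<close>, and keys may cancel in
  a sum of polynomials. Additivity survives because the summands vanish at coefficient 0.\<close>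

definition lin_ext :: "('k \<Rightarrow> 'b::zero \<Rightarrow> 'c::comm_monoid_add) \<Rightarrow> ('k \<Rightarrow>\<^sub>0 'b) \<Rightarrow> 'c" where
  "lin_ext \<phi> f = (\<Sum>\<mu>\<in>keys f. \<phi> \<mu> (lookup f \<mu>))"

lemma lin_ext_zero [simp]: "lin_ext \<phi> 0 = 0"
  by (simp add: lin_ext_def)

lemma lin_ext_single: "\<phi> \<mu> 0 = 0 \<Longrightarrow> lin_ext \<phi> (single \<mu> a) = \<phi> \<mu> a"
  by (simp add: lin_ext_def)

lemma lin_ext_add:
  fixes f g :: "'k \<Rightarrow>\<^sub>0 'b::comm_monoid_add"
  assumes "\<And>\<mu>. \<phi> \<mu> 0 = 0" "\<And>\<mu> a b. \<phi> \<mu> (a + b) = \<phi> \<mu> a + \<phi> \<mu> b"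
  shows "lin_ext \<phi> (f + g) = lin_ext \<phi> f + lin_ext \<phi> g"
  unfolding lin_ext_def by (rule setsum_keys_plus_distrib) (auto simp: assms)

lemma lin_ext_sum:
  fixes f :: "'i \<Rightarrow> 'k \<Rightarrow>\<^sub>0 'b::comm_monoid_add"
  assumes "\<And>\<mu>. \<phi> \<mu> 0 = 0" "\<And>\<mu> a b. \<phi> \<mu> (a + b) = \<phi> \<mu> a + \<phi> \<mu> b"
  shows "lin_ext \<phi> (\<Sum>i\<in>I. f i) = (\<Sum>i\<in>I. lin_ext \<phi> (f i))"
  by (induction I rule: infinite_finite_induct) (auto simp: lin_ext_add[of \<phi>, OF assms])

lemma lin_ext_superset:
  "finite A \<Longrightarrow> keys f \<subseteq> A \<Longrightarrow> (\<And>\<mu>. \<phi> \<mu> 0 = 0) \<Longrightarrow> lin_ext \<phi> f = (\<Sum>\<mu>\<in>A. \<phi> \<mu> (lookup f \<mu>))"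
  unfolding lin_ext_def by (rule sum.mono_neutral_left) (auto simp: in_keys_iff)

lemma Const_simps [simp]:
  "Const 0 = 0" "Const 1 = 1" "Const (a + b) = Const a + Const b" "Const (a * b) = Const a * Const b"
  "Const (- a) = - Const a" "Const (a - b) = Const a - Const b"
  by (simp_all add: Const_def single_add mult_single single_uminus single_diff)

lemma Const_sum: "Const (\<Sum>i\<in>I. f i) = (\<Sum>i\<in>I. Const (f i))"
  by (induction I rule: infinite_finite_induct) auto

lemma Mon_simps [simp]: "Mon 0 = 1" "Mon (\<mu> + \<nu>) = Mon \<mu> * Mon \<nu>"
  by (simp_all add: Mon_def mult_single)

lemma single_eq_Const_Mon: "single \<mu> c = Const c * Mon \<mu>"
  by (simp add: Const_def Mon_def mult_single)

lemma Mon_single: "Mon (single x n) = Var x ^ n"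
proof (induction n)
  case (Suc n)
  have "single x (Suc n) = single x 1 + single x n" by (simp flip: single_add)
  then show ?case using Suc by (simp add: Var_def)
qed simp

lemma apoly_induct [case_names Const Var add mult]:
  assumes "\<And>c. P (Const c)" "\<And>x. P (Var x)" "\<And>f g. P f \<Longrightarrow> P g \<Longrightarrow> P (f + g)"
    "\<And>f g. P f \<Longrightarrow> P g \<Longrightarrow> P (f * g)"
  shows "P f"
proof (induction f rule: poly_mapping_induct)
  case zero
  show ?case using assms(1)[of 0] by simp
next
  case (single \<mu> c)
  have "P (Mon \<mu>)"
  proof (induction \<mu> rule: poly_mapping_induct)
    case zero
    show ?case using assms(1)[of 1] by simp
  next
    case (single x n)
    have "P (Var x ^ n)" using assms(1)[of 1] assms(2,4) by (induction n) auto
    then show ?case by (simp add: Mon_single)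
  qed (simp add: assms)
  then show ?case by (simp add: single_eq_Const_Mon assms)
qed (rule assms(3))

subsection \<open>Derivations\<close>

definition is_derivation :: "(apoly \<Rightarrow> apoly) \<Rightarrow> bool" where
  "is_derivation D \<longleftrightarrow> (\<forall>f g. D (f + g) = D f + D g) \<and> (\<forall>c f. D (Const c * f) = Const c * D f) \<and>
     (\<forall>f g. D (f * g) = D f * g + f * D g)"

lemma is_derivationD:
  assumes "is_derivation D"
  shows "D (f + g) = D f + D g" "D (Const c * f) = Const c * D f" "D (f * g) = D f * g + f * D g"
    "D 1 = 0" "D (Const c) = 0" "D 0 = 0" "D (\<Sum>i\<in>I. h i) = (\<Sum>i\<in>I. D (h i))"
proof -
  note D = assms[unfolded is_derivation_def]
  show "D (f + g) = D f + D g" "D (Const c * f) = Const c * D f" "D (f * g) = D f * g + f * D g"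
    using D by auto
  have "D (1 * 1) = D 1 * 1 + 1 * D 1" using D by blast
  then show 1: "D 1 = 0" by simp
  have "D (Const c * 1) = Const c * D 1" using D by blast
  then show "D (Const c) = 0" using 1 by simp
  have "D (Const 0 * 1) = Const 0 * D 1" using D by blast
  then show z: "D 0 = 0" by simp
  show "D (\<Sum>i\<in>I. h i) = (\<Sum>i\<in>I. D (h i))"
    using D z by (induction I rule: infinite_finite_induct) auto
qed

lemma is_derivationI:
  assumes "\<And>f g. D (f + g) = D f + D g" "\<And>c. D (Const c) = 0"
    "\<And>f g. D (f * g) = D f * g + f * D g"
  shows "is_derivation D"
  unfolding is_derivation_def by (simp add: assms)

lemma is_derivation_eqI:
  assumes "is_derivation D" "is_derivation D'" "\<And>x. D (Var x) = D' (Var x)"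
  shows "D f = D' f"
  by (induction f rule: apoly_induct)
    (simp_all add: is_derivationD[OF assms(1)] is_derivationD[OF assms(2)] assms(3))

lemma is_derivation_commutator:
  assumes "is_derivation D" "is_derivation D'"
  shows "is_derivation (\<lambda>f. D (D' f) - D' (D f))"
  by (rule is_derivationI)
    (simp_all add: is_derivationD[OF assms(1)] is_derivationD[OF assms(2)] algebra_simps)

lemma is_derivation_scale:
  assumes "is_derivation D"
  shows "is_derivation (\<lambda>f. Const c * D f)"
  by (rule is_derivationI) (simp_all add: is_derivationD[OF assms] algebra_simps)

lemma is_derivation_sum:
  assumes "\<And>i. i \<in> I \<Longrightarrow> is_derivation (D i)"
  shows "is_derivation (\<lambda>f. \<Sum>i\<in>I. D i f * h i)"
proof (rule is_derivationI)
  fix f g c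
  show "(\<Sum>i\<in>I. D i (f + g) * h i) = (\<Sum>i\<in>I. D i f * h i) + (\<Sum>i\<in>I. D i g * h i)"
    unfolding sum.distrib[symmetric]
    by (intro sum.cong refl) (simp add: is_derivationD(1)[OF assms] algebra_simps)
  show "(\<Sum>i\<in>I. D i (Const c) * h i) = 0"
    by (intro sum.neutral) (simp add: is_derivationD(5)[OF assms])
  show "(\<Sum>i\<in>I. D i (f * g) * h i) = (\<Sum>i\<in>I. D i f * h i) * g + f * (\<Sum>i\<in>I. D i g * h i)"
    unfolding sum_distrib_left sum_distrib_right sum.distrib[symmetric]
    by (intro sum.cong refl) (simp add: is_derivationD(3)[OF assms] algebra_simps)
qed

text \<open>The derivation with prescribed values \<delta> on the variables. Truncated subtraction
  of exponents is harmless: the coefficient vanishes whenever the exponent of x is 0.\<close>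

definition derivation_of :: "(mode \<Rightarrow> apoly) \<Rightarrow> apoly \<Rightarrow> apoly" where
  "derivation_of \<delta> = lin_ext (\<lambda>\<mu> c. \<Sum>x\<in>keys \<mu>. single (\<mu> - single x 1) (c * of_nat (lookup \<mu> x)) * \<delta> x)"

lemma derivation_of_single:
  assumes "finite V" "keys \<mu> \<subseteq> V"
  shows "derivation_of \<delta> (single \<mu> c) = (\<Sum>x\<in>V. single (\<mu> - single x 1) (c * of_nat (lookup \<mu> x)) * \<delta> x)"
  unfolding derivation_of_def using assms
  by (subst lin_ext_single) (auto simp: in_keys_iff intro!: sum.mono_neutral_left)

lemma derivation_of_add: "derivation_of \<delta> (f + g) = derivation_of \<delta> f + derivation_of \<delta> g"
  unfolding derivation_of_def
  by (rule lin_ext_add) (simp_all add: single_add distrib_right sum.distrib)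

lemma is_derivation_derivation_of: "is_derivation (derivation_of \<delta>)"
proof -
  have leib: "derivation_of \<delta> (f * g) = derivation_of \<delta> f * g + f * derivation_of \<delta> g" for f g
  proof (induction f rule: poly_mapping_induct)
    case zero
    show ?case by (simp add: derivation_of_def)
  next
    case (add f1 f2)
    then show ?case by (simp add: derivation_of_add algebra_simps)
  next
    case (single \<mu> a)
    show ?case
    proof (induction g rule: poly_mapping_induct)
      case zero
      show ?case by (simp add: derivation_of_def)
    next
      case (add f1 f2)
      then show ?case by (simp add: derivation_of_add algebra_simps)
    next
      case (single \<nu> b)
      define V where "V = keys \<mu> \<union> keys \<nu>"
      have V: "finite V" "keys \<mu> \<subseteq> V" "keys \<nu> \<subseteq> V" "keys (\<mu> + \<nu>) \<subseteq> V"
        using keys_add[of \<mu> \<nu>] by (auto simp: V_def)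
      have eq: "single (\<mu> + \<nu> - single x 1) (a * b * of_nat (lookup (\<mu> + \<nu>) x)) =
          single (\<mu> - single x 1) (a * of_nat (lookup \<mu> x)) * single \<nu> b
          + single \<mu> a * single (\<nu> - single x 1) (b * of_nat (lookup \<nu> x))" for x
      proof -
        \<comment> \<open>Lowering the exponent commutes with adding another monomial only if it was
          positive; in the remaining case both terms carry the coefficient 0.\<close>
        have le: "\<kappa> - single x 1 + \<tau> = \<kappa> + \<tau> - single x 1" if "lookup \<kappa> x \<noteq> 0" for \<kappa> \<tau> :: "mode \<Rightarrow>\<^sub>0 nat"
          using that by (intro poly_mapping_eqI) (auto simp: lookup_add lookup_minus lookup_single when_def)
        have 1: "single (\<mu> - single x 1) (a * of_nat (lookup \<mu> x)) * single \<nu> b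
            = single (\<mu> + \<nu> - single x 1) (a * b * of_nat (lookup \<mu> x))"
          using le[of \<mu> \<nu>] by (cases "lookup \<mu> x = 0") (auto simp: mult_single ac_simps)
        have 2: "single \<mu> a * single (\<nu> - single x 1) (b * of_nat (lookup \<nu> x))
            = single (\<mu> + \<nu> - single x 1) (a * b * of_nat (lookup \<nu> x))"
          using le[of \<nu> \<mu>] by (cases "lookup \<nu> x = 0") (auto simp: mult_single ac_simps)
        show ?thesis unfolding 1 2 by (simp add: lookup_add distrib_left flip: single_add)
      qed
      show ?case
        unfolding mult_single[of \<mu> a \<nu> b] derivation_of_single[OF V(1,4)] derivation_of_single[OF V(1,2)]
          derivation_of_single[OF V(1,3)] eq sum_distrib_left sum_distrib_right sum.distrib[symmetric]
        by (intro sum.cong refl) (simp add: algebra_simps)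
    qed
  qed
  have "derivation_of \<delta> (Const c) = 0" for c
    unfolding Const_def by (subst derivation_of_single[of "{}"]) auto
  then show ?thesis by (intro is_derivationI leib derivation_of_add)
qed

lemma derivation_of_Var [simp]: "derivation_of \<delta> (Var x) = \<delta> x"
  unfolding Var_def Mon_def
  by (subst derivation_of_single[of "{x}"]) auto

definition partial :: "mode \<Rightarrow> apoly \<Rightarrow> apoly" where
  "partial x = derivation_of (\<lambda>y. if y = x then 1 else 0)"

lemma is_derivation_partial: "is_derivation (partial x)"
  unfolding partial_def by (rule is_derivation_derivation_of)

lemma partial_Var [simp]: "partial x (Var y) = (if y = x then 1 else 0)"
  by (simp add: partial_def)

section \<open>The action on the mode algebra\<close>

text \<open>For a square matrix b with orthonormal columns, Q = 1 - b \<open>b\<^sup>*\<close> is a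
  Hermitian idempotent. Its squared Frobenius norm therefore equals its trace, and the trace is 0
  because b \<open>b\<^sup>*\<close> and \<open>b\<^sup>*\<close> b have the same trace. Hence Q =
  0.\<close>

lemma unitary_basis_rows:
  assumes "unitary_basis B" "i \<le> 2 * K" "j \<le> 2 * K"
  shows "(\<Sum>n\<le>2*K. cnj (B K i n) * B K j n) = (if i = j then 1 else 0)"
proof -
  define b where "b = B K"
  define Q where "Q i j = (if i = j then 1 else 0) - (\<Sum>n\<le>2*K. b i n * cnj (b j n))" for i j
  have col: "(\<Sum>i\<le>2*K. cnj (b i m) * b i n) = (if m = n then 1 else 0)" if "m \<le> 2*K" "n \<le> 2*K" for m n
    using assms(1) that by (auto simp: unitary_basis_def b_def)
  have PP: "(\<Sum>k\<le>2*K. (\<Sum>n\<le>2*K. b i n * cnj (b k n)) * (\<Sum>m\<le>2*K. b k m * cnj (b j m)))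
      = (\<Sum>n\<le>2*K. b i n * cnj (b j n))" for i j
  proof -
    have "(\<Sum>k\<le>2*K. (\<Sum>n\<le>2*K. b i n * cnj (b k n)) * (\<Sum>m\<le>2*K. b k m * cnj (b j m)))
        = (\<Sum>k\<le>2*K. \<Sum>n\<le>2*K. \<Sum>m\<le>2*K. b i n * cnj (b j m) * (cnj (b k n) * b k m))"
      unfolding sum_product by (simp add: ac_simps)
    also have "\<dots> = (\<Sum>n\<le>2*K. \<Sum>m\<le>2*K. \<Sum>k\<le>2*K. b i n * cnj (b j m) * (cnj (b k n) * b k m))"
      by (rule sum_rotate)
    also have "\<dots> = (\<Sum>n\<le>2*K. \<Sum>m\<le>2*K. if m = n then b i n * cnj (b j m) else 0)"
      by (intro sum.cong) (auto simp: sum_distrib_left[symmetric] col)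
    finally show ?thesis by simp
  qed
  have delta: "(\<Sum>k\<le>2*K. (if i = k then 1 else 0) * f k) = f i" "(\<Sum>k\<le>2*K. f k * (if k = i then 1 else 0)) = f i"
    if "i \<le> 2 * K" for i and f :: "nat \<Rightarrow> complex"
    using that by (simp_all add: if_distrib[of "\<lambda>x. x * _"] if_distrib[of "\<lambda>x. _ * x"] cong: if_cong)
  have QQ: "(\<Sum>k\<le>2*K. Q i k * Q k j) = Q i j" if "i \<le> 2*K" "j \<le> 2*K" for i j
    using that by (simp add: Q_def left_diff_distrib right_diff_distrib sum_subtractf delta PP)
  have Qsym: "Q k i = cnj (Q i k)" for i k by (simp add: Q_def mult.commute)
  have "(\<Sum>i\<le>2*K. \<Sum>k\<le>2*K. (cmod (Q i k))\<^sup>2) = Re (\<Sum>i\<le>2*K. Q i i)"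
  proof -
    have "(\<Sum>k\<le>2*K. complex_of_real ((cmod (Q i k))\<^sup>2)) = Q i i" if "i \<le> 2*K" for i
      unfolding QQ[OF that that, symmetric]
      by (intro sum.cong refl) (metis Qsym complex_norm_square)
    then have "(\<Sum>i\<le>2*K. \<Sum>k\<le>2*K. complex_of_real ((cmod (Q i k))\<^sup>2)) = (\<Sum>i\<le>2*K. Q i i)" by simp
    then show ?thesis by (metis (mono_tags, lifting) Re_complex_of_real of_real_sum sum.cong)
  qed
  also have "(\<Sum>i\<le>2*K. Q i i) = (\<Sum>i\<le>2*K. 1) - (\<Sum>n\<le>2*K. \<Sum>i\<le>2*K. cnj (b i n) * b i n)"
    unfolding Q_def by (simp add: sum_subtractf, subst sum.swap) (simp add: mult.commute)
  also have "\<dots> = 0" by (simp add: col)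
  finally have "(\<Sum>i\<le>2*K. \<Sum>k\<le>2*K. (cmod (Q i k))\<^sup>2) = 0" by simp
  then have "(\<Sum>k\<le>2*K. (cmod (Q j k))\<^sup>2) = 0"
    using assms(3) by (subst (asm) sum_nonneg_eq_0_iff) (auto intro!: sum_nonneg)
  then have "Q j i = 0"
    using assms(2) by (subst (asm) sum_nonneg_eq_0_iff) auto
  then show ?thesis by (auto simp: Q_def b_def mult.commute)
qed

lemma rep_add: "rep B K (u + v) m n = rep B K u m n + rep B K v m n"
  and rep_uscale: "rep B K (uscale c u) m n = c * rep B K u m n"
  by (simp_all add: rep_def algebra_simps sum.distrib sum_distrib_left)

lemma rep_mult:
  assumes B: "unitary_basis B"
  shows "rep B K (u * v) m n = (\<Sum>l\<le>2*K. rep B K u m l * rep B K v l n)"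
proof -
  define u' where "u' j = (\<Sum>i\<le>2*K. cnj (B K i m) * ent u (2 * K) i j)" for j
  define v' where "v' k = (\<Sum>p\<le>2*K. ent v (2 * K) k p * B K p n)" for k
  have u: "rep B K u m l = (\<Sum>j\<le>2*K. u' j * B K j l)" for l
    unfolding rep_def u'_def sum_distrib_right by (rule sum.swap)
  have v: "rep B K v l n = (\<Sum>k\<le>2*K. cnj (B K k l) * v' k)" for l
    unfolding rep_def v'_def by (simp add: sum_distrib_left mult.assoc)
  have "(\<Sum>l\<le>2*K. rep B K u m l * rep B K v l n)
      = (\<Sum>l\<le>2*K. \<Sum>j\<le>2*K. \<Sum>k\<le>2*K. u' j * v' k * (cnj (B K k l) * B K j l))"
    unfolding u v by (simp add: sum_product ac_simps)
  also have "\<dots> = (\<Sum>j\<le>2*K. \<Sum>k\<le>2*K. \<Sum>l\<le>2*K. u' j * v' k * (cnj (B K k l) * B K j l))"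
    by (rule sum_rotate)
  also have "\<dots> = (\<Sum>j\<le>2*K. \<Sum>k\<le>2*K. if k = j then u' j * v' j else 0)"
    by (intro sum.cong refl) (auto simp: sum_distrib_left[symmetric] unitary_basis_rows[OF B])
  also have "\<dots> = (\<Sum>j\<le>2*K. u' j * v' j)" by simp
  also have "\<dots> = (\<Sum>j\<le>2*K. \<Sum>i\<le>2*K. \<Sum>p\<le>2*K. cnj (B K i m) * (ent u (2*K) i j * ent v (2*K) j p) * B K p n)"
    unfolding u'_def v'_def sum_product by (simp add: ac_simps)
  also have "\<dots> = rep B K (u * v) m n"
    unfolding rep_def ent_times sum_distrib_left sum_distrib_right by (rule sum_rotate)
  finally show ?thesis by simp
qed


definition gen_var :: "basis_change \<Rightarrow> nat uhat \<Rightarrow> mode \<Rightarrow> apoly" where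
  "gen_var B X = (\<lambda>(K, n). if n \<le> 2 * K then \<Sum>m\<le>2*K. Var (K, m) * Const (rep B K X m n) else 0)"

definition gen_deriv :: "basis_change \<Rightarrow> nat uhat \<Rightarrow> apoly \<Rightarrow> apoly" where
  "gen_deriv B X = derivation_of (gen_var B X)"

lemma is_derivation_gen_deriv: "is_derivation (gen_deriv B X)"
  unfolding gen_deriv_def by (rule is_derivation_derivation_of)

lemmas gen_deriv_simps = is_derivationD[OF is_derivation_gen_deriv]

lemma gen_deriv_Var: "gen_deriv B X (Var x) = gen_var B X x"
  by (simp add: gen_deriv_def)

lemma gen_deriv_gen_deriv_Var:
  assumes "unitary_basis B"
  shows "gen_deriv B X (gen_deriv B Y (Var x)) = gen_var B (X * Y) x"
proof (cases x)
  case (Pair K n)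
  show ?thesis
  proof (cases "n \<le> 2 * K")
    case True
    have "gen_deriv B X (gen_deriv B Y (Var x)) = (\<Sum>m\<le>2*K. gen_var B X (K, m) * Const (rep B K Y m n))"
      using True unfolding Pair
      by (simp add: gen_deriv_Var gen_var_def[of B Y] gen_deriv_simps mult.commute[of _ "Const _"])
    also have "\<dots> = (\<Sum>m\<le>2*K. \<Sum>l\<le>2*K. Var (K, l) * Const (rep B K X l m * rep B K Y m n))"
      by (simp add: gen_var_def sum_distrib_right mult.assoc)
    also have "\<dots> = gen_var B (X * Y) x"
      using True unfolding Pair
      by (subst sum.swap) (simp add: gen_var_def rep_mult[OF assms] Const_sum sum_distrib_left)
    finally show ?thesis .
  qed (simp add: Pair gen_deriv_Var gen_var_def gen_deriv_simps)
qed

lemma gen_var_add: "gen_var B (X + Y) x = gen_var B X x + gen_var B Y x"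
  and gen_var_uscale: "gen_var B (uscale c X) x = Const c * gen_var B X x"
  by (cases x, simp add: gen_var_def rep_add rep_uscale distrib_left sum.distrib sum_distrib_left ac_simps)+

text \<open>A commutator of derivations is a derivation, so the relation needs to be checked on the
  variables only, where it is the representation property of \<open>rep\<close>.\<close>

lemma gen_deriv_commutator:
  assumes B: "unitary_basis B" and "X * Y = Y * X + uscale c Z"
  shows "gen_deriv B X (gen_deriv B Y f) = gen_deriv B Y (gen_deriv B X f) + Const c * gen_deriv B Z f"
proof -
  have "gen_deriv B X (gen_deriv B Y f) - gen_deriv B Y (gen_deriv B X f) = Const c * gen_deriv B Z f"
    by (rule is_derivation_eqI[OF is_derivation_commutator[OF is_derivation_gen_deriv is_derivation_gen_deriv]
          is_derivation_scale[OF is_derivation_gen_deriv]])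
      (simp add: gen_deriv_gen_deriv_Var[OF B, unfolded gen_deriv_Var] assms(2) gen_var_add gen_var_uscale gen_deriv_Var)
  then show ?thesis by (simp add: algebra_simps)
qed

lemma module_Const: "module (\<lambda>c f. Const c * f)"
  by standard (auto simp: algebra_simps)

lemma module_hom_gen_deriv: "module_hom (\<lambda>c f. Const c * f) (\<lambda>c f. Const c * f) (gen_deriv B X)"
  by (auto simp: module_hom_def module_hom_axioms_def module_Const gen_deriv_simps)

locale mode_action =
  fixes B :: basis_change
  assumes unitary: "unitary_basis B" and dense: upoly_dense
begin

sublocale poly: sl2_rep "\<lambda>c f. Const c * f" "gen_deriv B uH" "gen_deriv B uXp" "gen_deriv B uXm"
proof (intro sl2_rep.intro sl2_rep_axioms.intro module_Const module_hom_gen_deriv)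
  fix f
  show "gen_deriv B uH (gen_deriv B uXp f) = gen_deriv B uXp (gen_deriv B uH f) + Const 2 * gen_deriv B uXp f"
    by (rule gen_deriv_commutator[OF unitary sl2_relations(1)])
  show "gen_deriv B uH (gen_deriv B uXm f) = gen_deriv B uXm (gen_deriv B uH f) - Const 2 * gen_deriv B uXm f"
    using gen_deriv_commutator[OF unitary sl2_relations(2), of f] by simp
  show "gen_deriv B uXp (gen_deriv B uXm f) = gen_deriv B uXm (gen_deriv B uXp f) + gen_deriv B uH f"
    using gen_deriv_commutator[OF unitary, of uXp uXm 1 uH] sl2_relations(3) by simp
qed

declare poly.scale_scale [simp del]

text \<open>The weight vectors recovered from the modes by the inverse of the unitary matrix
  \<open>B K\<close>. Intertwiners are formulated in the weight basis, the modes in the chosen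
  one.\<close>

definition basis_vec :: "nat \<Rightarrow> nat \<Rightarrow> apoly" where
  "basis_vec K i = (\<Sum>m\<le>2*K. Const (cnj (B K i m)) * Var (K, m))"

lemma Var_eq_basis_vec:
  assumes "n \<le> 2 * K"
  shows "Var (K, n) = (\<Sum>j\<le>2*K. Const (B K j n) * basis_vec K j)"
proof -
  have "(\<Sum>j\<le>2*K. Const (B K j n) * basis_vec K j)
      = (\<Sum>j\<le>2*K. \<Sum>m\<le>2*K. Const (cnj (B K j m) * B K j n) * Var (K, m))"
    by (simp add: basis_vec_def sum_distrib_left ac_simps)
  also have "\<dots> = (\<Sum>m\<le>2*K. Const (\<Sum>j\<le>2*K. cnj (B K j m) * B K j n) * Var (K, m))"
    by (subst sum.swap) (simp add: Const_sum sum_distrib_right)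
  also have "\<dots> = (\<Sum>m\<le>2*K. if m = n then Var (K, m) else 0)"
    using assms unitary by (intro sum.cong refl) (simp add: unitary_basis_def del: Const_simps(4) cong: if_cong)
  finally show ?thesis using assms by simp
qed

lemma sum_rep_Var:
  "(\<Sum>m\<le>2*K. Var (K, m) * Const (rep B K u m n)) = (\<Sum>j\<le>2*K. Const (B K j n) * (\<Sum>i\<le>2*K. Const (ent u (2*K) i j) * basis_vec K i))"
proof -
  have "(\<Sum>m\<le>2*K. Var (K, m) * Const (rep B K u m n))
    = (\<Sum>m\<le>2*K. \<Sum>i\<le>2*K. \<Sum>j\<le>2*K. Var (K, m) * Const (cnj (B K i m) * ent u (2*K) i j * B K j n))"
    unfolding rep_def Const_sum sum_distrib_left ..
  also have "\<dots> = (\<Sum>i\<le>2*K. \<Sum>j\<le>2*K. \<Sum>m\<le>2*K. Var (K, m) * Const (cnj (B K i m) * ent u (2*K) i j * B K j n))"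
    by (rule sum_rotate)
  also have "\<dots> = (\<Sum>j\<le>2*K. \<Sum>i\<le>2*K. \<Sum>m\<le>2*K. Var (K, m) * Const (cnj (B K i m) * ent u (2*K) i j * B K j n))"
    by (rule sum.swap)
  finally show ?thesis by (simp add: basis_vec_def sum_distrib_left ac_simps)
qed

lemma gen_deriv_basis_vec:
  assumes "j \<le> 2 * K"
  shows "gen_deriv B X (basis_vec K j) = (\<Sum>i\<le>2*K. Const (ent X (2*K) i j) * basis_vec K i)"
proof -
  have "gen_deriv B X (basis_vec K j) = (\<Sum>n\<le>2*K. Const (cnj (B K j n)) * (\<Sum>m\<le>2*K. Var (K, m) * Const (rep B K X m n)))"
    by (simp add: basis_vec_def gen_deriv_simps gen_deriv_Var gen_var_def)
  also have "\<dots> = (\<Sum>n\<le>2*K. \<Sum>k\<le>2*K. Const (cnj (B K j n) * B K k n) * (\<Sum>i\<le>2*K. Const (ent X (2*K) i k) * basis_vec K i))"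
    by (simp only: sum_rep_Var) (simp add: sum_distrib_left ac_simps)
  also have "\<dots> = (\<Sum>k\<le>2*K. Const (\<Sum>n\<le>2*K. cnj (B K j n) * B K k n) * (\<Sum>i\<le>2*K. Const (ent X (2*K) i k) * basis_vec K i))"
    by (subst sum.swap) (simp only: Const_sum sum_distrib_right)
  also have "\<dots> = (\<Sum>k\<le>2*K. if k = j then (\<Sum>i\<le>2*K. Const (ent X (2*K) i k) * basis_vec K i) else 0)"
    using assms by (intro sum.cong refl) (simp add: unitary_basis_rows[OF unitary] del: Const_simps(4))
  finally show ?thesis using assms by simp
qed

lemma intertwiner_basis_vec: "poly.intertwiner (2 * K) (basis_vec K)"
  unfolding poly.intertwiner_def by (simp add: gen_deriv_basis_vec)

lemma intertwiner_invariant: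
  "(\<And>X. X \<in> {uH, uXp, uXm} \<Longrightarrow> gen_deriv B X f = 0) \<Longrightarrow> poly.intertwiner 0 (\<lambda>_. f)"
  by (simp add: poly.intertwiner_def ent_uH ent_uXp ent_uXm)

lemma good_invariant: "(\<And>X. X \<in> {uH, uXp, uXm} \<Longrightarrow> gen_deriv B X f = 0) \<Longrightarrow> poly.good f"
  using poly.good_intertwiner[OF intertwiner_invariant] by blast

text \<open>Since the generators act by derivations, multiplication is an intertwiner from the
  tensor product of two representations into the mode algebra, and Clebsch-Gordan decomposes its
  image.\<close>

lemma good_mult: "poly.good f \<Longrightarrow> poly.good g \<Longrightarrow> poly.good (f * g)"
proof (induction arbitrary: g rule: poly.good.induct)
  case (good_intertwiner d \<theta> i)
  note \<theta> = this(1,2)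
  show ?case using \<open>poly.good g\<close>
  proof (induction rule: poly.good.induct)
    case (good_intertwiner e \<theta>' j)
    show ?case
      by (rule poly.good_tensor[where d = d and e = e and \<psi> = "\<lambda>i j. \<theta> i * \<theta>' j"])
        (use \<theta>[unfolded poly.intertwiner_def] good_intertwiner[unfolded poly.intertwiner_def]
          in \<open>auto simp: gen_deriv_simps sum_distrib_left sum_distrib_right ac_simps\<close>)
  qed (auto simp: distrib_left intro: poly.good.intros)
qed (auto simp: distrib_right intro: poly.good.intros)

lemma good: "poly.good f"
proof (induction f rule: apoly_induct)
  case (Const c)
  show ?case by (rule good_invariant) (simp add: gen_deriv_simps)
next
  case (Var x)
  obtain K n where x: "x = (K, n)" by (cases x)
  show ?case
  proof (cases "n \<le> 2 * K")
    case True
    then show ?thesis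
      using poly.good_intertwiner[OF intertwiner_basis_vec]
      by (auto simp: x Var_eq_basis_vec intro!: poly.good_sum poly.good_scale)
  next
    case False
    then show ?thesis by (intro good_invariant) (simp add: x gen_deriv_Var gen_var_def)
  qed
qed (auto intro: poly.good_add good_mult)

lemma ext_generator: "X \<in> {uH, uXp, uXm} \<Longrightarrow> poly.ext X f = gen_deriv B X f"
  using poly.ext_prel[OF dense _ good] poly.prel_H poly.prel_E poly.prel_F by blast

lemma is_action_ext: "is_action B poly.ext"
  unfolding is_action_def
proof (intro conjI allI ballI impI)
  fix u v f g c X K n
  show "poly.ext u (f + g) = poly.ext u f + poly.ext u g" by (rule poly.ext_add[OF dense good good])
  show "poly.ext u (Const c * f) = Const c * poly.ext u f" by (rule poly.ext_scale[OF dense good])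
  show "poly.ext (u + v) f = poly.ext u f + poly.ext v f" by (rule poly.ext_uadd[OF dense good])
  show "poly.ext (uscale c u) f = Const c * poly.ext u f" by (rule poly.ext_uscale[OF dense good])
  show "poly.ext 1 f = f" by (rule poly.ext_one[OF dense good])
  show "poly.ext (u * v) f = poly.ext u (poly.ext v f)" by (rule poly.ext_mult[OF dense good])
  show "poly.ext X (f * g) = poly.ext X f * g + f * poly.ext X g" if "X \<in> {uH, uXp, uXm}"
    using that by (simp only: ext_generator) (simp add: gen_deriv_simps)
  show "poly.ext X (Var (K, n)) = 0" if "X \<in> {uH, uXp, uXm}" "2 * K < n"
    using that(2) by (simp only: ext_generator[OF that(1)]) (simp add: gen_deriv_Var gen_var_def)
  show "poly.ext u (Var (K, n)) = (\<Sum>m\<le>2*K. Var (K, m) * Const (rep B K u m n))" if "n \<le> 2 * K"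
    unfolding sum_rep_Var Var_eq_basis_vec[OF that]
    using poly.ext_intertwiner[OF dense intertwiner_basis_vec] poly.good_scale[OF good]
    by (simp add: poly.ext_sum[OF dense good] poly.ext_scale[OF dense good])
next
  fix f
  obtain L where "\<And>u u'. (\<forall>d\<le>L. ent u d = ent u' d) \<Longrightarrow> poly.ext u f = poly.ext u' f"
    using poly.ext_cont[OF dense good, of f] unfolding poly.cont_def by blast
  moreover have "poly.ext 0 f = 0"
    using poly.ext_uscale[OF dense good, of 0 0 f] by simp
  ultimately show "\<exists>L. \<forall>u. (\<forall>d\<le>L. ent u d = ent 0 d) \<longrightarrow> poly.ext u f = 0" by metis
qed

lemma is_action_unique:
  assumes R: "is_action B R" and R': "is_action B R'"
  shows "R = R'"
proof (intro ext)
  fix u f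
  have gen: "R X f = R' X f" if X: "X \<in> {uH, uXp, uXm}" for X f
  proof -
    have d: "is_derivation (R X)" "is_derivation (R' X)"
      using R R' X by (auto simp: is_action_def is_derivation_def)
    have "R X (Var x) = R' X (Var x)" for x
      using R R' X by (cases x; cases "snd x \<le> 2 * fst x") (auto simp: is_action_def not_le)
    then show ?thesis using is_derivation_eqI[OF d] by blast
  qed
  have poly: "R p f = R' p f" if "p \<in> upoly" for p f
    using that
  proof (induction arbitrary: f rule: upoly.induct)
    case (upoly_mult u v)
    then show ?case using R R' by (simp add: is_action_def)
  qed (use gen R R' in \<open>simp_all add: is_action_def\<close>)
  \<comment> \<open>Continuity in \<open>is_action\<close> is stated at 0 only, so it is applied to
    the difference of u and its approximation, written with sum and scalar multiple.\<close>
  have lin: "R' (u + uscale (-1) v) f = R' u f - R' v f" "R (u + uscale (-1) v) f = R u f - R v f" for u v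
    using R R' by (simp_all add: is_action_def)
  have "\<exists>L. \<forall>u. (\<forall>d\<le>L. ent u d = ent 0 d) \<longrightarrow> R u f = 0"
    using R by (simp add: is_action_def)
  then obtain L where L: "\<And>u. (\<forall>d\<le>L. ent u d = ent 0 d) \<Longrightarrow> R u f = 0" by blast
  have "\<exists>L. \<forall>u. (\<forall>d\<le>L. ent u d = ent 0 d) \<longrightarrow> R' u f = 0"
    using R' by (simp add: is_action_def)
  then obtain L' where L': "\<And>u. (\<forall>d\<le>L'. ent u d = ent 0 d) \<Longrightarrow> R' u f = 0" by blast
  obtain p where p: "p \<in> upoly" "\<And>d. d \<le> max L L' \<Longrightarrow> ent p d = ent u d"
    using dense unfolding upoly_dense_def by blast
  have "R u f = R p f" using L[of "u + uscale (-1) p"] p(2) lin by (auto simp: fun_eq_iff)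
  moreover have "R' u f = R' p f" using L'[of "u + uscale (-1) p"] p(2) lin by (auto simp: fun_eq_iff)
  ultimately show "R u f = R' u f" using poly[OF p(1)] by simp
qed

lemma act_eq_ext: "act B = poly.ext"
  unfolding act_def by (rule the_equality[where P = "is_action B", OF is_action_ext]) (rule is_action_unique[OF _ is_action_ext])

lemma
  shows act_add: "act B u (f + g) = act B u f + act B u g"
    and act_Const_mult: "act B u (Const c * f) = Const c * act B u f"
    and act_uadd: "act B (u + v) f = act B u f + act B v f"
    and act_uscale: "act B (uscale c u) f = Const c * act B u f"
    and act_one: "act B 1 f = f"
    and act_mult: "act B (u * v) f = act B u (act B v f)"
    and act_Var: "n \<le> 2 * K \<Longrightarrow> act B u (Var (K, n)) = (\<Sum>m\<le>2*K. Var (K, m) * Const (rep B K u m n))"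
  using is_action_ext unfolding act_eq_ext is_action_def by auto

lemma act_generator: "X \<in> {uH, uXp, uXm} \<Longrightarrow> act B X f = gen_deriv B X f"
  unfolding act_eq_ext by (rule ext_generator)

lemma act_continuous:
  obtains L where "\<And>u v. (\<forall>d\<le>L. ent u d = ent v d) \<Longrightarrow> act B u f = act B v f"
  using poly.ext_cont[OF dense good, of f] unfolding act_eq_ext poly.cont_def by blast

text \<open>A single polynomial meets all these finitely many requirements at once, since each
  depends on finitely many components and the star preserves components. Identities proved by
  induction over \<open>upoly\<close> are transferred to the completion in this way.\<close>

lemma upoly_approx:
  obtains p where "p \<in> upoly" "act B p f = act B u f" "act B (ustar p) h = act B (ustar u) h"
    "ent (cop p) s = ent (cop u) s" "ueps p = ueps u"
proof -
  obtain L where L: "\<And>u v. (\<forall>d\<le>L. ent u d = ent v d) \<Longrightarrow> act B u f = act B v f"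
    using act_continuous by blast
  obtain L' where L': "\<And>u v. (\<forall>d\<le>L'. ent u d = ent v d) \<Longrightarrow> act B u h = act B v h"
    using act_continuous by blast
  obtain M where M: "\<And>u v. (\<forall>d\<le>M. ent u d = ent v d) \<Longrightarrow> ent (cop u) s = ent (cop v) s"
    using cop_continuous[OF dense] by blast
  obtain p where p: "p \<in> upoly" "\<And>d. d \<le> L + L' + M \<Longrightarrow> ent p d = ent u d"
    using dense unfolding upoly_dense_def by blast
  show thesis
  proof (rule that[OF p(1)])
    show "act B (ustar p) h = act B (ustar u) h" using p(2) by (intro L') (auto simp: fun_eq_iff)
  qed (use p(2) in \<open>auto intro!: L M simp: ueps_def\<close>)
qed

lemma act_zero: "act B u 0 = 0"
  using act_Const_mult[of u 0 0] by simp

lemma act_uzero: "act B 0 f = 0"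
  using act_uscale[of 0 0 f] by simp

lemma act_sum: "act B u (\<Sum>i\<in>I. f i) = (\<Sum>i\<in>I. act B u (f i))"
  by (induction I rule: infinite_finite_induct) (auto simp: act_zero act_add)

lemma act_usum: "act B (\<Sum>i\<in>I. u i) f = (\<Sum>i\<in>I. act B (u i) f)"
  by (induction I rule: infinite_finite_induct) (auto simp: act_uzero act_uadd)

lemma act_intertwiner:
  "poly.intertwiner d \<theta> \<Longrightarrow> j \<le> d \<Longrightarrow> act B u (\<theta> j) = (\<Sum>i\<le>d. Const (ent u d i j) * \<theta> i)"
  unfolding act_eq_ext by (rule poly.ext_intertwiner[OF dense])

text \<open>Every element of the mode algebra is a sum of images of intertwiners, so linear statements need
  to be checked for these only.\<close>

lemma intertwiner_induct [case_names zero intertwiner add]: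
  assumes "P 0" "\<And>d \<theta> j. poly.intertwiner d \<theta> \<Longrightarrow> j \<le> d \<Longrightarrow> P (\<theta> j)"
    "\<And>f g. P f \<Longrightarrow> P g \<Longrightarrow> P (f + g)"
  shows "P f"
  using good[of f] by (induction rule: poly.good.induct) (auto intro: assms)

lemma act_invariant:
  assumes "\<And>X. X \<in> {uH, uXp, uXm} \<Longrightarrow> gen_deriv B X f = 0"
  shows "act B u f = Const (ueps u) * f"
  using act_intertwiner[OF intertwiner_invariant[OF assms], of 0 u] by (simp add: ueps_def)

lemma act_unit: "act B u 1 = Const (ueps u)"
  using act_invariant[of 1] by (simp add: gen_deriv_simps)

end

section \<open>Products twisted by a two-leg element\<close>

lemma vac_act_eq_lin_ext: "vac_act B Z h = lin_ext (\<lambda>\<mu> u. Mon \<mu> * act B u h) Z"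
  by (simp add: vac_act_def lin_ext_def)

lemma apoly_expand_superset:
  assumes "finite A" "keys f \<subseteq> A"
  shows "f = (\<Sum>\<kappa>\<in>A. Mon \<kappa> * Const (lookup f \<kappa>))"
proof -
  have "f = (\<Sum>\<kappa>\<in>keys f. Mon \<kappa> * Const (lookup f \<kappa>))"
    using poly_mapping_expand[of f] by (simp add: single_eq_Const_Mon mult.commute)
  also have "\<dots> = (\<Sum>\<kappa>\<in>A. Mon \<kappa> * Const (lookup f \<kappa>))"
    using assms by (intro sum.mono_neutral_left) (auto simp: in_keys_iff)
  finally show ?thesis .
qed

context mode_action
begin

text \<open>The bound is uniform in u, which is what makes the function inside
  \<open>leg_act\<close> finitely supported. It holds because f lies in the span of finitely many
  images of weight vectors that the action preserves.\<close>

lemma act_finite_support: "\<exists>A. finite A \<and> (\<forall>u. keys (act B u f) \<subseteq> A)"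
proof (induction f rule: intertwiner_induct)
  case zero
  then show ?case by (auto simp: act_zero)
next
  case (intertwiner d \<theta> j)
  have "keys (act B u (\<theta> j)) \<subseteq> (\<Union>i\<le>d. keys (\<theta> i))" for u
  proof -
    have "keys (Const c * f) \<subseteq> keys f" for c f
      by (auto simp: Const_def mult_map_scale_conv_mult[symmetric] in_keys_iff map.rep_eq when_def)
    then show ?thesis
      unfolding act_intertwiner[OF intertwiner] using keys_sum[of _ "{..d}"] by fastforce
  qed
  then show ?case by (intro exI[of _ "\<Union>i\<le>d. keys (\<theta> i)"]) auto
next
  case (add f g)
  then obtain A A' where "finite A" "\<And>u. keys (act B u f) \<subseteq> A" "finite A'" "\<And>u. keys (act B u g) \<subseteq> A'"
    by blast
  then show ?case
    using keys_add by (intro exI[of _ "A \<union> A'"]) (fastforce simp: act_add)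
qed

lemma slice_outside: "\<not> (m \<le> d \<and> n \<le> d) \<Longrightarrow> slice X d m n = 0"
  by (rule uhat_ext) (auto simp: ent_outside)

lemma ent_lookup_leg_act: "ent (lookup (leg_act B X f) \<kappa>) d m n = lookup (act B (slice X d m n) f) \<kappa>"
proof -
  obtain A where A: "finite A" "\<And>u. keys (act B u f) \<subseteq> A" using act_finite_support by blast
  have "mk (\<lambda>d m n. lookup (act B (slice X d m n) f) \<kappa>) = 0" if "\<kappa> \<notin> A" for \<kappa>
  proof -
    have "lookup (act B u f) \<kappa> = 0" for u
      using A(2)[of u] that by (metis in_keys_iff subsetD)
    then show ?thesis by (intro uhat_ext) simp
  qed
  then have "finite {\<kappa>. mk (\<lambda>d m n. lookup (act B (slice X d m n) f) \<kappa>) \<noteq> 0}"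
    using A(1) by (metis (mono_tags, lifting) finite_subset mem_Collect_eq subsetI)
  then have "lookup (leg_act B X f) \<kappa> = mk (\<lambda>d m n. lookup (act B (slice X d m n) f) \<kappa>)"
    unfolding leg_act_def by (subst lookup_Abs_poly_mapping) auto
  then show ?thesis by (auto simp: slice_outside act_uzero)
qed

lemma keys_leg_act:
  assumes "\<And>u. keys (act B u f) \<subseteq> A"
  shows "keys (leg_act B X f) \<subseteq> A"
proof
  fix \<kappa> assume "\<kappa> \<in> keys (leg_act B X f)"
  then obtain d m n where "ent (lookup (leg_act B X f) \<kappa>) d m n \<noteq> 0"
    by (metis ent_zero in_keys_iff uhat_ext)
  then have "\<kappa> \<in> keys (act B (slice X d m n) f)" by (simp add: ent_lookup_leg_act in_keys_iff)
  then show "\<kappa> \<in> A" using assms by blast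
qed

lemma leg_act_add: "leg_act B X (f + g) = leg_act B X f + leg_act B X g"
  by (intro poly_mapping_eqI uhat_ext) (simp add: lookup_add ent_lookup_leg_act act_add)

lemma leg_act_zero: "leg_act B X 0 = 0"
  by (intro poly_mapping_eqI uhat_ext) (simp add: ent_lookup_leg_act act_zero)

lemma vac_act_Z_add: "vac_act B (Z + Z') h = vac_act B Z h + vac_act B Z' h"
  unfolding vac_act_eq_lin_ext by (rule lin_ext_add) (simp_all add: act_uzero act_uadd distrib_left)

lemma vac_act_Z_sum: "vac_act B (\<Sum>i\<in>I. Z i) h = (\<Sum>i\<in>I. vac_act B (Z i) h)"
  unfolding vac_act_eq_lin_ext by (rule lin_ext_sum) (simp_all add: act_uzero act_uadd distrib_left)

lemma vac_act_Z_zero: "vac_act B 0 h = 0"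
  unfolding vac_act_eq_lin_ext by simp

lemma vac_act_single: "vac_act B (single \<mu> u) h = Mon \<mu> * act B u h"
  unfolding vac_act_eq_lin_ext by (rule lin_ext_single) (simp add: act_uzero)

lemma vac_act_add: "vac_act B Z (f + g) = vac_act B Z f + vac_act B Z g"
  by (simp add: vac_act_def act_add distrib_left sum.distrib)

lemma vac_act_Const_mult: "vac_act B Z (Const c * f) = Const c * vac_act B Z f"
  by (simp add: vac_act_def act_Const_mult sum_distrib_left mult.left_commute)

lemma vac_act_zero: "vac_act B Z 0 = 0"
  by (simp add: vac_act_def act_zero)

text \<open>The product \<open>(X\<^sub>1 \<triangleright> f) (X\<^sub>2 \<triangleright>
  h)\<close>. The star product, the twisted operators and the ordinary action on products are the
  cases X = R and X = \<open>cop u\<close>.\<close>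

definition tprod :: "(nat \<times> nat) uhat \<Rightarrow> apoly \<Rightarrow> apoly \<Rightarrow> apoly" where
  "tprod X f h = vac_act B (leg_act B X f) h"

lemma tprod_add_left: "tprod X (f + g) h = tprod X f h + tprod X g h"
  by (simp add: tprod_def leg_act_add vac_act_Z_add)

lemma tprod_add_right: "tprod X f (g + h) = tprod X f g + tprod X f h"
  by (simp add: tprod_def vac_act_add)

lemma tprod_zero_left: "tprod X 0 h = 0"
  and tprod_zero_right: "tprod X f 0 = 0"
  by (simp_all add: tprod_def leg_act_zero vac_act_Z_zero vac_act_zero)

lemma tprod_Const_right: "tprod X f (Const c * h) = Const c * tprod X f h"
  by (simp add: tprod_def vac_act_Const_mult)

lemma tprod_sum_right: "tprod X f (\<Sum>i\<in>I. h i) = (\<Sum>i\<in>I. tprod X f (h i))"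
  by (induction I rule: infinite_finite_induct) (auto simp: tprod_zero_right tprod_add_right)

lemma tprod_sum_left: "tprod X (\<Sum>i\<in>I. h i) f = (\<Sum>i\<in>I. tprod X (h i) f)"
  by (induction I rule: infinite_finite_induct) (auto simp: tprod_zero_left tprod_add_left)

lemma tprod_intertwiner_right:
  assumes "poly.intertwiner e \<theta>" "k \<le> e"
  shows "tprod X f (\<theta> k) = (\<Sum>l\<le>e. act B (slice X e l k) f * \<theta> l)"
proof -
  obtain A where A: "finite A" "\<And>u. keys (act B u f) \<subseteq> A" using act_finite_support by blast
  have "tprod X f (\<theta> k) = (\<Sum>\<kappa>\<in>A. Mon \<kappa> * act B (lookup (leg_act B X f) \<kappa>) (\<theta> k))"
    unfolding tprod_def vac_act_eq_lin_ext
    by (rule lin_ext_superset[OF A(1) keys_leg_act[OF A(2)]]) (simp add: act_uzero)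
  also have "\<dots> = (\<Sum>l\<le>e. (\<Sum>\<kappa>\<in>A. Mon \<kappa> * Const (lookup (act B (slice X e l k) f) \<kappa>)) * \<theta> l)"
    by (simp add: act_intertwiner[OF assms] ent_lookup_leg_act sum_distrib_left sum_distrib_right ac_simps)
      (rule sum.swap)
  also have "\<dots> = (\<Sum>l\<le>e. act B (slice X e l k) f * \<theta> l)"
    using apoly_expand_superset[OF A] by simp
  finally show ?thesis .
qed

lemma tprod_Const_left: "tprod X (Const a * f) h = Const a * tprod X f h"
  by (induction h rule: intertwiner_induct)
    (simp_all add: tprod_zero_right tprod_add_right distrib_left tprod_intertwiner_right act_Const_mult
      sum_distrib_left mult.assoc)

lemma tprod_intertwiner:
  assumes "poly.intertwiner d \<theta>" "j \<le> d" "poly.intertwiner e \<theta>'" "k \<le> e"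
  shows "tprod X (\<theta> j) (\<theta>' k) = (\<Sum>i\<le>d. \<Sum>l\<le>e. Const (ent X (d, e) (i, l) (j, k)) * (\<theta> i * \<theta>' l))"
  unfolding tprod_intertwiner_right[OF assms(3,4)] act_intertwiner[OF assms(1,2)]
  by (subst sum.swap) (simp add: sum_distrib_right mult.assoc)

lemma tprod_induct:
  assumes "\<And>h. P 0 h" "\<And>f. P f 0"
    "\<And>f g h. P f h \<Longrightarrow> P g h \<Longrightarrow> P (f + g) h" "\<And>f g h. P f g \<Longrightarrow> P f h \<Longrightarrow> P f (g + h)"
    "\<And>d \<theta> j e \<theta>' k. poly.intertwiner d \<theta> \<Longrightarrow> j \<le> d \<Longrightarrow> poly.intertwiner e \<theta>' \<Longrightarrow> k \<le> e \<Longrightarrow> P (\<theta> j) (\<theta>' k)"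
  shows "P f h"
proof (induction f rule: intertwiner_induct)
  case (intertwiner d \<theta> j)
  show ?case by (induction h rule: intertwiner_induct) (auto intro: assms intertwiner)
qed (auto intro: assms)

lemma tprod_intertwiner_left:
  assumes "poly.intertwiner d \<theta>" "j \<le> d"
  shows "tprod X (\<theta> j) h = (\<Sum>i\<le>d. \<theta> i * act B (slice (flip X) d i j) h)"
proof (induction h rule: intertwiner_induct)
  case (intertwiner e \<theta>' k)
  then show ?case unfolding tprod_intertwiner[OF assms intertwiner]
    by (simp add: act_intertwiner[OF intertwiner] sum_distrib_left mult.left_commute)
qed (auto simp: tprod_zero_right act_zero tprod_add_right act_add distrib_left sum.distrib)

lemma tprod_X_add: "tprod (X + Y) f h = tprod X f h + tprod Y f h"
  by (induction f h rule: tprod_induct)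
    (simp_all add: tprod_zero_left tprod_zero_right tprod_add_left tprod_add_right tprod_intertwiner
      distrib_right sum.distrib)

lemma tprod_X_uscale: "tprod (uscale c X) f h = Const c * tprod X f h"
  by (induction f h rule: tprod_induct)
    (simp_all add: tprod_zero_left tprod_zero_right tprod_add_left tprod_add_right tprod_intertwiner
      distrib_left sum_distrib_left mult.assoc)

lemma tprod_X_zero: "tprod 0 f h = 0"
  using tprod_X_uscale[of 0 0] by simp

lemma tprod_X_sum_list: "tprod (\<Sum>x\<leftarrow>xs. X x) f h = (\<Sum>x\<leftarrow>xs. tprod (X x) f h)"
  by (induction xs) (auto simp: tprod_X_zero tprod_X_add)

lemma tprod_tens: "tprod (tens u v) f h = act B u f * act B v h"
  by (induction f h rule: tprod_induct)
    (simp_all add: tprod_zero_left tprod_zero_right tprod_add_left tprod_add_right tprod_intertwiner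
      act_zero act_add distrib_left distrib_right act_intertwiner sum_product ac_simps)

text \<open>\<open>tprod X\<close> takes a pair of polynomials and not a general tensor, so applying
  Y first has to be written out with the matrix of Y.\<close>

lemma tprod_mult_intertwiner:
  assumes "poly.intertwiner d \<theta>" "j \<le> d" "poly.intertwiner e \<theta>'" "k \<le> e"
  shows "tprod (X * Y) (\<theta> j) (\<theta>' k)
    = (\<Sum>i\<le>d. \<Sum>l\<le>e. Const (ent Y (d, e) (i, l) (j, k)) * tprod X (\<theta> i) (\<theta>' l))"
proof -
  have "(\<Sum>i\<le>d. \<Sum>l\<le>e. Const (ent Y (d, e) (i, l) (j, k)) * tprod X (\<theta> i) (\<theta>' l))
    = (\<Sum>p\<in>{..(d, e)}. \<Sum>q\<in>{..(d, e)}. Const (ent X (d, e) q p * ent Y (d, e) p (j, k)) * (\<theta> (fst q) * \<theta>' (snd q)))"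
    using assms by (simp add: sum_atMost_Pair tprod_intertwiner sum_distrib_left ac_simps)
  also have "\<dots> = (\<Sum>q\<in>{..(d, e)}. Const (ent (X * Y) (d, e) q (j, k)) * (\<theta> (fst q) * \<theta>' (snd q)))"
    by (subst sum.swap) (simp only: ent_times Const_sum sum_distrib_right)
  finally show ?thesis using assms by (simp add: sum_atMost_Pair tprod_intertwiner)
qed

lemma tprod_mult_tens: "tprod (X * tens u v) f h = tprod X (act B u f) (act B v h)"
proof (induction f h rule: tprod_induct)
  case (5 d \<theta> j e \<theta>' k)
  show ?case
    unfolding tprod_mult_intertwiner[OF 5] act_intertwiner[OF 5(1,2)] act_intertwiner[OF 5(3,4)]
      tprod_sum_left tprod_Const_left tprod_sum_right tprod_Const_right
    by (simp add: sum_distrib_left mult.assoc) (subst sum.swap, simp add: mult.left_commute)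
qed (simp_all add: tprod_zero_left tprod_zero_right tprod_add_left tprod_add_right act_zero act_add)

text \<open>For generators this is the Leibniz rule, and both sides are multiplicative in u. The
  passage to the completion works on a pair of intertwiner images, where the right side depends on
  one component of the coproduct only.\<close>

lemma act_times: "act B u (f * h) = tprod (cop u) f h"
proof (induction f h rule: tprod_induct)
  case (5 d \<theta> j e \<theta>' k)
  have poly: "act B p (\<theta> j * \<theta>' k) = tprod (cop p) (\<theta> j) (\<theta>' k)"
    if "p \<in> upoly" "j \<le> d" "k \<le> e" for p j k
    using that
  proof (induction arbitrary: j k rule: upoly.induct)
    case upoly_one
    show ?case using tprod_tens[of 1 1] by (simp add: act_one cop_simps[OF dense])
  next
    case (upoly_mult u v)
    have "act B (u * v) (\<theta> j * \<theta>' k)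
        = (\<Sum>i\<le>d. \<Sum>l\<le>e. Const (ent (cop v) (d, e) (i, l) (j, k)) * tprod (cop u) (\<theta> i) (\<theta>' l))"
      using upoly_mult 5
      by (simp add: act_mult tprod_intertwiner[of d \<theta> j e \<theta>' k] act_sum act_Const_mult)
    also have "\<dots> = tprod (cop (u * v)) (\<theta> j) (\<theta>' k)"
      using upoly_mult 5 by (simp add: cop_simps[OF dense] tprod_mult_intertwiner)
    finally show ?case .
  qed (simp_all add: cop_simps[OF dense] act_uadd act_uscale tprod_X_add tprod_X_uscale primitive_def tprod_tens
      act_one act_generator gen_deriv_simps)
  obtain p where "p \<in> upoly" "act B p (\<theta> j * \<theta>' k) = act B u (\<theta> j * \<theta>' k)" "ent (cop p) (d, e) = ent (cop u) (d, e)"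
    using upoly_approx by metis
  then show ?case using poly[of p j k] 5 by (simp add: tprod_intertwiner)
qed (simp_all add: act_zero act_add tprod_zero_left tprod_zero_right tprod_add_left tprod_add_right
    distrib_left distrib_right)

lemma act_tprod: "act B u (tprod X f h) = tprod (cop u * X) f h"
proof (induction f h rule: tprod_induct)
  case (5 d \<theta> j e \<theta>' k)
  show ?case
    unfolding tprod_mult_intertwiner[OF 5] unfolding tprod_intertwiner[OF 5] act_sum act_Const_mult
    by (simp only: act_times)
qed (simp_all add: tprod_zero_left tprod_zero_right tprod_add_left tprod_add_right act_zero act_add)

section \<open>Operators of the cross product on the vacuum representation\<close>

lemma commute_past_act: "vac_act B (commute_past B u f) h = act B u (f * h)"
  by (simp add: commute_past_def act_times tprod_def)

text \<open>The vacuum representation is multiplicative. Since correlation functions see an element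
  of the cross product only through it, all later computations take place in the mode
  algebra.\<close>

lemma vac_act_smash_mult: "vac_act B (smash_mult B X Y) f = vac_act B X (vac_act B Y f)"
proof -
  have "vac_act B (\<Sum>\<kappa>\<in>keys Z. single (\<mu> + \<kappa>) (lookup Z \<kappa> * u)) f = Mon \<mu> * vac_act B Z (act B u f)" for Z \<mu> u
    by (simp add: vac_act_Z_sum vac_act_single act_mult vac_act_def[of B Z] sum_distrib_left mult.assoc)
  then have "vac_act B (smash_mult B X Y) f
      = (\<Sum>\<mu>\<in>keys X. \<Sum>\<nu>\<in>keys Y. Mon \<mu> * act B (lookup X \<mu>) (Mon \<nu> * act B (lookup Y \<nu>) f))"
    by (simp add: smash_mult_def Let_def vac_act_Z_sum commute_past_act)
  also have "\<dots> = vac_act B X (vac_act B Y f)"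
    by (simp add: vac_act_def act_sum sum_distrib_left)
  finally show ?thesis .
qed

lemma vac_act_one: "vac_act B 1 f = f"
  using vac_act_single[of 0 1 f] by (simp add: act_one)

lemma vac_act_smash_prod: "vac_act B (smash_prod B Xs) f = foldr (vac_act B) Xs f"
  by (induction Xs) (auto simp: smash_prod_def vac_act_smash_mult vac_act_one)

lemma vac_act_of_U: "vac_act B (of_U u) f = act B u f"
  by (simp add: of_U_def vac_act_single)

lemma vac_act_hat: "vac_act B (hat B F x) f = tprod (uinv (flip F)) (Var x) f"
  by (simp add: hat_def tprod_def)

lemma vac_act_map_uscale: "vac_act B (Poly_Mapping.map (uscale c) Z) f = Const c * vac_act B Z f"
proof -
  have k: "keys (Poly_Mapping.map (uscale c) Z) \<subseteq> keys Z"
    by (auto simp: in_keys_iff map.rep_eq)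
  have "vac_act B (Poly_Mapping.map (uscale c) Z) f
      = (\<Sum>\<mu>\<in>keys Z. Mon \<mu> * act B (lookup (Poly_Mapping.map (uscale c) Z) \<mu>) f)"
    unfolding vac_act_eq_lin_ext by (rule lin_ext_superset[OF _ k]) (simp_all add: act_uzero)
  also have "\<dots> = Const c * vac_act B Z f"
    by (auto simp: vac_act_def map.rep_eq act_uscale sum_distrib_left in_keys_iff mult.left_commute intro!: sum.cong)
  finally show ?thesis .
qed

lemma star_mult_eq: "star_mult B F a b = tprod (uinv (flip F)) a b"
  by (simp add: star_mult_def tprod_def vac_act_def Let_def)

lemma vac_act_hat_poly:
  "vac_act B (hat_poly B F P) f
    = (\<Sum>w\<in>keys P. Const (lookup P w) * foldr (\<lambda>x. tprod (uinv (flip F)) (Var x)) w f)"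
proof -
  have "foldr (vac_act B) (map (hat B F) w) f = foldr (\<lambda>x. tprod (uinv (flip F)) (Var x)) w f" for w
    by (induction w) (auto simp: vac_act_hat)
  then show ?thesis
    by (simp add: hat_poly_def vac_act_Z_sum vac_act_map_uscale vac_act_smash_prod)
qed

end

text \<open>The counit reads off the one-dimensional component with label 0, so applying it to a leg
  is taking a slice; this gives multiplicativity.\<close>

lemma leg1_ueps: "leg1 ueps X = slice (flip X) (0::nat) 0 0"
  by (rule uhat_ext) (auto simp: leg1_def ueps_def ent_outside)

lemma leg1_ueps_mult: "leg1 ueps (X * Y) = leg1 ueps X * leg1 ueps Y"
  by (simp add: leg1_ueps flip_mult slice_mult)

lemma leg1_ueps_one: "leg1 ueps 1 = 1"
  by (simp add: leg1_ueps slice_one)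

locale twisted_modes = mode_action B for B +
  fixes F :: "(nat \<times> nat) uhat"
  assumes F: "invertible_uhat F" and counit: "leg1 ueps F = 1"
begin

abbreviation "R \<equiv> uinv (flip F)"

lemma uinv_flip: "R = flip (uinv F)"
  using uinv_mult[OF F] by (intro uinv_eq) (simp_all flip: flip_mult)

text \<open>The second leg of R meets the invariant 1 and is evaluated by the counit. Because R
  belongs to the flipped twist, this is the first leg of \<open>uinv F\<close>.\<close>

lemma tprod_unit: "tprod R f 1 = f"
proof -
  from tprod_intertwiner_right[OF intertwiner_invariant[of 1], of 0 R f]
  have "tprod R f 1 = act B (slice R 0 0 0) f" by (simp add: gen_deriv_simps)
  also have "slice R (0::nat) 0 0 = leg1 ueps (uinv F)"
    by (simp add: leg1_ueps uinv_flip)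
  also have "leg1 ueps (uinv F) = leg1 ueps F * leg1 ueps (uinv F)"
    by (simp add: counit)
  also have "\<dots> = 1" by (simp add: uinv_mult[OF F] leg1_ueps_one flip: leg1_ueps_mult)
  finally show ?thesis by (simp add: act_one)
qed

lemma star_word_eq: "star_word B F w = foldr (\<lambda>x. tprod R (Var x)) w 1"
proof (induction w)
  case (Cons x w)
  then show ?case by (cases w) (auto simp: star_mult_eq tprod_unit)
qed simp

text \<open>Each twisted operator acts as left star multiplication, so a word applied to 1 is nested
  to the right, and \<open>tprod_unit\<close> removes the final factor 1. This is the identification
  of the two kinds of correlation functions.\<close>

lemma vac_act_hat_poly_unit: "vac_act B (hat_poly B F P) 1 = star_poly B F P"
  by (simp add: vac_act_hat_poly star_poly_def star_word_eq)

lemma star_poly_eq_lin_ext: "star_poly B F P = lin_ext (\<lambda>w c. Const c * star_word B F w) P"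
  by (simp add: star_poly_def lin_ext_def)

lemma star_poly_add: "star_poly B F (P + Q) = star_poly B F P + star_poly B F Q"
  unfolding star_poly_eq_lin_ext by (rule lin_ext_add) (simp_all add: distrib_right)

lemma star_poly_sum: "star_poly B F (\<Sum>i\<in>I. P i) = (\<Sum>i\<in>I. star_poly B F (P i))"
  unfolding star_poly_eq_lin_ext by (rule lin_ext_sum) (simp_all add: distrib_right)

lemma star_poly_sum_list: "star_poly B F (\<Sum>x\<leftarrow>xs. P x) = (\<Sum>x\<leftarrow>xs. star_poly B F (P x))"
  by (induction xs) (auto simp: star_poly_add star_poly_def[of B F 0])

lemma star_poly_single: "star_poly B F (single w c) = Const c * star_word B F w"
  unfolding star_poly_eq_lin_ext by (rule lin_ext_single) simp

lemma star_poly_map: "star_poly B F (Poly_Mapping.map ((*) c) P) = Const c * star_poly B F P"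
proof -
  have k: "keys (Poly_Mapping.map ((*) c) P) \<subseteq> keys P"
    by (auto simp: in_keys_iff map.rep_eq)
  have "star_poly B F (Poly_Mapping.map ((*) c) P)
      = (\<Sum>w\<in>keys P. Const (lookup (Poly_Mapping.map ((*) c) P) w) * star_word B F w)"
    unfolding star_poly_eq_lin_ext by (rule lin_ext_superset[OF _ k]) simp_all
  also have "\<dots> = Const c * star_poly B F P"
    by (auto simp: star_poly_def map.rep_eq sum_distrib_left in_keys_iff mult.assoc intro!: sum.cong)
  finally show ?thesis .
qed

lemma star_word_Cons: "star_word B F (x # w) = tprod R (Var x) (star_word B F w)"
  by (simp add: star_word_eq)

end

section \<open>Covariance\<close>

lemma phi_elem_single: "phi_elem \<phi> (single w 1) = phi_word \<phi> w"
  by (simp add: phi_elem_def)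

lemma phi_cop_q_single: "phi_cop_q \<phi> (single w 1) = (\<Sum>(a, b)\<leftarrow>cop_q w. tens (phi_word \<phi> a) (phi_word \<phi> b))"
  by (simp add: phi_cop_q_def)

lemma ueps_power: "ueps (A ^ k) = ueps A ^ k"
  by (induction k) auto

lemma ueps_uexp: "ueps (uexp A) = exp (ueps A)"
proof -
  have "ueps (uexp A) = suminf (\<lambda>k. ueps (uscale (1 / fact k) (A ^ k)))"
    by (simp add: uexp_def usum_def ueps_def)
  also have "\<dots> = exp (ueps A)"
    unfolding exp_def by (simp add: ueps_power scaleR_conv_of_real divide_inverse)
  finally show ?thesis .
qed

lemma uexp_zero: "uexp 0 = 1"
proof (rule uhat_ext)
  fix s m n :: 'a
  have "ent (uexp 0) s m n = suminf (\<lambda>k. ent (uscale (1 / fact k) (0 ^ k)) s m n)"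
    by (auto simp: uexp_def usum_def ent_outside)
  also have "\<dots> = suminf (\<lambda>k. if k = 0 then ent 1 s m n else 0)"
    by (intro suminf_cong) (auto simp: power_0_left)
  also have "\<dots> = ent 1 s m n" by (subst suminf_finite[of "{0}"]) auto
  finally show "ent (uexp 0) s m n = ent 1 s m n" .
qed

lemma ueps_minus: "ueps (u - v) = ueps u - ueps v"
  by (simp add: ueps_def)

text \<open>The images of the generators are known only through the relations. The label 0 gives a
  one-dimensional representation, in which commutators vanish: the relations with H force the images
  of \<open>QXp\<close> and \<open>QXm\<close> to be 0, and the third relation forces the bracket of
  H to be 0.\<close>

lemma ueps_phi_word:
  assumes "drinfeld_iso h \<phi>"
  shows "ueps (phi_word \<phi> w) = eps_q_word w"
proof -
  note D = assms[unfolded drinfeld_iso_def]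
  have "ueps (\<phi> QH * \<phi> QXp - \<phi> QXp * \<phi> QH) = 2 * ueps (\<phi> QXp)"
    "ueps (\<phi> QH * \<phi> QXm - \<phi> QXm * \<phi> QH) = - 2 * ueps (\<phi> QXm)"
    "ueps (\<phi> QXp * \<phi> QXm - \<phi> QXm * \<phi> QXp) = ueps (qbracket h (\<phi> QH))"
    using D by (simp_all)
  then have X: "ueps (\<phi> QXp) = 0" "ueps (\<phi> QXm) = 0" and b: "ueps (qbracket h (\<phi> QH)) = 0"
    by (simp_all add: ueps_minus mult.commute)
  \<comment> \<open>Reality of the value of H, a consequence of the star condition, excludes the
    imaginary periods of exp when the vanishing bracket is solved.\<close>
  have "cnj (ueps (\<phi> QH)) = ueps (\<phi> QH)" using D ueps_ustar[of "\<phi> QH"] by simp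
  then obtain x where x: "ueps (\<phi> QH) = complex_of_real x" by (metis Reals_cases Reals_cnj_iff)
  have "x = 0"
  proof (cases "h = 0")
    case True
    then show ?thesis using b x by (simp add: qbracket_def)
  next
    case False
    then have "sinh h \<noteq> 0" by simp
    then have "complex_of_real (exp (h * x)) = complex_of_real (exp (- h * x))"
      using b x False by (simp add: qbracket_def ueps_minus ueps_uexp exp_of_real flip: of_real_mult of_real_minus)
    then show ?thesis using False by simp
  qed
  then have "ueps (\<phi> g) = (if g \<in> {QKp, QKm} then 1 else 0)" for g
    using X x D by (cases g) (auto simp: ueps_uexp)
  then show ?thesis
    unfolding phi_word_def eps_q_word_def by (induction w) auto
qed

lemma ueps_phi_elem: "drinfeld_iso h \<phi> \<Longrightarrow> ueps (phi_elem \<phi> u) = eps_q u"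
  by (simp add: phi_elem_def eps_q_def ueps_sum ueps_phi_word)

text \<open>The filter \<open>nhds 0\<close> contains the point 0 itself, where the bound c |h| is
  0.\<close>

lemma equal_mod_h_at_0:
  assumes "equal_mod_h A B"
  shows "A 0 = B"
proof (rule uhat_ext)
  fix s m n
  have "(\<lambda>h. ent (A h) s m n - ent B s m n) \<in> O[nhds 0](\<lambda>h. of_real h)"
    using assms by (auto simp: equal_mod_h_def)
  then obtain c where "eventually (\<lambda>h. norm (ent (A h) s m n - ent B s m n) \<le> c * norm (complex_of_real h)) (nhds 0)"
    by (elim landau_o.bigE)
  from eventually_nhds_x_imp_x[OF this] show "ent (A 0) s m n = ent B s m n" by simp
qed

text \<open>At h = 0 the images of the generators are the undeformed generators, and the
  exponentials become 1; hence every \<open>phi_elem\<close> is a polynomial, and the dense image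
  clause gives the claim.\<close>

lemma upoly_dense_of_drinfeld_iso:
  assumes "0 < h0" "drinfeld_iso_family h0 \<phi>"
  shows upoly_dense
proof -
  have D: "drinfeld_iso 0 (\<phi> 0)" using assms by (simp add: drinfeld_iso_family_def)
  have "\<phi> 0 QH = uH" "\<phi> 0 QXp = uXp" "\<phi> 0 QXm = uXm"
    using assms(2) equal_mod_h_at_0 unfolding drinfeld_iso_family_def by blast+
  moreover have "\<phi> 0 QKp = 1" "\<phi> 0 QKm = 1"
    using D by (simp_all add: drinfeld_iso_def uexp_zero)
  ultimately have "\<phi> 0 g \<in> upoly" for g by (cases g) (auto intro: upoly.intros)
  then have "phi_word (\<phi> 0) w \<in> upoly" for w
    unfolding phi_word_def by (induction w) (auto intro: upoly.intros)
  moreover have "0 \<in> upoly" using upoly_scale[OF upoly_one, of 0] by simp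
  moreover have "(\<Sum>w\<in>I. f w) \<in> upoly" if "\<And>w. f w \<in> upoly" "0 \<in> upoly" for I :: "uq_gen list set" and f
    using that by (induction I rule: infinite_finite_induct) (auto intro: upoly_add)
  ultimately have "phi_elem (\<phi> 0) u \<in> upoly" for u
    unfolding phi_elem_def by (simp add: upoly_scale)
  then show ?thesis using D unfolding drinfeld_iso_def upoly_dense_def by blast
qed

context twisted_modes
begin

text \<open>The twist relation is flipped in both legs; the undeformed coproduct is unchanged by
  this, while \<open>\<Delta>\<^sub>q\<close> becomes the flipped coproduct.\<close>

lemma cop_phi_word_R:
  assumes "phi_cop_q \<phi> (single u 1) = F * cop (phi_word \<phi> u) * uinv F"
  shows "cop (phi_word \<phi> u) * R = R * (\<Sum>(a, b)\<leftarrow>cop_q_flipped u. tens (phi_word \<phi> a) (phi_word \<phi> b))"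
proof -
  have "(\<Sum>(a, b)\<leftarrow>cop_q_flipped u. tens (phi_word \<phi> a) (phi_word \<phi> b)) = flip (phi_cop_q \<phi> (single u 1))"
    unfolding phi_cop_q_single flip_sum_list cop_q_flipped_def
    by (simp add: case_prod_unfold o_def)
  also have "\<dots> = flip F * cop (phi_word \<phi> u) * R"
    unfolding assms by (simp add: flip_mult flip_cop[OF dense] uinv_flip)
  finally have "R * (\<Sum>(a, b)\<leftarrow>cop_q_flipped u. tens (phi_word \<phi> a) (phi_word \<phi> b))
      = (R * flip F) * cop (phi_word \<phi> u) * R"
    by (simp add: mult.assoc)
  also have "R * flip F = 1"
    unfolding uinv_flip using uinv_mult(2)[OF F] by (simp flip: flip_mult)
  finally show ?thesis by simp
qed

text \<open>Induction over the word of modes: the first part of the flipped coproduct acts on the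
  head, the second one on the tail by the induction hypothesis, and \<open>cop_phi_word_R\<close>
  moves both through the twist.\<close>

lemma star_poly_q_act_word:
  assumes iso: "drinfeld_iso h \<phi>"
    and twist: "\<And>u. phi_cop_q \<phi> (single u 1) = F * cop (phi_word \<phi> u) * uinv F"
    and "\<forall>(K, n)\<in>set w. n \<le> 2 * K"
  shows "star_poly B F (q_act_word B \<phi> u w) = act B (phi_word \<phi> u) (star_word B F w)"
  using assms(3)
proof (induction w arbitrary: u)
  case Nil
  show ?case using ueps_phi_word[OF iso] by (simp add: star_poly_single act_unit)
next
  case (Cons x w)
  obtain K n where x: "x = (K, n)" by (cases x)
  have n: "n \<le> 2 * K" using Cons.prems x by auto
  define T where "T u1 u2 = (\<Sum>m\<le>2*K. let P = q_act_word B \<phi> u2 w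
      in \<Sum>v\<in>keys P. single ((K, m) # v) (rep B K (phi_word \<phi> u1) m n * lookup P v))" for u1 u2
  have T: "star_poly B F (T u1 u2) = tprod (R * tens (phi_word \<phi> u1) (phi_word \<phi> u2)) (Var x) (star_word B F w)" for u1 u2
  proof -
    define P where "P = q_act_word B \<phi> u2 w"
    have "star_poly B F (T u1 u2) = (\<Sum>m\<le>2*K. \<Sum>v\<in>keys P.
        Const (rep B K (phi_word \<phi> u1) m n) * (Const (lookup P v) * tprod R (Var (K, m)) (star_word B F v)))"
      unfolding T_def by (simp add: Let_def P_def star_poly_sum star_poly_single star_word_Cons mult.assoc)
    also have "\<dots> = (\<Sum>m\<le>2*K. Const (rep B K (phi_word \<phi> u1) m n) * tprod R (Var (K, m)) (star_poly B F P))"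
      by (simp add: star_poly_def tprod_sum_right tprod_Const_right sum_distrib_left)
    also have "star_poly B F P = act B (phi_word \<phi> u2) (star_word B F w)"
      unfolding P_def using Cons by simp
    also have "(\<Sum>m\<le>2*K. Const (rep B K (phi_word \<phi> u1) m n) * tprod R (Var (K, m)) (act B (phi_word \<phi> u2) (star_word B F w)))
        = tprod R (act B (phi_word \<phi> u1) (Var x)) (act B (phi_word \<phi> u2) (star_word B F w))"
      unfolding x act_Var[OF n] tprod_sum_left by (simp add: mult.commute[of "Var _"] tprod_Const_left)
    finally show ?thesis by (simp add: tprod_mult_tens)
  qed
  have "star_poly B F (q_act_word B \<phi> u (x # w))
      = (\<Sum>(u1, u2)\<leftarrow>cop_q_flipped u. star_poly B F (T u1 u2))"
    unfolding x q_act_word.simps T_def[symmetric] star_poly_sum_list by (simp add: case_prod_unfold)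
  also have "\<dots> = tprod (\<Sum>(u1, u2)\<leftarrow>cop_q_flipped u. R * tens (phi_word \<phi> u1) (phi_word \<phi> u2)) (Var x) (star_word B F w)"
    unfolding T tprod_X_sum_list by (simp add: case_prod_unfold)
  \<comment> \<open>With the undeformed coproduct on the left of R, \<open>act_tprod\<close>
    recognizes the action on the whole star product.\<close>
  also have "(\<Sum>(u1, u2)\<leftarrow>cop_q_flipped u. R * tens (phi_word \<phi> u1) (phi_word \<phi> u2))
      = cop (phi_word \<phi> u) * R"
    unfolding cop_phi_word_R[OF twist] sum_list_const_mult[symmetric] by (simp add: case_prod_unfold)
  finally show ?case by (simp add: star_word_Cons act_tprod)
qed

lemma star_poly_q_act:
  assumes iso: "drinfeld_iso h \<phi>"
    and twist: "\<And>u. phi_cop_q \<phi> u = F * cop (phi_elem \<phi> u) * uinv F"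
    and P: "P \<in> nc_polys N"
  shows "star_poly B F (q_act B \<phi> u P) = act B (phi_elem \<phi> u) (star_poly B F P)"
proof -
  have "star_poly B F (q_act_word B \<phi> a w) = act B (phi_word \<phi> a) (star_word B F w)" if "w \<in> keys P" for a w
    using that P by (intro star_poly_q_act_word[OF iso]) (auto simp: twist phi_elem_single nc_polys_def modes_def)
  then have "star_poly B F (q_act B \<phi> u P) = (\<Sum>a\<in>keys u. \<Sum>w\<in>keys P.
      Const (lookup u a * lookup P w) * act B (phi_word \<phi> a) (star_word B F w))"
    by (simp add: q_act_def star_poly_sum star_poly_map)
  also have "\<dots> = act B (phi_elem \<phi> u) (star_poly B F P)"
    by (simp add: phi_elem_def star_poly_def act_usum act_sum act_uscale act_Const_mult sum_distrib_left mult.assoc)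
      (subst sum.swap, simp add: mult.left_commute)
  finally show ?thesis .
qed

end

section \<open>Polynomials in the modes up to spin $N$\<close>

lemma keys_add_nat: "keys (\<mu> + \<nu> :: mode \<Rightarrow>\<^sub>0 nat) = keys \<mu> \<union> keys \<nu>"
  by (auto simp: in_keys_iff lookup_add)

lemma finite_modes [simp]: "finite (modes N)"
proof (rule finite_subset)
  show "modes N \<subseteq> {..N} \<times> {..2 * N}" by (auto simp: modes_def)
qed simp

lemma mode_polys_add: "f \<in> mode_polys N \<Longrightarrow> h \<in> mode_polys N \<Longrightarrow> f + h \<in> mode_polys N"
  using keys_add[of f h] by (auto simp: mode_polys_def)

lemma mode_polys_mult: "f \<in> mode_polys N \<Longrightarrow> h \<in> mode_polys N \<Longrightarrow> f * h \<in> mode_polys N"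
  using keys_mult[of f h] by (fastforce simp: mode_polys_def keys_add_nat)

lemma mode_polys_Const [simp]: "Const c \<in> mode_polys N"
  by (auto simp: mode_polys_def Const_def)

lemma mode_polys_zero [simp]: "0 \<in> mode_polys N" and mode_polys_one [simp]: "1 \<in> mode_polys N"
  by (auto simp: mode_polys_def)

lemma mode_polys_Mon: "keys \<mu> \<subseteq> modes N \<Longrightarrow> Mon \<mu> \<in> mode_polys N"
  by (auto simp: mode_polys_def Mon_def)

lemma mode_polys_Var: "x \<in> modes N \<Longrightarrow> Var x \<in> mode_polys N"
  by (auto simp: Var_def intro!: mode_polys_Mon)

lemma mode_polys_sum: "(\<And>i. i \<in> I \<Longrightarrow> f i \<in> mode_polys N) \<Longrightarrow> (\<Sum>i\<in>I. f i) \<in> mode_polys N"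
  by (induction I rule: infinite_finite_induct) (auto intro: mode_polys_add)

lemma mode_polys_uminus: "f \<in> mode_polys N \<Longrightarrow> - f \<in> mode_polys N"
  by (simp add: mode_polys_def)

lemma mode_polys_diff: "f \<in> mode_polys N \<Longrightarrow> h \<in> mode_polys N \<Longrightarrow> f - h \<in> mode_polys N"
  using mode_polys_add[of f N "- h"] mode_polys_uminus by simp

lemmas mode_polys_intros = mode_polys_add mode_polys_mult mode_polys_Const mode_polys_Var mode_polys_sum
  mode_polys_diff mode_polys_uminus

lemma Mon_sum: "Mon (\<Sum>x\<in>A. h x) = (\<Prod>x\<in>A. Mon (h x))"
  by (induction A rule: infinite_finite_induct) auto

lemma Mon_eq_prod: "Mon \<mu> = (\<Prod>x\<in>keys \<mu>. Var x ^ lookup \<mu> x)"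
  using Mon_sum[of "\<lambda>x. single x (lookup \<mu> x)" "keys \<mu>"] poly_mapping_expand[of \<mu>] by (simp add: Mon_single)

lemma mode_polys_induct [consumes 1, case_names Const Var add mult]:
  assumes f: "f \<in> mode_polys N"
    and C: "\<And>c. P (Const c)" and V: "\<And>x. x \<in> modes N \<Longrightarrow> P (Var x)"
    and A: "\<And>f h. f \<in> mode_polys N \<Longrightarrow> h \<in> mode_polys N \<Longrightarrow> P f \<Longrightarrow> P h \<Longrightarrow> P (f + h)"
    and M: "\<And>f h. f \<in> mode_polys N \<Longrightarrow> h \<in> mode_polys N \<Longrightarrow> P f \<Longrightarrow> P h \<Longrightarrow> P (f * h)"
  shows "P f"
proof -
  have 1: "P 1" and 0: "P 0" using C[of 1] C[of 0] by simp_all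
  have pow: "P (Var x ^ k) \<and> Var x ^ k \<in> mode_polys N" if "x \<in> modes N" for x k
    using that by (induction k) (auto intro: 1 M V mode_polys_intros)
  have prod: "P (\<Prod>x\<in>A. Var x ^ lookup \<mu> x) \<and> (\<Prod>x\<in>A. Var x ^ lookup \<mu> x) \<in> mode_polys N"
    if "A \<subseteq> modes N" for A \<mu>
    using that
  proof (induction A rule: infinite_finite_induct)
    case (insert x A)
    then show ?case using pow[of x] by (auto intro: M mode_polys_intros)
  qed (auto simp: 1)
  have "P (\<Sum>\<mu>\<in>A. single \<mu> (lookup f \<mu>)) \<and> (\<Sum>\<mu>\<in>A. single \<mu> (lookup f \<mu>)) \<in> mode_polys N" if "A \<subseteq> keys f" for A
    using that
  proof (induction A rule: infinite_finite_induct)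
    case (insert \<mu> A)
    then have "P (Mon \<mu>) \<and> Mon \<mu> \<in> mode_polys N"
      using prod f by (auto simp: Mon_eq_prod mode_polys_def)
    then have "P (single \<mu> (lookup f \<mu>)) \<and> single \<mu> (lookup f \<mu>) \<in> mode_polys N"
      by (auto simp: single_eq_Const_Mon intro: M C mode_polys_intros)
    then show ?case using insert by (auto intro: A mode_polys_intros)
  qed (auto simp: 0)
  then show ?thesis using poly_mapping_expand[of f] by (metis order_refl)
qed

lemma is_derivation_eq_on:
  assumes "is_derivation D" "is_derivation D'" "\<And>x. x \<in> modes N \<Longrightarrow> D (Var x) = D' (Var x)"
    and "f \<in> mode_polys N"
  shows "D f = D' f"
  using assms(4)
  by (induction rule: mode_polys_induct)
    (simp_all add: is_derivationD[OF assms(1)] is_derivationD[OF assms(2)] assms(3))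

lemma mode_polys_derivation:
  assumes D: "is_derivation D" and V: "\<And>x. x \<in> modes N \<Longrightarrow> D (Var x) \<in> mode_polys N" and f: "f \<in> mode_polys N"
  shows "D f \<in> mode_polys N"
  using f
  by (induction rule: mode_polys_induct)
    (auto simp: is_derivationD[OF D] intro: V mode_polys_intros)

lemma mode_polys_partial: "f \<in> mode_polys N \<Longrightarrow> partial x f \<in> mode_polys N"
  by (rule mode_polys_derivation[OF is_derivation_partial]) auto

lemma mode_polys_gen_var: "x \<in> modes N \<Longrightarrow> gen_var B X x \<in> mode_polys N"
  by (auto simp: gen_var_def modes_def intro!: mode_polys_intros)

lemma mode_polys_gen_deriv: "f \<in> mode_polys N \<Longrightarrow> gen_deriv B X f \<in> mode_polys N"
  by (rule mode_polys_derivation[OF is_derivation_gen_deriv]) (auto simp: gen_deriv_Var intro: mode_polys_gen_var)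

text \<open>A generator as a linear vector field in finitely many variables, the form in which it
  can be integrated by parts.\<close>

lemma gen_deriv_eq_sum_partial:
  assumes "f \<in> mode_polys N"
  shows "gen_deriv B X f = (\<Sum>x\<in>modes N. partial x f * gen_var B X x)"
proof (rule is_derivation_eq_on[OF is_derivation_gen_deriv _ _ assms])
  show "is_derivation (\<lambda>f. \<Sum>x\<in>modes N. partial x f * gen_var B X x)"
    by (intro is_derivation_sum is_derivation_partial)
  fix y assume "y \<in> modes N"
  then show "gen_deriv B X (Var y) = (\<Sum>x\<in>modes N. partial x (Var y) * gen_var B X x)"
    by (simp add: gen_deriv_Var if_distrib[of "\<lambda>x. x * _"] cong: if_cong)
qed

subsection \<open>Substitution homomorphisms\<close>

text \<open>The coefficient map only has to be a unital ring homomorphism, so evaluation and the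
  antilinear star are covered together.\<close>

lemma
  fixes c :: "complex \<Rightarrow> 'r::comm_ring_1"
  assumes c: "\<And>a b. c (a + b) = c a + c b" "\<And>a b. c (a * b) = c a * c b" "c 1 = 1"
  shows subst_add: "subst_apoly c x (f + h) = subst_apoly c x f + subst_apoly c x h"
    and subst_mult: "subst_apoly c x (f * h) = subst_apoly c x f * subst_apoly c x h"
    and subst_Const: "subst_apoly c x (Const a) = c a"
    and subst_Var: "subst_apoly c x (Var v) = x v"
proof -
  have c0: "c 0 = 0" using c(1)[of 0 0] by simp
  have eq: "subst_apoly c x = lin_ext (\<lambda>\<mu> a. c a * (\<Prod>v\<in>keys \<mu>. x v ^ lookup \<mu> v))"
    by (auto simp: subst_apoly_def lin_ext_def)
  show add: "subst_apoly c x (f + h) = subst_apoly c x f + subst_apoly c x h" for f h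
    unfolding eq by (rule lin_ext_add) (simp_all add: c c0 distrib_right)
  have mono: "subst_apoly c x (single \<mu> a) = c a * (\<Prod>v\<in>V. x v ^ lookup \<mu> v)" if "finite V" "keys \<mu> \<subseteq> V" for \<mu> a V
    unfolding eq using that
    by (subst lin_ext_single) (auto simp: c0 in_keys_iff intro!: arg_cong[of _ _ "\<lambda>z. c a * z"] prod.mono_neutral_left)
  have zero: "subst_apoly c x 0 = 0" by (simp add: eq)
  show "subst_apoly c x (Const a) = c a"
    unfolding Const_def by (subst mono[of "{}"]) auto
  show "subst_apoly c x (Var v) = x v"
    unfolding Var_def Mon_def by (subst mono[of "{v}"]) (auto simp: c)
  show "subst_apoly c x (f * h) = subst_apoly c x f * subst_apoly c x h"
  proof (induction f rule: poly_mapping_induct)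
    case (single \<mu> a)
    show ?case
    proof (induction h rule: poly_mapping_induct)
      case (single \<nu> b)
      show ?case
        by (simp add: mult_single mono[of "keys \<mu> \<union> keys \<nu>"] keys_add_nat c lookup_add power_add
            prod.distrib ac_simps)
    qed (simp_all add: add zero distrib_left)
  qed (simp_all add: add zero distrib_right)
qed

lemma apoly_fun_simps:
  "apoly_fun g (f + h) y = apoly_fun g f y + apoly_fun g h y"
  "apoly_fun g (f * h) y = apoly_fun g f y * apoly_fun g h y"
  "apoly_fun g (Const c) y = c" "apoly_fun g (Var x) y = real_point g y x"
  unfolding apoly_fun_def eval_apoly_def by (rule subst_add subst_mult subst_Const subst_Var; simp)+

lemma apoly_fun_zero: "apoly_fun g 0 y = 0" and apoly_fun_one: "apoly_fun g 1 y = 1"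
  using apoly_fun_simps(3)[of g 0 y] apoly_fun_simps(3)[of g 1 y] by simp_all

lemma apoly_fun_sum: "apoly_fun g (\<Sum>i\<in>I. f i) y = (\<Sum>i\<in>I. apoly_fun g (f i) y)"
  by (induction I rule: infinite_finite_induct) (auto simp: apoly_fun_simps apoly_fun_zero)

lemma apoly_fun_uminus: "apoly_fun g (- f) y = - apoly_fun g f y"
  using apoly_fun_simps(1)[of g f "- f" y] by (simp add: apoly_fun_zero eq_neg_iff_add_eq_0 add.commute)

lemma apoly_fun_diff: "apoly_fun g (f - h) y = apoly_fun g f y - apoly_fun g h y"
  using apoly_fun_simps(1)[of g f "- h" y] by (simp add: apoly_fun_uminus)

lemma apoly_star_simps:
  "apoly_star g (f + h) = apoly_star g f + apoly_star g h"
  "apoly_star g (f * h) = apoly_star g f * apoly_star g h"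
  "apoly_star g (Const c) = Const (cnj c)"
  "apoly_star g (Var (K, n)) = (\<Sum>m\<le>2*K. Const (of_real (g K n m)) * Var (K, m))"
  unfolding apoly_star_def
  by ((subst subst_add subst_mult subst_Const subst_Var; simp)+)

lemma apoly_star_zero: "apoly_star g 0 = 0" and apoly_star_one: "apoly_star g 1 = 1"
  using apoly_star_simps(3)[of g 0] apoly_star_simps(3)[of g 1] by simp_all

lemma apoly_star_sum: "apoly_star g (\<Sum>i\<in>I. f i) = (\<Sum>i\<in>I. apoly_star g (f i))"
  by (induction I rule: infinite_finite_induct) (auto simp: apoly_star_simps apoly_star_zero)


lemma mode_polys_star: "f \<in> mode_polys N \<Longrightarrow> apoly_star g f \<in> mode_polys N"
proof (induction rule: mode_polys_induct)
  case (Var x)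
  then show ?case by (cases x) (auto simp: apoly_star_simps modes_def intro!: mode_polys_intros)
qed (auto simp: apoly_star_simps intro: mode_polys_intros)

section \<open>The real structure\<close>

text \<open>The matrix \<open>(1+g)/2 + \<i> (1-g)/2\<close> of \<open>real_point\<close>\<close>

definition real_coeff :: "forms \<Rightarrow> nat \<Rightarrow> nat \<Rightarrow> nat \<Rightarrow> complex" where
  "real_coeff g K n m = (if n = m then (1 + \<i>) / 2 else 0) + (1 - \<i>) / 2 * of_real (g K n m)"

lemma real_point_eq: "real_point g y (K, n) = (\<Sum>m\<le>2*K. real_coeff g K n m * of_real (y (K, m)))"
  unfolding real_point_def by (auto simp: real_coeff_def field_simps intro!: sum.cong)

locale real_form =
  fixes B :: basis_change and g :: forms and N :: nat
  assumes form: "K \<le> N \<Longrightarrow> invariant_form B K (g K)"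
begin

lemma g_square: "K \<le> N \<Longrightarrow> i \<le> 2 * K \<Longrightarrow> k \<le> 2 * K \<Longrightarrow> (\<Sum>j\<le>2*K. g K i j * g K j k) = (if i = k then 1 else 0)"
  using form[of K] unfolding invariant_form_def by blast

lemma g_square_complex:
  assumes "K \<le> N" "i \<le> 2 * K" "k \<le> 2 * K"
  shows "(\<Sum>j\<le>2*K. complex_of_real (g K i j) * of_real (g K j k)) = (if i = k then 1 else 0)"
  using arg_cong[OF g_square[OF assms], of complex_of_real] by simp

lemma g_invariant:
  assumes "K \<le> N" "X \<in> {uH, uXp, uXm}" "m \<le> 2 * K" "n \<le> 2 * K"
  shows "(\<Sum>i\<le>2*K. rep B K X m i * of_real (g K i n)) + (\<Sum>j\<le>2*K. of_real (g K m j) * rep B K X n j) = 0"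
  using form[OF assms(1)] assms(2-) unfolding invariant_form_def by blast

text \<open>The columns of the matrix satisfy the reality condition of the modes. This follows from
  g being a real involution.\<close>

lemma sum_g_real_coeff:
  assumes "K \<le> N" "n \<le> 2 * K" "k \<le> 2 * K"
  shows "(\<Sum>m\<le>2*K. of_real (g K n m) * real_coeff g K m k) = cnj (real_coeff g K n k)"
proof -
  have "(\<Sum>m\<le>2*K. of_real (g K n m) * real_coeff g K m k)
      = (\<Sum>m\<le>2*K. if m = k then of_real (g K n k) * ((1 + \<i>) / 2) else 0)
        + (1 - \<i>) / 2 * (\<Sum>m\<le>2*K. of_real (g K n m) * of_real (g K m k))"
    unfolding sum_distrib_left sum.distrib[symmetric]
    by (intro sum.cong) (auto simp: real_coeff_def algebra_simps)
  then show ?thesis using assms by (simp add: g_square_complex real_coeff_def)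
qed

text \<open>For M = (1 + \<i>)/2 + (1 - \<i>)/2 g with g real and of square 1, the cross terms of M
  times its conjugate cancel and the remaining ones add up to 1. The inverse converts derivatives
  along real coordinates back into derivatives with respect to the modes.\<close>

lemma real_coeff_inverse:
  assumes "K \<le> N" "n \<le> 2 * K" "k \<le> 2 * K"
  shows "(\<Sum>m\<le>2*K. real_coeff g K n m * cnj (real_coeff g K m k)) = (if n = k then 1 else 0)"
proof -
  have "(\<Sum>m\<le>2*K. real_coeff g K n m * cnj (real_coeff g K m k))
      = (\<Sum>m\<le>2*K. if m = n then (1 + \<i>) / 2 * cnj (real_coeff g K n k) else 0)
        + (1 - \<i>) / 2 * (\<Sum>m\<le>2*K. of_real (g K n m) * cnj (real_coeff g K m k))"
    unfolding sum_distrib_left sum.distrib[symmetric]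
    by (intro sum.cong) (auto simp: real_coeff_def[of g K n] algebra_simps)
  also have "(\<Sum>m\<le>2*K. of_real (g K n m) * cnj (real_coeff g K m k)) = real_coeff g K n k"
    using arg_cong[OF sum_g_real_coeff[OF assms], of cnj] by simp
  finally show ?thesis using assms by (auto simp: real_coeff_def field_simps)
qed

lemma apoly_fun_star:
  assumes "f \<in> mode_polys N"
  shows "apoly_fun g (apoly_star g f) y = cnj (apoly_fun g f y)"
  using assms
proof (induction rule: mode_polys_induct)
  case (Var x)
  obtain K n where x: "x = (K, n)" "K \<le> N" "n \<le> 2 * K" using Var by (cases x) (auto simp: modes_def)
  have "apoly_fun g (apoly_star g (Var x)) y
      = (\<Sum>m\<le>2*K. \<Sum>k\<le>2*K. of_real (g K n m) * real_coeff g K m k * of_real (y (K, k)))"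
    by (simp add: x(1) apoly_star_simps apoly_fun_sum apoly_fun_simps real_point_eq sum_distrib_left mult.assoc)
  also have "\<dots> = (\<Sum>k\<le>2*K. cnj (real_coeff g K n k) * of_real (y (K, k)))"
    by (subst sum.swap) (simp add: sum_distrib_right[symmetric] sum_g_real_coeff x)
  finally show ?case by (simp add: x(1) apoly_fun_simps real_point_eq)
qed (simp_all add: apoly_star_simps apoly_fun_simps)

lemma apoly_star_star:
  assumes "f \<in> mode_polys N"
  shows "apoly_star g (apoly_star g f) = f"
  using assms
proof (induction rule: mode_polys_induct)
  case (Var x)
  obtain K n where x: "x = (K, n)" "K \<le> N" "n \<le> 2 * K" using Var by (cases x) (auto simp: modes_def)
  have "apoly_star g (apoly_star g (Var x))
      = (\<Sum>m\<le>2*K. \<Sum>k\<le>2*K. Const (of_real (g K n m) * of_real (g K m k)) * Var (K, k))"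
    by (simp add: x(1) apoly_star_simps apoly_star_sum sum_distrib_left mult.assoc)
  also have "\<dots> = (\<Sum>k\<le>2*K. Const (\<Sum>m\<le>2*K. of_real (g K n m) * of_real (g K m k)) * Var (K, k))"
    by (subst sum.swap) (simp only: Const_sum sum_distrib_right)
  also have "\<dots> = (\<Sum>k\<le>2*K. if k = n then Var (K, k) else 0)"
    by (intro sum.cong refl) (simp add: g_square_complex x del: Const_simps(4))
  finally show ?case using x by simp
qed (simp_all add: apoly_star_simps)

lemma rep_ustar: "rep B K (ustar X) m n = cnj (rep B K X n m)"
  unfolding rep_def by (simp add: mult.commute mult.left_commute) (rule sum.swap)

text \<open>The compatibility \<open>(X \<triangleright> a)\<^sup>* = S(X)\<^sup>* \<triangleright>
  a\<^sup>*\<close> with antipode S(X) = -X. It combines unitarity of the representation with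
  invariance of g.\<close>

lemma gen_deriv_star_Var:
  assumes "x \<in> modes N" "X \<in> {uH, uXp, uXm}"
  shows "apoly_star g (gen_deriv B X (Var x)) = - gen_deriv B (ustar X) (apoly_star g (Var x))"
proof -
  obtain K n where x: "x = (K, n)" "K \<le> N" "n \<le> 2 * K" using assms(1) by (cases x) (auto simp: modes_def)
  define r where "r i j = cnj (rep B K X i j)" for i j
  define G where "G i j = complex_of_real (g K i j)" for i j
  \<comment> \<open>v consists of the starred variables. As the star is an involution, the variables
    are expressed through v by the same matrix G, so it is enough to treat one family and to change
    the basis afterwards.\<close>
  define v where "v m = apoly_star g (Var (K, m))" for m
  have v: "v m = (\<Sum>k\<le>2*K. Const (G m k) * Var (K, k))" for m
    by (simp add: v_def G_def apoly_star_simps)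
  have star_v: "apoly_star g (v m) = Var (K, m)" if "m \<le> 2 * K" for m
    unfolding v_def using that x(2) by (intro apoly_star_star mode_polys_Var) (simp add: modes_def)
  have Var: "Var (K, m) = (\<Sum>k\<le>2*K. Const (G m k) * v k)" if "m \<le> 2 * K" for m
    using arg_cong[OF v[of m], of "apoly_star g"] star_v[OF that]
    by (simp add: apoly_star_sum apoly_star_simps(1-3) G_def v_def)
  have "gen_deriv B (ustar X) (Var (K, m)) = - apoly_star g (gen_deriv B X (v m))" if m: "m \<le> 2 * K" for m
  proof -
    have "gen_deriv B (ustar X) (Var (K, m)) = (\<Sum>i\<le>2*K. Const (r m i) * Var (K, i))"
      using m by (simp add: gen_deriv_Var gen_var_def rep_ustar r_def mult.commute[of "Var _"])
    also have "\<dots> = (\<Sum>i\<le>2*K. Const (r m i) * (\<Sum>k\<le>2*K. Const (G i k) * v k))"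
      by (intro sum.cong refl) (simp add: Var[symmetric])
    also have "\<dots> = (\<Sum>k\<le>2*K. Const (\<Sum>i\<le>2*K. r m i * G i k) * v k)"
      unfolding sum_distrib_left by (subst sum.swap) (simp add: Const_sum sum_distrib_right mult.assoc)
    \<comment> \<open>The complex conjugate of the invariance equation moves the representation
      matrix across g at the cost of a sign.\<close>
    also have "\<dots> = (\<Sum>k\<le>2*K. - Const (\<Sum>j\<le>2*K. G m j * r k j) * v k)"
    proof (intro sum.cong refl)
      fix k assume "k \<in> {..2 * K}"
      then have "(\<Sum>i\<le>2*K. r m i * G i k) = - (\<Sum>j\<le>2*K. G m j * r k j)"
        using arg_cong[OF g_invariant[OF x(2) assms(2) m, of k], of cnj]
        by (simp add: r_def G_def eq_neg_iff_add_eq_0)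
      then show "Const (\<Sum>i\<le>2*K. r m i * G i k) * v k = - Const (\<Sum>j\<le>2*K. G m j * r k j) * v k" by simp
    qed
    also have "\<dots> = - (\<Sum>j\<le>2*K. \<Sum>k\<le>2*K. Const (G m j * r k j) * v k)"
      by (subst sum.swap) (simp only: Const_sum sum_distrib_right sum_negf minus_mult_left[symmetric])
    also have "(\<Sum>j\<le>2*K. \<Sum>k\<le>2*K. Const (G m j * r k j) * v k) = apoly_star g (gen_deriv B X (v m))"
      unfolding v[of m]
      by (simp add: gen_deriv_simps gen_deriv_Var gen_var_def apoly_star_sum apoly_star_simps(1-3)
          G_def r_def v_def sum_distrib_left ac_simps)
    finally show ?thesis .
  qed
  then have *: "apoly_star g (gen_deriv B X (v m)) = - gen_deriv B (ustar X) (Var (K, m))" if "m \<le> 2 * K" for m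
    using that by simp
  have "apoly_star g (gen_deriv B X (Var x)) = (\<Sum>k\<le>2*K. Const (G n k) * apoly_star g (gen_deriv B X (v k)))"
    unfolding x(1) Var[OF x(3)] by (simp add: gen_deriv_simps apoly_star_sum apoly_star_simps(1-3) G_def)
  also have "\<dots> = - gen_deriv B (ustar X) (v n)"
    unfolding v[of n] by (simp add: * gen_deriv_simps sum_negf)
  finally show ?thesis by (simp add: v_def x(1))
qed

lemma gen_deriv_star:
  assumes "f \<in> mode_polys N" "X \<in> {uH, uXp, uXm}"
  shows "apoly_star g (gen_deriv B X f) = - gen_deriv B (ustar X) (apoly_star g f)"
  using assms(1)
  by (induction rule: mode_polys_induct)
    (simp_all add: gen_deriv_star_Var[OF _ assms(2)] gen_deriv_simps apoly_star_simps apoly_star_zero algebra_simps)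

end

section \<open>Stability of the polynomials with spin at most \<open>N\<close>\<close>

context mode_action
begin

lemma mode_polys_act:
  assumes "f \<in> mode_polys N"
  shows "act B u f \<in> mode_polys N"
proof -
  have poly: "act B p f \<in> mode_polys N" if "p \<in> upoly" "f \<in> mode_polys N" for p f
    using that
    by (induction arbitrary: f rule: upoly.induct)
      (auto simp: act_generator act_one act_uadd act_uscale act_mult intro: mode_polys_gen_deriv mode_polys_intros)
  obtain p where "p \<in> upoly" "act B p f = act B u f" using upoly_approx by metis
  then show ?thesis using poly[OF _ assms] by metis
qed

lemma keys_leg_act_modes:
  assumes "f \<in> mode_polys N" "\<mu> \<in> keys (leg_act B X f)"
  shows "keys \<mu> \<subseteq> modes N"
proof -
  have "keys (leg_act B X f) \<subseteq> {\<mu>. keys \<mu> \<subseteq> modes N}"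
    using mode_polys_act[OF assms(1)] by (intro keys_leg_act) (auto simp: mode_polys_def)
  then show ?thesis using assms(2) by blast
qed

definition smash_modes :: "nat \<Rightarrow> smash set" where
  "smash_modes N = {Z. \<forall>\<mu>\<in>keys Z. keys \<mu> \<subseteq> modes N}"

lemma smash_modes_sum: "(\<And>i. i \<in> I \<Longrightarrow> Z i \<in> smash_modes N) \<Longrightarrow> (\<Sum>i\<in>I. Z i) \<in> smash_modes N"
  using keys_sum[of Z I] by (fastforce simp: smash_modes_def)

lemma smash_modes_mult:
  assumes "X \<in> smash_modes N" "Y \<in> smash_modes N"
  shows "smash_mult B X Y \<in> smash_modes N"
  unfolding smash_mult_def Let_def commute_past_def
proof (intro smash_modes_sum)
  fix \<mu> \<nu> \<kappa> assume "\<mu> \<in> keys X" "\<nu> \<in> keys Y" "\<kappa> \<in> keys (leg_act B (cop (lookup X \<mu>)) (Mon \<nu>))"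
  then have "keys (\<mu> + \<kappa>) \<subseteq> modes N"
    using assms keys_leg_act_modes[OF mode_polys_Mon, of \<nu> N \<kappa>] by (simp add: smash_modes_def keys_add_nat)
  then show "single (\<mu> + \<kappa>) u \<in> smash_modes N" for u
    by (auto simp: smash_modes_def)
qed

lemma smash_modes_hat: "x \<in> modes N \<Longrightarrow> hat B F x \<in> smash_modes N"
  unfolding hat_def smash_modes_def by (auto dest: keys_leg_act_modes[OF mode_polys_Var])

lemma smash_modes_hat_poly:
  assumes "P \<in> nc_polys N"
  shows "hat_poly B F P \<in> smash_modes N"
  unfolding hat_poly_def
proof (rule smash_modes_sum)
  fix w assume "w \<in> keys P"
  then have "set w \<subseteq> modes N" using assms by (auto simp: nc_polys_def)
  then have "smash_prod B (map (hat B F) w) \<in> smash_modes N"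
    by (induction w) (auto simp: smash_prod_def smash_modes_hat intro!: smash_modes_mult, auto simp: smash_modes_def)
  then show "Poly_Mapping.map (uscale c) (smash_prod B (map (hat B F) w)) \<in> smash_modes N" for c
    by (auto simp: smash_modes_def in_keys_iff map.rep_eq)
qed

lemma mode_polys_vac_act: "Z \<in> smash_modes N \<Longrightarrow> f \<in> mode_polys N \<Longrightarrow> vac_act B Z f \<in> mode_polys N"
  unfolding vac_act_def smash_modes_def
  by (auto intro!: mode_polys_intros mode_polys_Mon mode_polys_act)

end

section \<open>Integration by parts\<close>

text \<open>With a nonzero limit the norm would exceed a positive constant on a half-line.\<close>

lemma integrable_limit_at_top_zero:
  fixes f :: "real \<Rightarrow> complex"
  assumes lim: "(f \<longlongrightarrow> L) at_top" and int: "integrable lborel f"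
  shows "L = 0"
proof (rule ccontr)
  assume "L \<noteq> 0"
  define c where "c = norm L / 2"
  have c: "c > 0" "c < norm L" using \<open>L \<noteq> 0\<close> by (auto simp: c_def)
  have "eventually (\<lambda>x. norm (f x) > c) at_top"
    using order_tendstoD(1)[OF tendsto_norm[OF lim] c(2)] .
  then obtain b where b: "\<And>x. x \<ge> b \<Longrightarrow> norm (f x) > c" by (auto simp: eventually_at_top_linorder)
  \<comment> \<open>The length n is chosen such that n c exceeds the integral of the norm by
    c.\<close>
  define n where "n = (\<integral>x. norm (f x) \<partial>lborel) / c + 1"
  have "(\<integral>x. norm (f x) \<partial>lborel) \<ge> 0" by simp
  then have n: "n \<ge> 0" using c by (simp add: n_def)
  have "n * c = (\<integral>x. indicator {b..b + n} x * c \<partial>lborel)" using n by simp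
  also have "\<dots> \<le> (\<integral>x. norm (f x) \<partial>lborel)"
  proof (rule integral_mono)
    show "integrable lborel (\<lambda>x. indicator {b..b + n} x * c)" using n by simp
    show "integrable lborel (\<lambda>x. norm (f x))" using int by simp
    show "indicator {b..b + n} x * c \<le> norm (f x)" for x
      using b[of x] by (auto simp: indicator_def)
  qed
  finally show False using c mult_pos_pos[OF c(1) c(1)] by (simp add: n_def field_simps)
qed

lemma tendsto_integral_indicator_at_top:
  fixes f :: "real \<Rightarrow> complex"
  assumes "integrable lborel f" "\<And>x. \<forall>\<^sub>F y in at_top. x \<in> A y \<longleftrightarrow> x \<in> A'"
    and [measurable]: "\<And>y :: real. A y \<in> sets borel" "A' \<in> sets borel"
  shows "((\<lambda>y. \<integral>x. indicator (A y) x *\<^sub>R f x \<partial>lborel) \<longlongrightarrow> (\<integral>x. indicator A' x *\<^sub>R f x \<partial>lborel)) at_top"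
proof (rule integral_dominated_convergence_at_top[where w = "\<lambda>x. norm (f x)"])
  show "AE x in lborel. ((\<lambda>y. indicator (A y) x *\<^sub>R f x) \<longlongrightarrow> indicator A' x *\<^sub>R f x) at_top"
  proof (intro AE_I2 tendsto_eventually)
    show "\<forall>\<^sub>F y in at_top. indicator (A y) x *\<^sub>R f x = indicator A' x *\<^sub>R f x" for x
      using assms(2)[of x] by eventually_elim (simp add: indicator_def)
  qed
qed (use assms(1) in \<open>auto simp: indicator_def\<close>)

text \<open>Integrability of the derivative makes f(y) = f(0) +
  \<open>\<integral>\<^sub>0\<^sup>y f'\<close> converge, and integrability of f leaves 0 as the
  only possible limit.\<close>

lemma integrable_with_derivative_tendsto_zero:
  fixes f f' :: "real \<Rightarrow> complex"
  assumes d: "\<And>x. (f has_vector_derivative f' x) (at x)" and c: "continuous_on UNIV f'"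
    and int: "integrable lborel f" "integrable lborel f'"
  shows "(f \<longlongrightarrow> 0) at_top"
proof -
  have "((\<lambda>y. \<integral>x. indicator {0..y} x *\<^sub>R f' x \<partial>lborel) \<longlongrightarrow> (\<integral>x. indicator {0..} x *\<^sub>R f' x \<partial>lborel)) at_top"
  proof (rule tendsto_integral_indicator_at_top[OF int(2)])
    show "\<forall>\<^sub>F y in at_top. x \<in> {0..y} \<longleftrightarrow> x \<in> {0..}" for x :: real
      using eventually_ge_at_top[of x] by eventually_elim auto
  qed auto
  then have "((\<lambda>y. f 0 + (\<integral>x. indicator {0..y} x *\<^sub>R f' x \<partial>lborel)) \<longlongrightarrow> f 0 + (\<integral>x. indicator {0..} x *\<^sub>R f' x \<partial>lborel)) at_top"
    by (intro tendsto_intros)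
  moreover have "\<forall>\<^sub>F y in at_top. f 0 + (\<integral>x. indicator {0..y} x *\<^sub>R f' x \<partial>lborel) = f y"
    using eventually_ge_at_top[of 0]
  proof eventually_elim
    case (elim y)
    have "(\<integral>x. indicator {0..y} x *\<^sub>R f' x \<partial>lborel) = f y - f 0"
      using elim by (intro integral_FTC_atLeastAtMost)
        (auto intro: has_vector_derivative_at_within[OF d] continuous_on_subset[OF c])
    then show ?case by simp
  qed
  ultimately have "(f \<longlongrightarrow> f 0 + (\<integral>x. indicator {0..} x *\<^sub>R f' x \<partial>lborel)) at_top"
    by (rule Lim_transform_eventually)
  then show ?thesis using integrable_limit_at_top_zero[OF _ int(1)] by metis
qed

lemma integral_derivative_zero:
  fixes f f' :: "real \<Rightarrow> complex"
  assumes d: "\<And>x. (f has_vector_derivative f' x) (at x)" and c: "continuous_on UNIV f'"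
    and int: "integrable lborel f" "integrable lborel f'"
  shows "(\<integral>x. f' x \<partial>lborel) = 0"
proof -
  have top: "(f \<longlongrightarrow> 0) at_top" by (rule integrable_with_derivative_tendsto_zero[OF assms])
  have refl: "integrable lborel (\<lambda>x. h (- x))" if "integrable lborel h" for h :: "real \<Rightarrow> complex"
    using lborel_integrable_real_affine[OF that, of "-1" 0] by simp
  \<comment> \<open>The behaviour at minus infinity is the previous lemma for the reflected
    function.\<close>
  have bot: "((\<lambda>x. f (- x)) \<longlongrightarrow> 0) at_top"
  proof (rule integrable_with_derivative_tendsto_zero[where f' = "\<lambda>x. - f' (- x)"])
    show "((\<lambda>x. f (- x)) has_vector_derivative - f' (- x)) (at x)" for x
    proof -
      have "(uminus has_real_derivative - 1) (at x)" by (auto intro!: derivative_eq_intros)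
      then show ?thesis
        using vector_diff_chain_at[of uminus "-1" x f "f' (- x)"] d[of "- x"]
        by (simp add: o_def has_real_derivative_iff_has_vector_derivative)
    qed
    show "continuous_on UNIV (\<lambda>x. - f' (- x))"
      by (intro continuous_intros continuous_on_compose2[OF c]) auto
  qed (use refl int in auto)
  have "((\<lambda>y. \<integral>x. indicator {- y..y} x *\<^sub>R f' x \<partial>lborel) \<longlongrightarrow> (\<integral>x. indicator UNIV x *\<^sub>R f' x \<partial>lborel)) at_top"
  proof (rule tendsto_integral_indicator_at_top[OF int(2)])
    show "\<forall>\<^sub>F y in at_top. x \<in> {- y..y} \<longleftrightarrow> x \<in> UNIV" for x :: real
      using eventually_ge_at_top[of "\<bar>x\<bar>"] by eventually_elim auto
  qed auto
  then have "((\<lambda>y. \<integral>x. indicator {- y..y} x *\<^sub>R f' x \<partial>lborel) \<longlongrightarrow> (\<integral>x. f' x \<partial>lborel)) at_top" by simp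
  moreover have "\<forall>\<^sub>F y in at_top. (\<integral>x. indicator {- y..y} x *\<^sub>R f' x \<partial>lborel) = f y - f (- y)"
    using eventually_ge_at_top[of 0]
  proof eventually_elim
    case (elim y)
    then show ?case
      by (intro integral_FTC_atLeastAtMost)
        (auto intro: has_vector_derivative_at_within[OF d] continuous_on_subset[OF c])
  qed
  ultimately have "((\<lambda>y. f y - f (- y)) \<longlongrightarrow> (\<integral>x. f' x \<partial>lborel)) at_top"
    by (rule Lim_transform_eventually)
  moreover have "((\<lambda>y. f y - f (- y)) \<longlongrightarrow> 0 - 0) at_top" by (intro tendsto_intros top bot)
  ultimately show ?thesis using tendsto_unique[OF trivial_limit_at_top_linorder] by fastforce
qed

text \<open>Fubini in the coordinate i: integrability on the product yields integrability on almost
  every line parallel to the axis, with measurability on the line coming from continuity. There the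
  one-dimensional statement applies.\<close>

lemma product_integral_derivative_zero:
  fixes G G' :: "('i \<Rightarrow> real) \<Rightarrow> complex"
  assumes J: "finite J" "i \<in> J"
    and d: "\<And>y t. ((\<lambda>t. G (y(i := t))) has_vector_derivative G' (y(i := t))) (at t)"
    and c: "\<And>y. continuous_on UNIV (\<lambda>t. G' (y(i := t)))"
    and int: "integrable (\<Pi>\<^sub>M x\<in>J. lborel) G" "integrable (\<Pi>\<^sub>M x\<in>J. lborel) G'"
  shows "(\<integral>y. G' y \<partial>(\<Pi>\<^sub>M x\<in>J. lborel)) = 0"
proof -
  interpret product_sigma_finite "\<lambda>_ :: 'i. lborel :: real measure"
    by (rule product_sigma_finite.intro) (rule lborel.sigma_finite_measure_axioms)
  define I where "I = J - {i}"
  have I: "finite I" "i \<notin> I" "J = insert i I" using J by (auto simp: I_def)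
  have c0: "continuous_on UNIV (\<lambda>t. G (y(i := t)))" for y
    by (intro continuous_at_imp_continuous_on ballI has_vector_derivative_continuous[OF d])
  have AE: "AE y in (\<Pi>\<^sub>M x\<in>I. lborel). integrable lborel (\<lambda>t. H (y(i := t)))"
    if H: "integrable (\<Pi>\<^sub>M x\<in>J. lborel) H" and cH: "\<And>y. continuous_on UNIV (\<lambda>t. H (y(i := t)))"
    for H :: "('i \<Rightarrow> real) \<Rightarrow> complex"
  proof -
    have Hm: "(\<lambda>y. ennreal (norm (H y))) \<in> borel_measurable (\<Pi>\<^sub>M x\<in>insert i I. lborel)"
      using H unfolding I(3) by measurable
    have "(\<integral>\<^sup>+ y. (\<integral>\<^sup>+ t. norm (H (y(i := t))) \<partial>lborel) \<partial>(\<Pi>\<^sub>M x\<in>I. lborel))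
        = (\<integral>\<^sup>+ y. norm (H y) \<partial>(\<Pi>\<^sub>M x\<in>J. lborel))"
      unfolding I(3) by (rule product_nn_integral_insert[OF I(1,2) Hm, symmetric])
    also have "\<dots> \<noteq> \<infinity>" using H by (simp add: integrable_iff_bounded less_top)
    finally have fin: "(\<integral>\<^sup>+ y. (\<integral>\<^sup>+ t. norm (H (y(i := t))) \<partial>lborel) \<partial>(\<Pi>\<^sub>M x\<in>I. lborel)) \<noteq> \<infinity>" .
    have "(\<lambda>y. \<integral>\<^sup>+ t. norm (H (y(i := t))) \<partial>lborel) \<in> borel_measurable (\<Pi>\<^sub>M x\<in>I. lborel)"
    proof (rule lborel.borel_measurable_nn_integral)
      show "(\<lambda>(y, t). ennreal (norm (H (y(i := t))))) \<in> borel_measurable ((\<Pi>\<^sub>M x\<in>I. lborel) \<Otimes>\<^sub>M lborel)"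
        using measurable_compose[OF measurable_add_dim[of i I "\<lambda>_. lborel"] Hm] by (simp add: case_prod_unfold)
    qed
    from nn_integral_PInf_AE[OF this fin] show ?thesis
    proof eventually_elim
      case (elim y)
      have "(\<lambda>t. H (y(i := t))) \<in> borel_measurable lborel"
        using borel_measurable_continuous_onI[OF cH] by simp
      then show ?case using elim by (simp add: integrable_iff_bounded less_top)
    qed
  qed
  have "(\<integral>y. G' y \<partial>(\<Pi>\<^sub>M x\<in>J. lborel)) = (\<integral>y. (\<integral>t. G' (y(i := t)) \<partial>lborel) \<partial>(\<Pi>\<^sub>M x\<in>I. lborel))"
    using int(2) unfolding I(3) by (intro product_integral_insert I)
  also have "\<dots> = 0"
  proof (rule integral_eq_zero_AE)
    show "AE y in (\<Pi>\<^sub>M x\<in>I. lborel). (\<integral>t. G' (y(i := t)) \<partial>lborel) = 0"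
      using AE[OF int(1) c0] AE[OF int(2) c]
      by eventually_elim (rule integral_derivative_zero[OF d c])
  qed
  finally show ?thesis .
qed

context real_form
begin

text \<open>The chain rule for the linear map \<open>real_point\<close>; the coordinate (K, m)
  influences only modes with the same K.\<close>

lemma apoly_fun_has_derivative:
  assumes f: "f \<in> mode_polys N" and m: "m \<le> 2 * K"
  shows "((\<lambda>t. apoly_fun g f (y((K, m) := t))) has_vector_derivative
    (\<Sum>n\<le>2*K. real_coeff g K n m * apoly_fun g (partial (K, n) f) (y((K, m) := t)))) (at t)"
  using f
proof (induction rule: mode_polys_induct)
  case (Const c)
  show ?case by (simp add: apoly_fun_simps is_derivationD[OF is_derivation_partial] apoly_fun_zero)
next
  case (Var x)
  obtain K' n' where x: "x = (K', n')" "n' \<le> 2 * K'" using Var by (cases x) (auto simp: modes_def)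
  have "((\<lambda>t. \<Sum>k\<le>2*K'. real_coeff g K' n' k * of_real ((y((K, m) := t)) (K', k))) has_vector_derivative
      (\<Sum>k\<le>2*K'. if K' = K \<and> k = m then real_coeff g K' n' k else 0)) (at t)"
  proof (intro has_vector_derivative_sum)
    fix k
    show "((\<lambda>t. real_coeff g K' n' k * of_real ((y((K, m) := t)) (K', k))) has_vector_derivative
      (if K' = K \<and> k = m then real_coeff g K' n' k else 0)) (at t)"
      by (cases "K' = K \<and> k = m") (auto intro!: derivative_eq_intros
          simp: has_vector_derivative_def scaleR_conv_of_real mult.commute fun_eq_iff)
  qed
  also have "(\<Sum>k\<le>2*K'. if K' = K \<and> k = m then real_coeff g K' n' k else 0)
      = (if K' = K then real_coeff g K n' m else 0)"
    using m by auto
  also have "\<dots> = (\<Sum>n\<le>2*K. real_coeff g K n m * apoly_fun g (partial (K, n) (Var x)) (y((K, m) := t)))"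
    using x by (auto simp: apoly_fun_zero apoly_fun_one if_distrib[of "\<lambda>z. _ * z"]
        if_distrib[of "\<lambda>z. apoly_fun g z _"] cong: if_cong)
  finally show ?case unfolding x(1) apoly_fun_simps real_point_eq .
next
  case (add f h)
  show ?case
    using has_vector_derivative_add[OF add(3,4)]
    by (simp add: apoly_fun_simps is_derivationD[OF is_derivation_partial] distrib_left sum.distrib)
next
  case (mult f h)
  show ?case
    using has_vector_derivative_mult[OF mult(3,4)]
    by (simp add: apoly_fun_simps is_derivationD[OF is_derivation_partial] distrib_left sum.distrib
        sum_distrib_left sum_distrib_right ac_simps)
qed


end

section \<open>The weighted functional: invariance, adjoints, reality and positivity\<close>

locale weighted_modes = mode_action B + real_form B g N
  for B g N +
  fixes s :: apoly
  assumes s: "s \<in> mode_polys N"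
    and s_invariant: "X \<in> {uH, uXp, uXm} \<Longrightarrow> gen_deriv B X s = 0"
    and weight_integrable: "f \<in> mode_polys N \<Longrightarrow>
      integrable (mode_measure N) (\<lambda>y. exp (- apoly_fun g s y) * apoly_fun g f y)"
begin

definition W :: "apoly \<Rightarrow> complex" where
  "W f = (\<integral>y. exp (- apoly_fun g s y) * apoly_fun g f y \<partial>mode_measure N)"

lemma W_add: "f \<in> mode_polys N \<Longrightarrow> h \<in> mode_polys N \<Longrightarrow> W (f + h) = W f + W h"
  unfolding W_def by (simp add: apoly_fun_simps distrib_left weight_integrable)

lemma W_Const_mult: "W (Const c * f) = c * W f"
  unfolding W_def by (simp add: apoly_fun_simps mult.left_commute)

lemma W_zero: "W 0 = 0"
  by (simp add: W_def apoly_fun_zero)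

lemma W_uminus: "W (- f) = - W f"
  using W_Const_mult[of "-1" f] by simp

lemma W_diff: "f \<in> mode_polys N \<Longrightarrow> h \<in> mode_polys N \<Longrightarrow> W (f - h) = W f - W h"
  using W_add[of f "- h"] by (simp add: W_uminus mode_polys_uminus)

lemma W_sum: "(\<And>i. i \<in> I \<Longrightarrow> f i \<in> mode_polys N) \<Longrightarrow> W (\<Sum>i\<in>I. f i) = (\<Sum>i\<in>I. W (f i))"
  by (induction I rule: infinite_finite_induct) (auto simp: W_zero W_add mode_polys_sum)

text \<open>The derivative of \<open>e\<^sup>-\<^sup>s f\<close> along a real coordinate is again
  \<open>e\<^sup>-\<^sup>s\<close> times a polynomial, called \<open>D f\<close> in the proof. Hence
  both are integrable, and the derivative is continuous because it is differentiable by the same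
  formula.\<close>

lemma W_partial_real:
  assumes f: "f \<in> mode_polys N" and K: "K \<le> N" "m \<le> 2 * K"
  shows "(\<Sum>n\<le>2*K. real_coeff g K n m * W (partial (K, n) f - partial (K, n) s * f)) = 0"
proof -
  define D where "D f = (\<Sum>n\<le>2*K. Const (real_coeff g K n m) * (partial (K, n) f - partial (K, n) s * f))" for f
  have Dm: "D f \<in> mode_polys N" if "f \<in> mode_polys N" for f
    unfolding D_def using that s by (intro mode_polys_intros mode_polys_partial)
  define G where "G f y = exp (- apoly_fun g s y) * apoly_fun g f y" for f y
  have d: "((\<lambda>t. G f (y((K, m) := t))) has_vector_derivative G (D f) (y((K, m) := t))) (at t)"
    if f: "f \<in> mode_polys N" for f y t
  proof -
    let ?y = "\<lambda>t. y((K, m) := t)"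
    let ?d = "\<lambda>f. \<Sum>n\<le>2*K. real_coeff g K n m * apoly_fun g (partial (K, n) f) (?y t)"
    have "((\<lambda>t. exp (- apoly_fun g s (?y t))) has_vector_derivative (- ?d s) * exp (- apoly_fun g s (?y t))) (at t)"
      using field_vector_diff_chain_at[of "\<lambda>t. - apoly_fun g s (?y t)" "- ?d s" t exp "exp (- apoly_fun g s (?y t))"]
        has_vector_derivative_minus[OF apoly_fun_has_derivative[OF s K(2)]] DERIV_exp
      by (simp add: o_def)
    from has_vector_derivative_mult[OF this apoly_fun_has_derivative[OF f K(2)]]
    show ?thesis
      unfolding G_def D_def
      by (rule has_vector_derivative_eq_rhs)
        (simp add: apoly_fun_sum apoly_fun_simps apoly_fun_diff sum_distrib_left sum_distrib_right
          sum_subtractf algebra_simps)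
  qed
  have "(\<integral>y. G (D f) y \<partial>(\<Pi>\<^sub>M x\<in>modes N. lborel)) = 0"
  proof (rule product_integral_derivative_zero[where G = "G f" and i = "(K, m)"])
    show "(K, m) \<in> modes N" using K by (simp add: modes_def)
    show "((\<lambda>t. G f (y((K, m) := t))) has_vector_derivative G (D f) (y((K, m) := t))) (at t)" for y t
      by (rule d[OF f])
    show "continuous_on UNIV (\<lambda>t. G (D f) (y((K, m) := t)))" for y
      by (intro continuous_at_imp_continuous_on ballI has_vector_derivative_continuous[OF d[OF Dm[OF f]]])
    show "integrable (\<Pi>\<^sub>M x\<in>modes N. lborel) (G f)" "integrable (\<Pi>\<^sub>M x\<in>modes N. lborel) (G (D f))"
      using weight_integrable[OF f] weight_integrable[OF Dm[OF f]] by (simp_all add: G_def[abs_def] mode_measure_def)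
  qed simp
  then have "W (D f) = 0" by (simp add: W_def G_def mode_measure_def)
  then show ?thesis
    unfolding D_def using f s
    by (subst (asm) W_sum) (auto simp: W_Const_mult intro!: mode_polys_intros mode_polys_partial)
qed

lemma W_partial:
  assumes f: "f \<in> mode_polys N" and K: "K \<le> N" "k \<le> 2 * K"
  shows "W (partial (K, k) f) = W (partial (K, k) s * f)"
proof -
  define w where "w n = W (partial (K, n) f - partial (K, n) s * f)" for n
  \<comment> \<open>Contracting the real-coordinate identities with the inverse matrix isolates a
    single mode.\<close>
  have "0 = (\<Sum>m\<le>2*K. (\<Sum>n\<le>2*K. real_coeff g K n m * w n) * cnj (real_coeff g K m k))"
    using W_partial_real[OF f K(1)] by (simp add: w_def)
  also have "\<dots> = (\<Sum>n\<le>2*K. w n * (\<Sum>m\<le>2*K. real_coeff g K n m * cnj (real_coeff g K m k)))"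
    unfolding sum_distrib_left sum_distrib_right by (subst sum.swap) (simp add: ac_simps)
  also have "\<dots> = (\<Sum>n\<le>2*K. if n = k then w n else 0)"
    using K by (intro sum.cong refl) (simp add: real_coeff_inverse)
  also have "\<dots> = w k" using K by simp
  finally show ?thesis
    using f s by (simp add: w_def W_diff mode_polys_partial mode_polys_mult)
qed

lemma trace_rep:
  assumes "X \<in> {uH, uXp, uXm}"
  shows "(\<Sum>n\<le>2*K. rep B K X n n) = 0"
proof -
  have "(\<Sum>n\<le>2*K. rep B K X n n)
      = (\<Sum>n\<le>2*K. \<Sum>i\<le>2*K. \<Sum>j\<le>2*K. ent X (2*K) i j * (cnj (B K i n) * B K j n))"
    by (simp add: rep_def ac_simps)
  also have "\<dots> = (\<Sum>i\<le>2*K. \<Sum>j\<le>2*K. \<Sum>n\<le>2*K. ent X (2*K) i j * (cnj (B K i n) * B K j n))"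
    by (rule sum_rotate)
  also have "\<dots> = (\<Sum>i\<le>2*K. \<Sum>j\<le>2*K. if j = i then ent X (2*K) i i else 0)"
    by (intro sum.cong refl) (auto simp: sum_distrib_left[symmetric] unitary_basis_rows[OF unitary])
  also have "\<dots> = (\<Sum>i\<le>2*K. ent X (2*K) i i)" by simp
  also have "\<dots> = 0"
  proof (cases "X = uH")
    case True
    have "(\<Sum>i\<le>n. of_nat n - 2 * of_nat i :: complex) = 0" for n
    proof -
      have "(\<Sum>i\<le>m. 2 * of_nat i :: complex) = of_nat m * (of_nat m + 1)" for m
        by (induction m) (auto simp: algebra_simps)
      then show ?thesis by (simp add: sum_subtractf algebra_simps)
    qed
    from this[of "2 * K"] show ?thesis using True by (simp add: ent_uH)
  next
    case False
    then show ?thesis using assms by (auto simp: ent_uXp ent_uXm)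
  qed
  finally show ?thesis .
qed

text \<open>Integrating the vector field by parts yields its derivative of s, zero by invariance,
  and its divergence, zero because the generators are traceless.\<close>

lemma W_gen_deriv:
  assumes f: "f \<in> mode_polys N" and X: "X \<in> {uH, uXp, uXm}"
  shows "W (gen_deriv B X f) = 0"
proof -
  let ?v = "gen_var B X"
  have v: "?v x \<in> mode_polys N" if "x \<in> modes N" for x using mode_polys_gen_var[OF that] .
  have "W (partial x f * ?v x) = W (partial x s * ?v x * f) - W (f * partial x (?v x))" if x: "x \<in> modes N" for x
  proof -
    have "W (partial x (f * ?v x)) = W (partial x s * (f * ?v x))"
      using x f v by (cases x) (auto simp: modes_def intro!: W_partial mode_polys_intros)
    moreover have "W (partial x (f * ?v x)) = W (partial x f * ?v x) + W (f * partial x (?v x))"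
      using x f v by (simp add: is_derivationD[OF is_derivation_partial] W_add mode_polys_mult mode_polys_partial)
    ultimately show ?thesis by (simp add: algebra_simps)
  qed
  then have "W (gen_deriv B X f) = (\<Sum>x\<in>modes N. W (partial x s * ?v x * f) - W (f * partial x (?v x)))"
    unfolding gen_deriv_eq_sum_partial[OF f] using f v
    by (subst W_sum) (auto intro!: mode_polys_intros mode_polys_partial)
  also have "\<dots> = W (gen_deriv B X s * f) - W (f * (\<Sum>x\<in>modes N. partial x (?v x)))"
    unfolding gen_deriv_eq_sum_partial[OF s] sum_subtractf sum_distrib_left sum_distrib_right using f v s
    by (subst (1 2) W_sum) (auto intro!: mode_polys_intros mode_polys_partial)
  \<comment> \<open>The divergence of a linear vector field is the trace of its matrix.\<close>
  also have "(\<Sum>x\<in>modes N. partial x (?v x)) = 0"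
  proof -
    have "modes N = (SIGMA K:{..N}. {..2 * K})" by (auto simp: modes_def)
    then have "(\<Sum>x\<in>modes N. partial x (?v x)) = (\<Sum>K\<le>N. \<Sum>n\<le>2*K. partial (K, n) (?v (K, n)))"
      by (simp add: sum.Sigma)
    also have "\<dots> = (\<Sum>K\<le>N. Const (\<Sum>n\<le>2*K. rep B K X n n))"
      by (intro sum.cong refl)
        (simp add: gen_var_def is_derivationD[OF is_derivation_partial] Const_sum if_distrib[of "\<lambda>z. z * _"] cong: if_cong)
    finally show ?thesis by (simp add: trace_rep[OF X])
  qed
  finally show ?thesis by (simp add: s_invariant[OF X] W_zero)
qed

lemma W_act:
  assumes "f \<in> mode_polys N"
  shows "W (act B u f) = ueps u * W f"
proof -
  have poly: "W (act B p f) = ueps p * W f" if "p \<in> upoly" "f \<in> mode_polys N" for p f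
    using that
    by (induction arbitrary: f rule: upoly.induct)
      (simp_all add: act_generator W_gen_deriv act_one act_uadd act_uscale act_mult W_add W_Const_mult
        mode_polys_act distrib_right)
  obtain p where "p \<in> upoly" "act B p f = act B u f" "ueps p = ueps u" using upoly_approx by metis
  then show ?thesis using poly[OF _ assms] by metis
qed

text \<open>For a generator, expand the vanishing \<open>W\<close> of its derivative of
  \<open>a\<^sup>* b\<close>; the sign from integration by parts cancels the one in
  \<open>gen_deriv_star\<close>. Products are treated by moving one factor at a time, which reverses
  their order as the star does.\<close>

lemma W_adjoint_act:
  assumes "a \<in> mode_polys N" "b \<in> mode_polys N"
  shows "W (apoly_star g a * act B u b) = W (apoly_star g (act B (ustar u) a) * b)"
proof -
  have gen: "W (apoly_star g a * act B X b) = W (apoly_star g (act B (ustar X) a) * b)"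
    if X: "X \<in> {uH, uXp, uXm}" and ab: "a \<in> mode_polys N" "b \<in> mode_polys N" for X a b
  proof -
    have X': "ustar X \<in> {uH, uXp, uXm}" using X by auto
    have "0 = W (gen_deriv B X (apoly_star g a * b))"
      using X ab by (simp add: W_gen_deriv mode_polys_mult mode_polys_star)
    also have "\<dots> = W (apoly_star g a * gen_deriv B X b) + W (gen_deriv B X (apoly_star g a) * b)"
      using ab by (simp add: gen_deriv_simps W_add mode_polys_mult mode_polys_star mode_polys_gen_deriv)
    also have "gen_deriv B X (apoly_star g a) = - apoly_star g (gen_deriv B (ustar X) a)"
      using gen_deriv_star[OF ab(1) X'] by simp
    also have "W (- apoly_star g (gen_deriv B (ustar X) a) * b) = - W (apoly_star g (gen_deriv B (ustar X) a) * b)"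
      using W_Const_mult[of "-1" "apoly_star g (gen_deriv B (ustar X) a) * b"] by simp
    finally show ?thesis by (simp add: act_generator[OF X] act_generator[OF X'])
  qed
  have poly: "W (apoly_star g a * act B p b) = W (apoly_star g (act B (ustar p) a) * b)"
    if "p \<in> upoly" "a \<in> mode_polys N" "b \<in> mode_polys N" for p a b
    using that
  proof (induction arbitrary: a b rule: upoly.induct)
    case (upoly_scale u c)
    have "W (apoly_star g a * act B (uscale c u) b) = c * W (apoly_star g a * act B u b)"
      by (simp add: act_uscale mult.left_commute W_Const_mult)
    also have "\<dots> = W (apoly_star g (act B (ustar (uscale c u)) a) * b)"
      using upoly_scale by (simp add: act_uscale apoly_star_simps mult.assoc W_Const_mult)
    finally show ?case .
  next
    case (upoly_add u v)
    then show ?case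
      by (simp add: act_uadd distrib_left distrib_right apoly_star_simps W_add mode_polys_act mode_polys_mult mode_polys_star)
  next
    case (upoly_mult u v)
    then show ?case by (simp add: act_mult ustar_mult mode_polys_act)
  qed (use gen[of uH] gen[of uXp] gen[of uXm] in \<open>simp_all add: act_one\<close>)
  obtain p where "p \<in> upoly" "act B p b = act B u b" "act B (ustar p) a = act B (ustar u) a"
    using upoly_approx by metis
  then show ?thesis using poly[OF _ assms] by metis
qed

lemma vac_act_smash_star:
  "vac_act B (smash_star B g Z) a = (\<Sum>\<mu>\<in>keys Z. act B (ustar (lookup Z \<mu>)) (apoly_star g (Mon \<mu>) * a))"
  by (simp add: smash_star_def vac_act_Z_sum commute_past_act)

lemma W_adjoint:
  assumes Z: "Z \<in> smash_modes N" and ab: "a \<in> mode_polys N" "b \<in> mode_polys N"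
  shows "W (apoly_star g a * vac_act B Z b) = W (apoly_star g (vac_act B (smash_star B g Z) a) * b)"
proof -
  have M: "Mon \<mu> \<in> mode_polys N" if "\<mu> \<in> keys Z" for \<mu>
    using Z that by (auto simp: smash_modes_def intro: mode_polys_Mon)
  have "W (apoly_star g a * vac_act B Z b)
      = (\<Sum>\<mu>\<in>keys Z. W (apoly_star g a * (Mon \<mu> * act B (lookup Z \<mu>) b)))"
    unfolding vac_act_def sum_distrib_left using M ab
    by (intro W_sum mode_polys_intros mode_polys_star mode_polys_act)
  also have "\<dots> = (\<Sum>\<mu>\<in>keys Z. W (apoly_star g (act B (ustar (lookup Z \<mu>)) (apoly_star g (Mon \<mu>) * a)) * b))"
  proof (intro sum.cong refl)
    fix \<mu> assume \<mu>: "\<mu> \<in> keys Z"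
    have "apoly_star g a * (Mon \<mu> * act B (lookup Z \<mu>) b)
        = apoly_star g (apoly_star g (Mon \<mu>) * a) * act B (lookup Z \<mu>) b"
      using M[OF \<mu>] by (simp add: apoly_star_simps apoly_star_star ac_simps)
    then show "W (apoly_star g a * (Mon \<mu> * act B (lookup Z \<mu>) b))
        = W (apoly_star g (act B (ustar (lookup Z \<mu>)) (apoly_star g (Mon \<mu>) * a)) * b)"
      using M[OF \<mu>] ab by (simp add: W_adjoint_act mode_polys_mult mode_polys_star)
  qed
  also have "\<dots> = W (apoly_star g (vac_act B (smash_star B g Z) a) * b)"
    unfolding vac_act_smash_star apoly_star_sum sum_distrib_right using M ab
    by (intro W_sum[symmetric] mode_polys_intros mode_polys_star mode_polys_act)
  finally show ?thesis .
qed

text \<open>The element acting as the projection onto the invariants absorbs the \<open>U(su(2))\<close> factors of \<open>Z\<close>,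
  so that \<open>Z\<close> and its star have conjugate symbols on the vacuum.\<close>

lemma star_invariant_symbol:
  assumes Z: "Z \<in> smash_modes N" and self: "smash_star B g Z = Z" and s_eq: "vac_act B Z 1 = s"
  shows "apoly_star g s = s"
proof -
  let ?p = "component (0::nat)"
  \<comment> \<open>The component with label 0 is one-dimensional, so its projection turns every
    factor into its counit.\<close>
  have p: "?p * u = uscale (ueps u) ?p" for u
  proof (rule uhat_ext)
    fix t m n
    have "ent u 0 m n = 0" if "m \<noteq> n" by (rule ent_outside) (use that in auto)
    then show "ent (?p * u) t m n = ent (uscale (ueps u) ?p) t m n"
      by (auto simp: ent_component_mult ent_component ent_one ueps_def ent_outside)
  qed
  have ep: "ueps ?p = 1" by (simp add: ueps_def ent_component ent_one)
  have ps: "act B ?p s = s" using act_invariant[of s ?p] s_invariant ep by simp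
  have "gen_deriv B X (apoly_star g s) = 0" if "X \<in> {uH, uXp, uXm}" for X
  proof -
    have "ustar X \<in> {uH, uXp, uXm}" using that by auto
    from gen_deriv_star[OF s this] s_invariant[OF this] show ?thesis by (simp add: apoly_star_zero)
  qed
  then have ps': "act B ?p (apoly_star g s) = apoly_star g s" using act_invariant ep by simp
  have "s = act B ?p (vac_act B (smash_star B g Z) 1)" using ps self s_eq by simp
  also have "\<dots> = (\<Sum>\<mu>\<in>keys Z. act B (?p * ustar (lookup Z \<mu>)) (apoly_star g (Mon \<mu>)))"
    by (simp add: vac_act_smash_star act_sum act_mult)
  \<comment> \<open>The same scalar \<open>ueps (lookup Z \<mu>)\<close> arises when Z acts on 1, so
    the sum is the star of the symbol s under the projection.\<close>
  also have "\<dots> = (\<Sum>\<mu>\<in>keys Z. act B ?p (apoly_star g (Mon \<mu> * Const (ueps (lookup Z \<mu>)))))"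
    by (simp add: p act_uscale ueps_ustar apoly_star_simps act_Const_mult mult.commute[of _ "Const _"])
  also have "\<dots> = act B ?p (apoly_star g s)"
    by (simp add: s_eq[symmetric] vac_act_def act_unit apoly_star_sum act_sum)
  finally show ?thesis using ps' by simp
qed

lemma W_star:
  assumes "apoly_star g s = s" "f \<in> mode_polys N"
  shows "W (apoly_star g f) = cnj (W f)"
proof -
  have "cnj (apoly_fun g s y) = apoly_fun g s y" for y
    using apoly_fun_star[OF s, of y] assms(1) by simp
  then have "exp (- apoly_fun g s y) * cnj (apoly_fun g f y) = cnj (exp (- apoly_fun g s y) * apoly_fun g f y)" for y
    by (simp add: exp_cnj)
  then show ?thesis
    unfolding W_def apoly_fun_star[OF assms(2)] by (simp only: Bochner_Integration.integral_cnj)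
qed

lemma W_positive:
  assumes "apoly_star g s = s" "f \<in> mode_polys N"
  shows "\<exists>r\<ge>0. W (apoly_star g f * f) = of_real r"
proof -
  have "cnj (apoly_fun g s y) = apoly_fun g s y" for y
    using apoly_fun_star[OF s, of y] assms(1) by simp
  then have re: "apoly_fun g s y = of_real (Re (apoly_fun g s y))" for y
    by (metis Reals_cnj_iff of_real_Re)
  have "exp (- apoly_fun g s y) * apoly_fun g (apoly_star g f * f) y
      = of_real (exp (- Re (apoly_fun g s y)) * (cmod (apoly_fun g f y))\<^sup>2)" for y
    using complex_norm_square[of "apoly_fun g f y"]
    by (subst re) (simp add: apoly_fun_simps apoly_fun_star[OF assms(2)] mult.commute exp_of_real
        flip: of_real_minus)
  then have "W (apoly_star g f * f)
      = of_real (\<integral>y. exp (- Re (apoly_fun g s y)) * (cmod (apoly_fun g f y))\<^sup>2 \<partial>mode_measure N)"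
    unfolding W_def by (simp only: integral_complex_of_real)
  then show ?thesis by (intro exI conjI) (auto intro!: integral_nonneg)
qed

end

section \<open>The exchange relation\<close>

lemma ent_leg1: "f 0 = 0 \<Longrightarrow> ent (leg1 f X) t k l = f (slice X t k l)"
proof -
  assume "f 0 = 0"
  moreover have "slice X t k l = 0" if "\<not> (k \<le> t \<and> l \<le> t)"
    by (rule uhat_ext) (use that in \<open>auto simp: ent_outside\<close>)
  ultimately show ?thesis by (auto simp: leg1_def)
qed

lemma ent_mult_tens_one:
  assumes "p \<le> d"
  shows "ent (X * tens 1 Y) (d, t) x (p, z) = (\<Sum>y\<in>{..t}. ent X (d, t) x (p, y) * ent Y t y z)"
proof -
  have "ent (X * tens 1 Y) (d, t) x (p, z)
      = (\<Sum>y\<in>{..t}. \<Sum>a\<in>{..d}. ent X (d, t) x (a, y) * ent Y t y z * ent 1 d a p)"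
    by (subst sum.swap) (simp add: ent_times sum_atMost_Pair ac_simps)
  then show ?thesis using assms by (simp add: sum_ent_one_right)
qed

lemma sum_matrix_regroup:
  fixes m :: "'x \<Rightarrow> apoly"
  shows "(\<Sum>x\<in>A. Const (\<Sum>y\<in>A. \<Sum>z\<in>A. cb y x * t y z * b z) * m x)
    = (\<Sum>z\<in>A. Const (b z) * (\<Sum>y\<in>A. Const (t y z) * (\<Sum>x\<in>A. Const (cb y x) * m x)))"
proof -
  have "(\<Sum>x\<in>A. Const (\<Sum>y\<in>A. \<Sum>z\<in>A. cb y x * t y z * b z) * m x)
      = (\<Sum>x\<in>A. \<Sum>y\<in>A. \<Sum>z\<in>A. Const (b z) * (Const (t y z) * (Const (cb y x) * m x)))"
    unfolding Const_sum sum_distrib_right by (simp add: ac_simps)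
  also have "\<dots> = (\<Sum>y\<in>A. \<Sum>z\<in>A. \<Sum>x\<in>A. Const (b z) * (Const (t y z) * (Const (cb y x) * m x)))"
    by (rule sum_rotate)
  also have "\<dots> = (\<Sum>z\<in>A. \<Sum>y\<in>A. \<Sum>x\<in>A. Const (b z) * (Const (t y z) * (Const (cb y x) * m x)))"
    by (rule sum.swap)
  finally show ?thesis by (simp add: sum_distrib_left)
qed

context twisted_modes
begin

text \<open>The last factor stays a general polynomial, because in the exchange relation the third
  leg acts on everything to the right of the two exchanged modes.\<close>

definition tprod3 :: "apoly \<Rightarrow> apoly \<Rightarrow> apoly \<Rightarrow> apoly" where
  "tprod3 a b f = tprod R a (tprod R b f)"

lemma tprod3_sum:
  "tprod3 (\<Sum>i\<in>I. f i) b c = (\<Sum>i\<in>I. tprod3 (f i) b c)"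
  "tprod3 a (\<Sum>i\<in>I. f i) c = (\<Sum>i\<in>I. tprod3 a (f i) c)"
  "tprod3 a b (\<Sum>i\<in>I. f i) = (\<Sum>i\<in>I. tprod3 a b (f i))"
  by (simp_all add: tprod3_def tprod_sum_left tprod_sum_right)

lemma tprod3_Const:
  "tprod3 (Const z * a) b c = Const z * tprod3 a b c"
  "tprod3 a (Const z * b) c = Const z * tprod3 a b c"
  "tprod3 a b (Const z * c) = Const z * tprod3 a b c"
  by (simp_all add: tprod3_def tprod_Const_left tprod_Const_right)

abbreviation "W3 \<equiv> cop_right R * tens 1 R"

text \<open>The inner product applies R to the legs two and three. In the outer one, the second leg
  of R acts on a product and is therefore distributed by the coproduct.\<close>

lemma tprod3_intertwiner:
  assumes "poly.intertwiner d \<theta>" "p \<le> d" "poly.intertwiner e \<theta>'" "q \<le> e" "poly.intertwiner c \<theta>''" "r \<le> c"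
  shows "tprod3 (\<theta> p) (\<theta>' q) (\<theta>'' r)
    = (\<Sum>x\<le>d. \<Sum>z\<in>{..(e, c)}. Const (ent W3 (d, e, c) (x, z) (p, q, r)) * (\<theta> x * (\<theta>' (fst z) * \<theta>'' (snd z))))"
proof -
  define CR where "CR x z y = ent (cop_right R) (d, e, c) (x, z) (p, y)" for x z y
  define m where "m z = \<theta>' (fst z) * \<theta>'' (snd z)" for z
  have act: "act B (slice (flip R) d x p) (m y) = (\<Sum>z\<in>{..(e, c)}. Const (CR x z y) * m z)"
    if "y \<in> {..(e, c)}" for x y
    using that assms(3,5)
    by (cases y) (simp add: m_def CR_def act_times tprod_intertwiner sum_atMost_Pair ent_cop_right[OF dense] less_eq_prod_def)
  have "tprod3 (\<theta> p) (\<theta>' q) (\<theta>'' r)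
      = (\<Sum>y\<in>{..(e, c)}. Const (ent R (e, c) y (q, r)) * tprod R (\<theta> p) (m y))"
    using assms by (simp add: tprod3_def tprod_intertwiner tprod_sum_right tprod_Const_right sum_atMost_Pair m_def)
  also have "\<dots> = (\<Sum>y\<in>{..(e, c)}. \<Sum>x\<le>d. \<Sum>z\<in>{..(e, c)}. Const (CR x z y * ent R (e, c) y (q, r)) * (\<theta> x * m z))"
    by (intro sum.cong refl) (simp add: tprod_intertwiner_left[OF assms(1,2)] act sum_distrib_left ac_simps)
  also have "\<dots> = (\<Sum>x\<le>d. \<Sum>z\<in>{..(e, c)}. \<Sum>y\<in>{..(e, c)}. Const (CR x z y * ent R (e, c) y (q, r)) * (\<theta> x * m z))"
    by (rule sum_rotate)
  also have "\<dots> = (\<Sum>x\<le>d. \<Sum>z\<in>{..(e, c)}. Const (ent W3 (d, e, c) (x, z) (p, q, r)) * (\<theta> x * m z))"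
    by (simp only: ent_mult_tens_one[OF assms(2)] CR_def Const_sum sum_distrib_right)
  finally show ?thesis by (simp add: m_def)
qed

abbreviation exchange_matrix :: "(nat \<times> nat \<times> nat) uhat" where
  "exchange_matrix \<equiv> flip213 (tilde_phi F) * pad (tilde_R F) * uinv (tilde_phi F)"

text \<open>By commutativity of the mode algebra, both orders are combinations of the same ordinary
  products, with matrices \<open>W3\<close> and \<open>flip213 W3\<close>;
  \<open>exchange_cocycle\<close> relates these matrices.\<close>

lemma tprod3_exchange_intertwiner:
  assumes "poly.intertwiner d \<theta>" "p \<le> d" "poly.intertwiner e \<theta>'" "q \<le> e" "poly.intertwiner c \<theta>''" "r \<le> c"
  shows "tprod3 (\<theta> p) (\<theta>' q) (\<theta>'' r)
    = (\<Sum>x\<in>{..(d, e, c)}. Const (ent exchange_matrix (d, e, c) x (p, q, r))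
        * tprod3 (\<theta>' (fst (snd x))) (\<theta> (fst x)) (\<theta>'' (snd (snd x))))"
proof -
  define m where "m y = \<theta> (fst y) * (\<theta>' (fst (snd y)) * \<theta>'' (snd (snd y)))" for y
  have sw: "tprod3 (\<theta>' (fst (snd x))) (\<theta> (fst x)) (\<theta>'' (snd (snd x)))
      = (\<Sum>y\<in>{..(d, e, c)}. Const (ent (flip213 W3) (d, e, c) y x) * m y)"
    if "x \<in> {..(d, e, c)}" for x
    using that assms
    by (cases x) (simp add: tprod3_intertwiner[of e \<theta>' _ d \<theta> _ c \<theta>''] sum_atMost_Pair m_def less_eq_prod_def
        sum.swap[of _ "{..e}" "{..d}"] ac_simps)
  have "(\<Sum>x\<in>{..(d, e, c)}. Const (ent exchange_matrix (d, e, c) x (p, q, r))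
        * tprod3 (\<theta>' (fst (snd x))) (\<theta> (fst x)) (\<theta>'' (snd (snd x))))
    = (\<Sum>x\<in>{..(d, e, c)}. \<Sum>y\<in>{..(d, e, c)}.
        Const (ent (flip213 W3) (d, e, c) y x * ent exchange_matrix (d, e, c) x (p, q, r)) * m y)"
    by (intro sum.cong refl) (simp add: sw sum_distrib_left ac_simps)
  also have "\<dots> = (\<Sum>y\<in>{..(d, e, c)}. Const (ent (flip213 W3 * exchange_matrix) (d, e, c) y (p, q, r)) * m y)"
    by (subst sum.swap) (simp only: ent_times[of "flip213 W3"] Const_sum sum_distrib_right)
  also have "flip213 W3 * exchange_matrix = W3"
    by (rule exchange_cocycle[OF dense F])
  also have "(\<Sum>y\<in>{..(d, e, c)}. Const (ent W3 (d, e, c) y (p, q, r)) * m y) = tprod3 (\<theta> p) (\<theta>' q) (\<theta>'' r)"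
    unfolding tprod3_intertwiner[OF assms] by (simp add: sum_atMost_Pair[of _ d] m_def)
  finally show ?thesis by simp
qed

text \<open>Index pairs list \<open>K'\<close> first, the order of the modes after the exchange,
  while the leg of \<open>K\<close> comes first in \<open>exchange_matrix\<close>; this explains the
  crossing of \<open>fst\<close> and \<open>snd\<close>.\<close>

lemma ent_exchange:
  "ent (exchange B F K K' l k i j) c r' r
    = (\<Sum>y\<in>{..(2*K', 2*K)}. \<Sum>z\<in>{..(2*K', 2*K)}. (cnj (B K' (fst y) k) * cnj (B K (snd y) l))
        * ent exchange_matrix (2*K, 2*K', c) (snd y, fst y, r') (snd z, fst z, r) * (B K' (fst z) j * B K (snd z) i))"
proof -
  define T where "T p' q' p q = ent exchange_matrix (2*K, 2*K', c) (p', q', r') (p, q, r)" for p' q' p q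
  have "ent (exchange B F K K' l k i j) c r' r
    = (\<Sum>q'\<le>2*K'. \<Sum>q\<le>2*K'. cnj (B K' q' k) * (\<Sum>p'\<le>2*K. \<Sum>p\<le>2*K. cnj (B K p' l) * T p' q' p q * B K p i) * B K' q j)"
    by (simp add: exchange_def ent_leg1 T_def rep_def[of B K'] rep_def[of B K])
  also have "\<dots> = (\<Sum>q'\<le>2*K'. \<Sum>q\<le>2*K'. \<Sum>p'\<le>2*K. \<Sum>p\<le>2*K.
      (cnj (B K' q' k) * cnj (B K p' l)) * T p' q' p q * (B K' q j * B K p i))"
    by (simp add: sum_distrib_left sum_distrib_right ac_simps)
  also have "\<dots> = (\<Sum>q'\<le>2*K'. \<Sum>p'\<le>2*K. \<Sum>q\<le>2*K'. \<Sum>p\<le>2*K.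
      (cnj (B K' q' k) * cnj (B K p' l)) * T p' q' p q * (B K' q j * B K p i))"
    by (rule sum.cong[OF refl]) (rule sum.swap)
  finally show ?thesis by (simp add: sum_atMost_Pair T_def)
qed

text \<open>Both modes are expanded in weight vectors, where the matrix identity applies, and the
  basis is changed back on the other side. The third leg then becomes the operator
  \<open>exchange\<close> on f.\<close>

lemma tprod3_exchange:
  assumes "i \<le> 2 * K" "j \<le> 2 * K'"
  shows "tprod3 (Var (K, i)) (Var (K', j)) f
    = (\<Sum>k\<le>2*K'. \<Sum>l\<le>2*K. tprod3 (Var (K', k)) (Var (K, l)) (act B (exchange B F K K' l k i j) f))"
proof (induction f rule: intertwiner_induct)
  case zero
  then show ?case by (simp add: tprod3_def tprod_zero_right act_zero)
next
  case (add f h)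
  then show ?case by (simp add: tprod3_def tprod_add_right act_add sum.distrib)
next
  case (intertwiner c \<theta> r)
  let ?A = "{..(2*K', 2*K)}" and ?e = "basis_vec K" and ?e' = "basis_vec K'"
  define t where "t r' y z = ent exchange_matrix (2*K, 2*K', c) (snd y, fst y, r') (snd z, fst z, r)" for r' and y z :: "nat \<times> nat"
  define b where "b z = B K' (fst z) j * B K (snd z) i" for z
  define cb where "cb y x = cnj (B K' (fst y) (fst x)) * cnj (B K (snd y) (snd x))" for x y :: "nat \<times> nat"
  define m where "m r' x = tprod3 (Var (K', fst x)) (Var (K, snd x)) (\<theta> r')" for r' and x :: "nat \<times> nat"
  have basis: "(\<Sum>x\<in>?A. Const (cb y x) * m r' x) = tprod3 (?e' (fst y)) (?e (snd y)) (\<theta> r')" for y r'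
    unfolding basis_vec_def unfolding tprod3_sum(1) unfolding tprod3_sum(2) tprod3_Const
    by (simp add: sum_atMost_Pair cb_def m_def ac_simps)
  have "(\<Sum>k\<le>2*K'. \<Sum>l\<le>2*K. tprod3 (Var (K', k)) (Var (K, l)) (act B (exchange B F K K' l k i j) (\<theta> r)))
      = (\<Sum>x\<in>?A. \<Sum>r'\<le>c. Const (ent (exchange B F K K' (snd x) (fst x) i j) c r' r) * m r' x)"
    by (simp add: sum_atMost_Pair act_intertwiner[OF intertwiner] tprod3_sum tprod3_Const m_def)
  also have "\<dots> = (\<Sum>r'\<le>c. \<Sum>x\<in>?A. Const (\<Sum>y\<in>?A. \<Sum>z\<in>?A. cb y x * t r' y z * b z) * m r' x)"
    unfolding ent_exchange by (subst sum.swap) (simp only: cb_def t_def b_def)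
  also have "\<dots> = (\<Sum>r'\<le>c. \<Sum>z\<in>?A. Const (b z) * (\<Sum>y\<in>?A. Const (t r' y z)
      * tprod3 (?e' (fst y)) (?e (snd y)) (\<theta> r')))"
    unfolding sum_matrix_regroup basis ..
  also have "\<dots> = (\<Sum>z\<in>?A. Const (b z) * (\<Sum>r'\<le>c. \<Sum>y\<in>?A. Const (t r' y z)
      * tprod3 (?e' (fst y)) (?e (snd y)) (\<theta> r')))"
    by (subst sum.swap) (simp only: sum_distrib_left)
  also have "\<dots> = (\<Sum>z\<in>?A. Const (b z) * tprod3 (?e (snd z)) (?e' (fst z)) (\<theta> r))"
  proof (intro sum.cong refl arg_cong[of _ _ "\<lambda>f. Const _ * f"])
    fix z assume "z \<in> ?A"
    then have z: "snd z \<le> 2 * K" "fst z \<le> 2 * K'" by (auto simp: less_eq_prod_def)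
    have "tprod3 (?e (snd z)) (?e' (fst z)) (\<theta> r)
        = (\<Sum>p\<le>2*K. \<Sum>q\<le>2*K'. \<Sum>r'\<le>c. Const (t r' (q, p) z) * tprod3 (?e' q) (?e p) (\<theta> r'))"
      unfolding tprod3_exchange_intertwiner[OF intertwiner_basis_vec z(1) intertwiner_basis_vec z(2) intertwiner]
      by (simp add: sum_atMost_Pair t_def)
    also have "\<dots> = (\<Sum>q\<le>2*K'. \<Sum>p\<le>2*K. \<Sum>r'\<le>c. Const (t r' (q, p) z) * tprod3 (?e' q) (?e p) (\<theta> r'))"
      by (rule sum.swap)
    also have "\<dots> = (\<Sum>r'\<le>c. \<Sum>q\<le>2*K'. \<Sum>p\<le>2*K. Const (t r' (q, p) z) * tprod3 (?e' q) (?e p) (\<theta> r'))"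
      by (rule sum_rotate[symmetric])
    finally show "(\<Sum>r'\<le>c. \<Sum>y\<in>?A. Const (t r' y z) * tprod3 (?e' (fst y)) (?e (snd y)) (\<theta> r'))
        = tprod3 (?e (snd z)) (?e' (fst z)) (\<theta> r)"
      by (simp add: sum_atMost_Pair)
  qed
  also have "\<dots> = (\<Sum>q\<le>2*K'. \<Sum>p\<le>2*K. Const (B K' q j) * (Const (B K p i) * tprod3 (?e p) (?e' q) (\<theta> r)))"
    by (simp add: sum_atMost_Pair b_def ac_simps)
  also have "\<dots> = tprod3 (Var (K, i)) (Var (K', j)) (\<theta> r)"
    unfolding Var_eq_basis_vec[OF assms(1)] Var_eq_basis_vec[OF assms(2)]
    unfolding tprod3_sum(1) unfolding tprod3_sum(2) tprod3_Const by (rule sum.swap)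
  finally show ?case by simp
qed

text \<open>X and Y may be arbitrary: Y only supplies the polynomial on which the exchanged pair
  acts, and X acts linearly afterwards.\<close>

lemma vac_act_exchange:
  assumes "i \<le> 2 * K" "j \<le> 2 * K'"
  shows "vac_act B (smash_prod B [X, hat B F (K, i), hat B F (K', j), Y]) f
    = vac_act B (\<Sum>k\<le>2*K'. \<Sum>l\<le>2*K.
        smash_prod B [X, hat B F (K', k), hat B F (K, l), of_U (exchange B F K K' l k i j), Y]) f"
proof -
  have add: "vac_act B X (\<Sum>i\<in>I. h i) = (\<Sum>i\<in>I. vac_act B X (h i))" for I :: "nat set" and h
    by (induction I rule: infinite_finite_induct) (auto simp: vac_act_zero vac_act_add)
  show ?thesis
    using tprod3_exchange[OF assms, of "vac_act B Y f"]
    by (simp add: vac_act_smash_prod vac_act_Z_sum vac_act_hat vac_act_of_U tprod3_def add)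
qed

end

section \<open>The properties of the correlation functions\<close>

theorem mainTheorem6:
  fixes N :: nat and h h0 :: real
    and \<phi> :: "real \<Rightarrow> uq_gen \<Rightarrow> nat uhat" and F :: "real \<Rightarrow> (nat \<times> nat) uhat"
    and B :: basis_change and g :: forms and S :: nc_poly
  assumes "0 < h0" and "\<bar>h\<bar> < h0"
    and "drinfeld_iso_family h0 \<phi>"
    and "drinfeld_twist_family h0 \<phi> F"
    and "\<forall>h'. \<bar>h'\<bar> < h0 \<longrightarrow> unitary_twist (F h') \<and> minimal_twist h' (F h')"
    and "unitary_basis B"
    and "\<forall>K\<le>N. invariant_form B K (g K)"
    and "S \<in> nc_polys N"
    and "\<forall>u. q_act B (\<phi> h) u S = Poly_Mapping.map ((*) (eps_q u)) S"
    and "smash_star B g (hat_poly B (F h) S) = hat_poly B (F h) S"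
    and "weight_integrable B g N (F h) S"
  shows "\<forall>P\<in>nc_polys N.
      (\<forall>u. corr B g N (F h) S (hat_poly B (F h) (q_act B (\<phi> h) u P))
           = eps_q u * corr B g N (F h) S (hat_poly B (F h) P)) \<and>
      cnj (corr B g N (F h) S (hat_poly B (F h) P))
        = corr B g N (F h) S (smash_star B g (hat_poly B (F h) P)) \<and>
      (\<exists>r\<ge>0. corr B g N (F h) S
         (smash_prod B [smash_star B g (hat_poly B (F h) P), hat_poly B (F h) P]) = of_real r) \<and>
      (\<forall>Q\<in>nc_polys N. \<forall>K\<le>N. \<forall>K'\<le>N. \<forall>i\<le>2*K. \<forall>j\<le>2*K'.
         corr B g N (F h) S
           (smash_prod B [hat_poly B (F h) P, hat B (F h) (K, i), hat B (F h) (K', j), hat_poly B (F h) Q])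
         = corr B g N (F h) S
           (\<Sum>k\<le>2*K'. \<Sum>l\<le>2*K.
              smash_prod B [hat_poly B (F h) P, hat B (F h) (K', k), hat B (F h) (K, l),
                of_U (exchange B (F h) K K' l k i j), hat_poly B (F h) Q])) \<and>
      corr B g N (F h) S (hat_poly B (F h) P) = fun_corr B g N (F h) S (star_poly B (F h) P)"
proof -
  have dense: upoly_dense by (rule upoly_dense_of_drinfeld_iso[OF assms(1,3)])
  have iso: "drinfeld_iso h (\<phi> h)" using assms(2,3) by (simp add: drinfeld_iso_family_def)
  have twist: "drinfeld_twist h (\<phi> h) (F h)" using assms(2,4) by (simp add: drinfeld_twist_family_def)
  interpret twisted_modes B "F h"
    using assms(6) dense twist by unfold_locales (simp_all add: drinfeld_twist_def)
  have q_act: "star_poly B (F h) (q_act B (\<phi> h) u P) = act B (phi_elem (\<phi> h) u) (star_poly B (F h) P)"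
    if "P \<in> nc_polys N" for u P
    using twist by (intro star_poly_q_act[OF iso _ that]) (simp add: drinfeld_twist_def)
  have star_poly_mode_polys: "star_poly B (F h) P \<in> mode_polys N" if "P \<in> nc_polys N" for P
    using mode_polys_vac_act[OF smash_modes_hat_poly[OF that, where F = "F h"] mode_polys_one] by (simp add: vac_act_hat_poly_unit)
  define s where "s = star_poly B (F h) S"
  \<comment> \<open>The action S is invariant under \<open>U\<^sub>q\<close>, while integration by
    parts needs invariance of its symbol under the undeformed generators. The images of \<phi>
    approximate X on all components that act on s.\<close>
  have "act B X s = Const (ueps X) * s" for X
  proof -
    obtain L where L: "\<And>u v. (\<forall>d\<le>L. ent u d = ent v d) \<Longrightarrow> act B u s = act B v s"
      using act_continuous by blast
    obtain u where u: "\<And>d. d \<le> L \<Longrightarrow> ent (phi_elem (\<phi> h) u) d = ent X d"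
      using iso unfolding drinfeld_iso_def by blast
    have "act B X s = act B (phi_elem (\<phi> h) u) s" using L[of X] u by simp
    also have "\<dots> = Const (eps_q u) * s"
      using q_act[OF assms(8), of u] assms(9) by (simp add: s_def star_poly_map)
    \<comment> \<open>The counit reads the component with label 0, which is among those
      approximated.\<close>
    also have "eps_q u = ueps X"
      using ueps_phi_elem[OF iso, of u] u[of 0] by (simp add: ueps_def)
    finally show ?thesis .
  qed
  then have inv: "gen_deriv B X s = 0" if "X \<in> {uH, uXp, uXm}" for X
    using act_generator[OF that, of s] that by auto
  interpret weighted_modes B g N s
    using assms(7,11) star_poly_mode_polys[OF assms(8)] inv
    by unfold_locales (auto simp: s_def weight_integrable_def)
  have W: "fun_corr B g N (F h) S f = W f / W 1" for f
    by (simp only: fun_corr_def weighted_integral_def W_def) (simp only: s_def)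
  have s_real: "apoly_star g s = s"
    using smash_modes_hat_poly[OF assms(8)] assms(10)
    by (rule star_invariant_symbol) (simp add: s_def vac_act_hat_poly_unit)
  have W1: "cnj (W 1) = W 1" using W_star[OF s_real, of 1] by (simp add: apoly_star_one)
  obtain r1 where r1: "r1 \<ge> 0" "W 1 = of_real r1"
    using W_positive[OF s_real, of 1] by (auto simp: apoly_star_one)
  show ?thesis
  proof (intro ballI conjI allI impI)
    fix P assume P: "P \<in> nc_polys N"
    define p where "p = star_poly B (F h) P"
    define Z where "Z = hat_poly B (F h) P"
    have p: "p \<in> mode_polys N" unfolding p_def by (rule star_poly_mode_polys[OF P])
    have Z: "Z \<in> smash_modes N" "vac_act B Z 1 = p"
      unfolding Z_def p_def by (rule smash_modes_hat_poly[OF P], rule vac_act_hat_poly_unit)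
    have star_mode_polys: "vac_act B (smash_star B g Z) f \<in> mode_polys N" if "f \<in> mode_polys N" for f
      unfolding vac_act_smash_star using Z(1) that
      by (intro mode_polys_sum mode_polys_act mode_polys_mult mode_polys_star mode_polys_Mon) (auto simp: smash_modes_def)
    \<comment> \<open>The adjoint relation paired with the vacuum 1. Taking f = 1 gives hermiticity,
      f = p gives positivity.\<close>
    have adj: "W (vac_act B (smash_star B g Z) f) = cnj (W (apoly_star g f * p))" if "f \<in> mode_polys N" for f
      using W_adjoint[OF Z(1) that mode_polys_one] W_star[OF s_real star_mode_polys[OF that]]
      by (simp add: Z(2))
    show "corr B g N (F h) S (hat_poly B (F h) (q_act B (\<phi> h) u P))
        = eps_q u * corr B g N (F h) S (hat_poly B (F h) P)" for u
      by (simp add: corr_def W vac_act_hat_poly_unit q_act[OF P] W_act[OF p[unfolded p_def]] ueps_phi_elem[OF iso])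
    show "cnj (corr B g N (F h) S (hat_poly B (F h) P)) = corr B g N (F h) S (smash_star B g (hat_poly B (F h) P))"
      using adj[of 1] W1 by (simp add: corr_def W Z_def[symmetric] Z(2) apoly_star_one)
    obtain r where r: "r \<ge> 0" "W (apoly_star g p * p) = of_real r"
      using W_positive[OF s_real p] by blast
    \<comment> \<open>The quotient of nonnegative reals is nonnegative, also under the convention
      for a denominator 0.\<close>
    have "corr B g N (F h) S (smash_prod B [smash_star B g Z, Z]) = of_real (r / r1)"
      using adj[OF p] r by (simp add: corr_def W vac_act_smash_prod Z(2) r1)
    then show "\<exists>r\<ge>0. corr B g N (F h) S
         (smash_prod B [smash_star B g (hat_poly B (F h) P), hat_poly B (F h) P]) = of_real r"
      unfolding Z_def using r(1) r1(1) by (metis divide_nonneg_nonneg)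
    show "corr B g N (F h) S (hat_poly B (F h) P) = fun_corr B g N (F h) S (star_poly B (F h) P)"
      by (simp add: corr_def vac_act_hat_poly_unit)
  next
    fix P Q and K K' i j :: nat
    assume "i \<le> 2 * K" "j \<le> 2 * K'"
    then show "corr B g N (F h) S
           (smash_prod B [hat_poly B (F h) P, hat B (F h) (K, i), hat B (F h) (K', j), hat_poly B (F h) Q])
         = corr B g N (F h) S
           (\<Sum>k\<le>2*K'. \<Sum>l\<le>2*K.
              smash_prod B [hat_poly B (F h) P, hat B (F h) (K', k), hat B (F h) (K, l),
                of_U (exchange B (F h) K K' l k i j), hat_poly B (F h) Q])"
      by (simp only: corr_def vac_act_exchange)
  qed
qed

end
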